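(* Let $K_n$ be the set of pairs $(A,B)$ of complex $n\times n$ matrices such that $e_1=(1,0,\dots,0)^T$ is cyclic for $(A,B)$, let $G$ be the subgroup of $GL(n,\mathbb{C})$ of matrices whose first column is $e_1$, acting on $K_n$ by simultaneous conjugation, and let $\mu:K_n\to\mathfrak{g}^*$ be the moment map for this action with respect to the symplectic form $\mathrm{tr}\,dA\wedge dB$, i.e. $\mu(A,B)$ is the projection of $[A,B]$ onto the last $n-1$ rows. Then the action of $G$ on $\mu^{-1}(0)\subset K_n$ is free and proper, and the symplectic quotient $\mu^{-1}(0)/G$ is biholomorphic to the Hilbert scheme $(\mathbb{C}^2)^{[n]}$ of $n$ points in $\mathbb{C}^2$.
   Context: A vector $v\in\mathbb{C}^n$ is cyclic for a pair $(A,B)$ of (not necessarily commuting) $n\times n$ matrices if no proper subspace of $\mathbb{C}^n$ contains $v$ and is invariant under both $A$ and $B$. $\mathfrak{g}$ is the Lie algebra of $G$ (matrices with zero first column), and $\mathfrak{g}^*$ is identified, via the trace pairing, with the space of the last $n-1$ rows of $n\times n$ matrices. *)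

theory Defs
  imports "HOL-Analysis.Analysis" "HOL-Algebra.Group_Action" "HOL-Computational_Algebra.Polynomial"
begin

section \<open>Complex manifolds as spaces with a sheaf of holomorphic functions\<close>

text \<open>
  A complex-analytic structure is recorded as a topology together with the germs of its structure
  sheaf: \<open>Hol X \<phi> p\<close> says that \<open>\<phi>\<close> is holomorphic on some neighbourhood of \<open>p\<close>. A function belongs to
  the sheaf over an open set \<open>U\<close> iff its germ is holomorphic at every point of \<open>U\<close>. The functions
  \<open>\<phi>\<close> are total, but only their values near \<open>p\<close> matter.
\<close>

record 'a holo_space =
  Top :: "'a topology"
  Hol :: "('a \<Rightarrow> complex) \<Rightarrow> 'a \<Rightarrow> bool"

definition holomorphic_map ::
    "'a holo_space \<Rightarrow> 'b holo_space \<Rightarrow> ('a \<Rightarrow> 'b) \<Rightarrow> bool" where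
  "holomorphic_map X Y f \<longleftrightarrow>
     continuous_map (Top X) (Top Y) f \<and>
     (\<forall>p \<in> topspace (Top X). \<forall>\<phi>. Hol Y \<phi> (f p) \<longrightarrow> Hol X (\<phi> \<circ> f) p)"

definition biholomorphic_maps ::
    "'a holo_space \<Rightarrow> 'b holo_space \<Rightarrow> ('a \<Rightarrow> 'b) \<Rightarrow> ('b \<Rightarrow> 'a) \<Rightarrow> bool" where
  "biholomorphic_maps X Y f g \<longleftrightarrow>
     homeomorphic_maps (Top X) (Top Y) f g \<and> holomorphic_map X Y f \<and> holomorphic_map Y X g"

definition open_subspace :: "'a holo_space \<Rightarrow> 'a set \<Rightarrow> 'a holo_space" where
  "open_subspace X V = \<lparr>Top = subtopology (Top X) V, Hol = Hol X\<rparr>"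

text \<open>
  The coordinate space \<open>\<complex>\<^sup>J\<close> for a finite index set \<open>J\<close> consists of the extensional functions on \<open>J\<close>.
  Holomorphic functions of several variables are those that are complex (Frechet) differentiable
  on an open set.
\<close>

definition coord_space :: "'i set \<Rightarrow> ('i \<Rightarrow> complex) topology" where
  "coord_space J = product_topology (\<lambda>_. euclidean) J"

definition complex_differentiable_at ::
    "'i set \<Rightarrow> (('i \<Rightarrow> complex) \<Rightarrow> complex) \<Rightarrow> ('i \<Rightarrow> complex) \<Rightarrow> bool" where
  "complex_differentiable_at J F z \<longleftrightarrow>
     (\<exists>a. ((\<lambda>w. (F w - F z - (\<Sum>j\<in>J. a j * (w j - z j))) / of_real (\<Sum>j\<in>J. cmod (w j - z j)))
             \<longlongrightarrow> 0) (atin (coord_space J) z))"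

definition holomorphic_near ::
    "'i set \<Rightarrow> (('i \<Rightarrow> complex) \<Rightarrow> complex) \<Rightarrow> ('i \<Rightarrow> complex) \<Rightarrow> bool" where
  "holomorphic_near J F z \<longleftrightarrow>
     (\<exists>U. openin (coord_space J) U \<and> z \<in> U \<and> (\<forall>w\<in>U. complex_differentiable_at J F w))"

definition affine_space :: "nat \<Rightarrow> (nat \<Rightarrow> complex) holo_space" where
  "affine_space d = \<lparr>Top = coord_space {..<d}, Hol = holomorphic_near {..<d}\<rparr>"

definition complex_manifold :: "'a holo_space \<Rightarrow> bool" where
  "complex_manifold X \<longleftrightarrow>
     Hausdorff_space (Top X) \<and> second_countable (Top X) \<and>
     (\<exists>d. \<forall>p \<in> topspace (Top X). \<exists>V W f g.
        openin (Top X) V \<and> p \<in> V \<and> openin (Top (affine_space d)) W \<and>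
        biholomorphic_maps (open_subspace X V) (open_subspace (affine_space d) W) f g)"

definition biholomorphic :: "'a holo_space \<Rightarrow> 'b holo_space \<Rightarrow> bool" where
  "biholomorphic X Y \<longleftrightarrow>
     complex_manifold X \<and> complex_manifold Y \<and> (\<exists>f g. biholomorphic_maps X Y f g)"

text \<open>
  Near \<open>p\<close>, the function \<open>\<phi>\<close> is a holomorphic function of finitely many of the coordinate functions
  \<open>c i\<close>. If the \<open>c i\<close> embed a space as a locally closed analytic subset of a coordinate space, these
  are the local restrictions of ambient holomorphic functions.
\<close>

definition holomorphic_in_coords ::
    "'a topology \<Rightarrow> ('i \<Rightarrow> 'a \<Rightarrow> complex) \<Rightarrow> ('a \<Rightarrow> complex) \<Rightarrow> 'a \<Rightarrow> bool" where
  "holomorphic_in_coords T c \<phi> p \<longleftrightarrow>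
     (\<exists>J F V. finite J \<and> holomorphic_near J F (\<lambda>j\<in>J. c j p) \<and>
        openin T V \<and> p \<in> V \<and> (\<forall>q\<in>V. \<phi> q = F (\<lambda>j\<in>J. c j q)))"

text \<open>
  The quotient structure along a surjection \<open>\<pi>\<close>: quotient topology, and a function is holomorphic
  iff its pullback is.
\<close>

definition quotient_top :: "'a topology \<Rightarrow> ('a \<Rightarrow> 'b) \<Rightarrow> 'b topology" where
  "quotient_top T \<pi> =
     topology (\<lambda>U. U \<subseteq> \<pi> ` topspace T \<and> openin T {p \<in> topspace T. \<pi> p \<in> U})"

lemma openin_quotient_top:
  "openin (quotient_top T \<pi>) U \<longleftrightarrow>
     U \<subseteq> \<pi> ` topspace T \<and> openin T {p \<in> topspace T. \<pi> p \<in> U}"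
proof -
  have "istopology (\<lambda>U. U \<subseteq> \<pi> ` topspace T \<and> openin T {p \<in> topspace T. \<pi> p \<in> U})"
    unfolding istopology_def
  proof (intro conjI allI impI)
    fix S U
    assume "S \<subseteq> \<pi> ` topspace T \<and> openin T {p \<in> topspace T. \<pi> p \<in> S}"
      and "U \<subseteq> \<pi> ` topspace T \<and> openin T {p \<in> topspace T. \<pi> p \<in> U}"
    moreover have "{p \<in> topspace T. \<pi> p \<in> S \<inter> U} =
        {p \<in> topspace T. \<pi> p \<in> S} \<inter> {p \<in> topspace T. \<pi> p \<in> U}" by auto
    ultimately show "S \<inter> U \<subseteq> \<pi> ` topspace T" "openin T {p \<in> topspace T. \<pi> p \<in> S \<inter> U}"
      by auto
  next
    fix K
    assume K: "\<forall>S\<in>K. S \<subseteq> \<pi> ` topspace T \<and> openin T {p \<in> topspace T. \<pi> p \<in> S}"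
    then show "\<Union>K \<subseteq> \<pi> ` topspace T" by blast
    have "{p \<in> topspace T. \<pi> p \<in> \<Union>K} = (\<Union>S\<in>K. {p \<in> topspace T. \<pi> p \<in> S})" by auto
    with K show "openin T {p \<in> topspace T. \<pi> p \<in> \<Union>K}" by auto
  qed
  then show ?thesis by (simp add: quotient_top_def topology_inverse')
qed

definition quotient_space :: "'a holo_space \<Rightarrow> ('a \<Rightarrow> 'b) \<Rightarrow> 'b holo_space" where
  "quotient_space X \<pi> =
     \<lparr>Top = quotient_top (Top X) \<pi>,
      Hol = (\<lambda>\<phi> y. \<exists>U. openin (quotient_top (Top X) \<pi>) U \<and> y \<in> U \<and>
               (\<forall>p \<in> topspace (Top X). \<pi> p \<in> U \<longrightarrow> Hol X (\<phi> \<circ> \<pi>) p))\<rparr>"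


section \<open>Free and proper actions\<close>

definition free_action :: "('g, 'm) monoid_scheme \<Rightarrow> 'a set \<Rightarrow> ('g \<Rightarrow> 'a \<Rightarrow> 'a) \<Rightarrow> bool" where
  "free_action G E \<phi> \<longleftrightarrow>
     group_action G E \<phi> \<and> (\<forall>x\<in>E. stabilizer G \<phi> x = {one G})"

text \<open>
  Properness: \<open>(g, x) \<mapsto> (g \<cdot> x, x)\<close> is a proper map \<open>G \<times> E \<rightarrow> E \<times> E\<close>. The library's \<^const>\<open>proper_map\<close>
  (closed with compact fibres) does not include continuity.
\<close>

definition proper_action ::
    "('g::topological_space, 'm) monoid_scheme \<Rightarrow> 'a::topological_space set \<Rightarrow>
     ('g \<Rightarrow> 'a \<Rightarrow> 'a) \<Rightarrow> bool" where
  "proper_action G E \<phi> \<longleftrightarrow>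
     group_action G E \<phi> \<and>
     continuous_map (top_of_set (carrier G \<times> E)) (top_of_set (E \<times> E)) (\<lambda>(g, x). (\<phi> g x, x)) \<and>
     proper_map (top_of_set (carrier G \<times> E)) (top_of_set (E \<times> E)) (\<lambda>(g, x). (\<phi> g x, x))"


section \<open>Pairs of matrices\<close>

text \<open>
  The index type of the \<open>n \<times> n\<close> matrices is any finite linearly ordered type \<open>'n\<close> with \<open>n\<close> elements;
  its least element plays the role of the index 1.
\<close>

type_synonym 'n cmat = "complex^'n^'n"

type_synonym 'n mat_pair = "'n cmat \<times> 'n cmat"

definition first :: "'n::{finite,linorder}" where
  "first = Min UNIV"

definition e1 :: "complex^'n::{finite,linorder}" where
  "e1 = axis first 1"

definition cyclic_vector :: "complex^'n::finite \<Rightarrow> 'n cmat \<Rightarrow> 'n cmat \<Rightarrow> bool" where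
  "cyclic_vector v A B \<longleftrightarrow>
     \<not> (\<exists>S. vec.subspace S \<and> S \<noteq> UNIV \<and> v \<in> S \<and> (\<forall>w\<in>S. A *v w \<in> S \<and> B *v w \<in> S))"

definition cyclic_pairs :: "'n::{finite,linorder} mat_pair set" where
  "cyclic_pairs = {(A, B). cyclic_vector e1 A B}"

definition stab_group :: "'n::{finite,linorder} cmat monoid" where
  "stab_group = \<lparr>carrier = {g. invertible g \<and> column first g = e1}, mult = (**), one = mat 1\<rparr>"

definition conj_action ::
    "'n::finite mat_pair set \<Rightarrow> 'n cmat \<Rightarrow> 'n mat_pair \<Rightarrow> 'n mat_pair" where
  "conj_action E g = (\<lambda>(A, B)\<in>E. (g ** A ** matrix_inv g, g ** B ** matrix_inv g))"

definition commutator :: "'n::finite cmat \<Rightarrow> 'n cmat \<Rightarrow> 'n cmat" where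
  "commutator A B = A ** B - B ** A"

text \<open>
  The space of the last \<open>n - 1\<close> rows of \<open>n \<times> n\<close> matrices is represented by the matrices whose first
  row vanishes.
\<close>

definition moment_map :: "'n::{finite,linorder} mat_pair \<Rightarrow> 'n cmat" where
  "moment_map = (\<lambda>(A, B). \<chi> i j. if i = first then 0 else commutator A B $ i $ j)"

definition zero_level :: "'n::{finite,linorder} mat_pair set" where
  "zero_level = {p \<in> cyclic_pairs. moment_map p = 0}"

text \<open>
  \<^const>\<open>moment_map\<close> is the moment map of the conjugation action: for \<open>\<xi>\<close> in the Lie algebra of
  \<^const>\<open>stab_group\<close>, the function \<open>p \<mapsto> tr (\<xi> \<mu>(p))\<close> is a Hamiltonian of the fundamental vector field
  \<open>(A, B) \<mapsto> ([\<xi>, A], [\<xi>, B])\<close> with respect to \<open>tr dA \<and> dB\<close>.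
\<close>

definition symplectic_form :: "'n::finite mat_pair \<Rightarrow> 'n mat_pair \<Rightarrow> complex" where
  "symplectic_form = (\<lambda>(a, b) (a', b'). trace (a ** b') - trace (a' ** b))"

definition fundamental_field :: "'n::finite cmat \<Rightarrow> 'n mat_pair \<Rightarrow> 'n mat_pair" where
  "fundamental_field \<xi> = (\<lambda>(A, B). (commutator \<xi> A, commutator \<xi> B))"

lemma moment_map_hamiltonian:
  fixes \<xi> :: "'n::{finite,linorder} cmat"
  assumes "column first \<xi> = 0"
  shows "((\<lambda>p. trace (\<xi> ** moment_map p)) has_derivative symplectic_form (fundamental_field \<xi> p)) (at p)"
proof -
  have \<xi>: "\<xi> $ i $ first = 0" for i
    using assms by (simp add: column_def vec_eq_iff)
  have eq: "trace (\<xi> ** moment_map q) = trace (\<xi> ** commutator (fst q) (snd q))" for q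
    unfolding trace_def matrix_matrix_mult_def moment_map_def
    by (auto simp: \<xi> case_prod_beta intro!: sum.cong)
  have trm: "trace (X ** (Y ** Z)) = trace (Z ** (X ** Y))" for X Y Z :: "'n cmat"
    by (metis matrix_mul_assoc trace_mul_sym)
  have sub: "trace (\<xi> ** (X - Y)) = trace (\<xi> ** X) - trace (\<xi> ** Y)" for X Y :: "'n cmat"
    by (simp add: trace_def matrix_matrix_mult_def algebra_simps sum_subtractf)
  have mm: "((\<lambda>q. trace (\<xi> ** (f q ** g q))) has_derivative
        (\<lambda>v. trace (\<xi> ** (f p ** g v)) + trace (\<xi> ** (f v ** g p)))) (at p)"
    if "f = fst \<and> g = snd \<or> f = snd \<and> g = fst" for f g :: "'n mat_pair \<Rightarrow> 'n cmat"
  proof -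
    have bl: "bounded_linear f" "bounded_linear g"
      using that bounded_linear_fst bounded_linear_snd by auto
    have d: "((\<lambda>q. f q $ i $ j) has_derivative (\<lambda>v. f v $ i $ j)) (at p)"
      "((\<lambda>q. g q $ i $ j) has_derivative (\<lambda>v. g v $ i $ j)) (at p)" for i j
      by (intro bounded_linear.has_derivative[OF bounded_linear_vec_nth]
          bounded_linear_imp_has_derivative bl)+
    have "((\<lambda>q. \<Sum>i\<in>UNIV. \<Sum>j\<in>UNIV. \<xi> $ i $ j * (\<Sum>k\<in>UNIV. f q $ j $ k * g q $ k $ i))
        has_derivative (\<lambda>v. \<Sum>i\<in>UNIV. \<Sum>j\<in>UNIV. \<xi> $ i $ j *
          (\<Sum>k\<in>UNIV. f p $ j $ k * g v $ k $ i + f v $ j $ k * g p $ k $ i))) (at p)"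
      by (intro has_derivative_sum has_derivative_mult_right has_derivative_mult d)
    then show ?thesis
      by (simp add: trace_def matrix_matrix_mult_def sum.distrib distrib_left)
  qed
  have "((\<lambda>q. trace (\<xi> ** (fst q ** snd q)) - trace (\<xi> ** (snd q ** fst q))) has_derivative
      (\<lambda>v. (trace (\<xi> ** (fst p ** snd v)) + trace (\<xi> ** (fst v ** snd p))) -
           (trace (\<xi> ** (snd p ** fst v)) + trace (\<xi> ** (snd v ** fst p))))) (at p)"
    by (intro has_derivative_diff mm) auto
  moreover have "(trace (\<xi> ** (fst p ** snd v)) + trace (\<xi> ** (fst v ** snd p))) -
       (trace (\<xi> ** (snd p ** fst v)) + trace (\<xi> ** (snd v ** fst p)))
     = symplectic_form (fundamental_field \<xi> p) v" for v
  proof -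
    have s1: "trace ((X - Y) ** Z) = trace (X ** Z) - trace (Y ** Z)"
      and s2: "trace (Z ** (X - Y)) = trace (Z ** X) - trace (Z ** Y)" for X Y Z :: "'n cmat"
      by (simp_all add: trace_def matrix_matrix_mult_def algebra_simps sum_subtractf)
    show ?thesis
      by (simp add: symplectic_form_def fundamental_field_def commutator_def case_prod_beta s1 s2
          matrix_mul_assoc[symmetric] trm[of "fst v" "snd p" \<xi>] trm[of \<xi> "snd p" "fst v"]
          trm[of \<xi> "snd v" "fst p"])
  qed
  ultimately show ?thesis
    by (simp add: eq commutator_def sub)
qed

definition entry :: "bool \<times> 'n::finite \<times> 'n \<Rightarrow> 'n mat_pair \<Rightarrow> complex" where
  "entry = (\<lambda>(s, i, j) (A, B). (if s then B else A) $ i $ j)"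

definition matrix_space :: "'n::finite mat_pair set \<Rightarrow> 'n mat_pair holo_space" where
  "matrix_space E = \<lparr>Top = top_of_set E, Hol = holomorphic_in_coords (top_of_set E) entry\<rparr>"

text \<open>The points are the \<^const>\<open>orbits\<close> of the group in the zero level.\<close>

definition symplectic_quotient :: "'n::{finite,linorder} mat_pair set holo_space" where
  "symplectic_quotient =
     quotient_space (matrix_space zero_level) (orbit stab_group (conj_action zero_level))"


section \<open>The Hilbert scheme of points in the plane\<close>

text \<open>
  \<open>\<complex>[x, y]\<close> is the type \<^typ>\<open>complex poly poly\<close>. The points of the Hilbert scheme are the ideals \<open>I\<close>
  with \<open>dim \<complex>[x, y]/I = n\<close>.
\<close>

definition poly_ideal :: "complex poly poly set \<Rightarrow> bool" where
  "poly_ideal I \<longleftrightarrow> 0 \<in> I \<and> (\<forall>f\<in>I. \<forall>g\<in>I. f + g \<in> I) \<and> (\<forall>f\<in>I. \<forall>h. h * f \<in> I)"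

text \<open>The classes of \<open>b 0, \<dots>, b (n - 1)\<close> form a basis of the complex vector space \<open>\<complex>[x, y]/I\<close>.\<close>

definition quotient_basis ::
    "nat \<Rightarrow> (nat \<Rightarrow> complex poly poly) \<Rightarrow> complex poly poly set \<Rightarrow> bool" where
  "quotient_basis n b I \<longleftrightarrow>
     (\<forall>f. \<exists>!a. a \<in> {..<n} \<rightarrow>\<^sub>E UNIV \<and> f - (\<Sum>k<n. smult [:a k:] (b k)) \<in> I)"

definition basis_coeff ::
    "nat \<Rightarrow> (nat \<Rightarrow> complex poly poly) \<Rightarrow> complex poly poly \<times> nat \<Rightarrow> complex poly poly set \<Rightarrow> complex"
  where
  "basis_coeff n b = (\<lambda>(f, k) I.
     (THE a. a \<in> {..<n} \<rightarrow>\<^sub>E UNIV \<and> f - (\<Sum>k<n. smult [:a k:] (b k)) \<in> I) k)"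

definition hilb_points :: "nat \<Rightarrow> complex poly poly set set" where
  "hilb_points n = {I. poly_ideal I \<and> (\<exists>b. quotient_basis n b I)}"

text \<open>
  The standard affine open subscheme \<open>U\<^sub>b\<close> of the Hilbert scheme, on which \<open>b\<close> is a basis of the
  tautological bundle with fibre \<open>\<complex>[x, y]/I\<close>. Its coordinate ring is generated by the coefficient
  functions of \<open>f = \<Sum>\<^sub>k c\<^bsub>f,k\<^esub> b\<^sub>k mod I\<close>, i.e. by the functions \<^term>\<open>basis_coeff n b (f, k)\<close>.
\<close>

definition hilb_chart :: "nat \<Rightarrow> (nat \<Rightarrow> complex poly poly) \<Rightarrow> complex poly poly set set" where
  "hilb_chart n b = {I. poly_ideal I \<and> quotient_basis n b I}"

text \<open>
  The classical (analytic) topology: the \<open>U\<^sub>b\<close> are open and carry the coarsest topology for which the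
  coefficient functions are continuous. The quantifier over \<open>k\<close> makes this right for \<open>n = 0\<close> too.
\<close>

definition hilb_top :: "nat \<Rightarrow> complex poly poly set topology" where
  "hilb_top n = topology_generated_by
     {{I \<in> hilb_chart n b. \<forall>k<n. basis_coeff n b (f, k) I \<in> W k} | b f W. \<forall>k. open (W k)}"

text \<open>
  The analytic structure: on \<open>U\<^sub>b\<close>, holomorphic functions are locally holomorphic functions of
  finitely many coefficient functions. As the Hilbert scheme of points on a smooth surface is
  smooth, in particular reduced, its analytic structure sheaf is a sheaf of functions on the set of
  points.
\<close>

definition hilbert_scheme :: "nat \<Rightarrow> complex poly poly set holo_space" where
  "hilbert_scheme n =
     \<lparr>Top = hilb_top n,
      Hol = (\<lambda>\<phi> I. \<exists>b. I \<in> hilb_chart n b \<and>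
               holomorphic_in_coords (subtopology (hilb_top n) (hilb_chart n b))
                 (basis_coeff n b) \<phi> I)\<rparr>"

end

theory Submission
  imports Defs
begin

text \<open>
  If \<open>[A, B]\<close> has image in the line spanned by the cyclic vector \<open>e\<^sub>1\<close>, a trace computation shows
  \<open>[A, B] = 0\<close>. So the zero level consists of the commuting pairs with cyclic vector \<open>e\<^sub>1\<close>, and
  \<open>(A, B) \<mapsto> I = {f. f(A, B) e\<^sub>1 = 0}\<close> identifies its orbits with the ideals of codimension \<open>n\<close>: a basis
  \<open>b\<close> of \<open>\<complex>[x, y]/I\<close> with \<open>b\<^sub>1 = 1\<close> turns \<open>I\<close> into the pair of multiplication matrices by \<open>x\<close> and \<open>y\<close>. The
  matrix with columns \<open>b\<^sub>j(A, B) e\<^sub>1\<close> is translated by the group, so that group elements can be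
  recovered from pairs of points; this gives properness, hence the Hausdorff property. The
  multiplication matrices are entries of coefficient functions, and conversely the coefficient
  functions are rational in \<open>A\<close> and \<open>B\<close>, so the two analytic structures agree. For smoothness,
  the chart of \<open>b\<close> is cut out of the space of all pairs by the equations \<open>\<mu>(A, B) = 0\<close> and
  \<open>b\<^sub>j(A, B) e\<^sub>1 = e\<^sub>j\<close>, whose differentials are independent because the action is free and
  \<open>\<mu>\<close> is its moment map.
\<close>


section \<open>Holomorphic functions on coordinate spaces\<close>

text \<open>The Hilbert scheme is a bare set of ideals with coefficient functions, so its Hausdorff
  property, countability and smoothness are all read off from matrices. The link is that the orbit
  projection and \<open>ideal_of\<close> are quotient maps of one zero level with the same fibres:
  bijection, continuity and holomorphy follow formally, and the manifold structure is proved on the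
  Hilbert side and transported back. The trace computation rests on C = [A, B] having one nonzero
  row: then tr(U C V C) = tr(U C) tr(V C), so exchanging two letters of a word costs a product of
  traces of shorter words. There are only 2(n^2 - n) slice equations, because the first row of the
  moment map and, as b_1 = 1, the first column of the frame condition vanish identically. The 2n
  vacant positions are filled with linear functions; this gives a square system for the inverse
  function theorem, and the added functions become the coordinates. That theorem is real; the
  inverse is holomorphic because the derivative of a polynomial map commutes with complex scalars,
  and so does its inverse.\<close>

abbreviation (input) l1_dist :: "'i set \<Rightarrow> ('i \<Rightarrow> complex) \<Rightarrow> ('i \<Rightarrow> complex) \<Rightarrow> real" where
  "l1_dist J w z \<equiv> (\<Sum>j\<in>J. cmod (w j - z j))"

section \<open>Polydisc neighbourhoods and an epsilon form of complex differentiability\<close>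

lemma topspace_coord_space [simp]: "topspace (coord_space J) = extensional J"
  by (simp add: coord_space_def PiE_def)

definition cbox_near :: "'i set \<Rightarrow> ('i \<Rightarrow> complex) \<Rightarrow> real \<Rightarrow> ('i \<Rightarrow> complex) set" where
  "cbox_near J z d = {w \<in> extensional J. \<forall>j\<in>J. cmod (w j - z j) < d}"

text \<open>Only finitely many coordinates are constrained, so the radii of the factors of a basic
  open box have a positive minimum.\<close>

lemma openin_coord_space_iff:
  assumes "finite J"
  shows "openin (coord_space J) U \<longleftrightarrow> U \<subseteq> extensional J \<and> (\<forall>z\<in>U. \<exists>d>0. cbox_near J z d \<subseteq> U)"
    (is "_ \<longleftrightarrow> ?R")
proof
  assume U: "openin (coord_space J) U"
  show ?R
  proof (intro conjI ballI)
    show "U \<subseteq> extensional J" using openin_subset[OF U] by simp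
    fix z assume "z \<in> U"
    then obtain V where V: "\<And>j. j \<in> J \<Longrightarrow> open (V j)" "z \<in> Pi\<^sub>E J V" "Pi\<^sub>E J V \<subseteq> U"
      using U unfolding coord_space_def openin_product_topology_alt by (metis open_openin)
    have "\<forall>j\<in>J. \<exists>d>0. ball (z j) d \<subseteq> V j"
      using V by (auto simp: open_contains_ball PiE_iff)
    then obtain d where d: "\<And>j. j \<in> J \<Longrightarrow> d j > 0 \<and> ball (z j) (d j) \<subseteq> V j"
      by metis
    \<comment> \<open>The inserted \<open>1\<close> keeps \<open>Min\<close> defined when
      \<open>J\<close> is empty; the same device recurs below.\<close>
    define e where "e = Min (insert 1 (d ` J))"
    have e: "e > 0" "\<And>j. j \<in> J \<Longrightarrow> e \<le> d j"
      using assms d by (auto simp: e_def)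
    have "cbox_near J z e \<subseteq> Pi\<^sub>E J V"
    proof
      fix w assume w: "w \<in> cbox_near J z e"
      have "w j \<in> V j" if "j \<in> J" for j
      proof -
        have "w j \<in> ball (z j) (d j)"
          using w e(2)[OF that] that by (force simp: cbox_near_def dist_norm norm_minus_commute)
        then show ?thesis using d[OF that] by blast
      qed
      then show "w \<in> Pi\<^sub>E J V" using w by (auto simp: PiE_iff cbox_near_def)
    qed
    then show "\<exists>d>0. cbox_near J z d \<subseteq> U" using V(3) e(1) by blast
  qed
next
  assume R: ?R
  show "openin (coord_space J) U"
    unfolding coord_space_def openin_product_topology_alt
  proof
    fix z assume "z \<in> U"
    then obtain d where d: "d > 0" "cbox_near J z d \<subseteq> U"
      using R by blast
    have "z \<in> Pi\<^sub>E J (\<lambda>j. ball (z j) d)"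
      using \<open>z \<in> U\<close> R d by (auto simp: PiE_iff)
    moreover have "Pi\<^sub>E J (\<lambda>j. ball (z j) d) \<subseteq> U"
      by (rule order_trans[OF _ d(2)]) (auto simp: PiE_iff cbox_near_def dist_norm norm_minus_commute)
    ultimately show "\<exists>Ua. finite {i \<in> J. Ua i \<noteq> topspace euclidean} \<and>
        (\<forall>i\<in>J. openin euclidean (Ua i)) \<and> z \<in> Pi\<^sub>E J Ua \<and> Pi\<^sub>E J Ua \<subseteq> U"
      using assms by (intro exI[of _ "\<lambda>j. ball (z j) d"]) auto
  qed
qed

lemma openin_cbox_near:
  assumes "finite J"
  shows "openin (coord_space J) (cbox_near J z d)"
  unfolding openin_coord_space_iff[OF assms]
proof (intro conjI ballI)
  fix w assume w: "w \<in> cbox_near J z d"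
  define e where "e = Min (insert 1 ((\<lambda>j. d - cmod (w j - z j)) ` J))"
  have e: "e > 0" "\<And>j. j \<in> J \<Longrightarrow> e \<le> d - cmod (w j - z j)"
    using assms w by (auto simp: e_def cbox_near_def)
  have "v \<in> cbox_near J z d" if v: "v \<in> cbox_near J w e" for v
    unfolding cbox_near_def
  proof (intro CollectI conjI ballI)
    fix j assume "j \<in> J"
    have "cmod (v j - z j) \<le> cmod (v j - w j) + cmod (w j - z j)"
      using norm_triangle_ineq[of "v j - w j" "w j - z j"] by simp
    also have "\<dots> < d" using v e(2)[OF \<open>j \<in> J\<close>] \<open>j \<in> J\<close> by (fastforce simp: cbox_near_def)
    finally show "cmod (v j - z j) < d" .
  qed (use v in \<open>auto simp: cbox_near_def\<close>)
  with e show "\<exists>d'>0. cbox_near J w d' \<subseteq> cbox_near J z d"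
    by blast
qed (auto simp: cbox_near_def)

lemma cbox_near_self: "z \<in> extensional J \<Longrightarrow> d > 0 \<Longrightarrow> z \<in> cbox_near J z d"
  by (simp add: cbox_near_def)

lemma cbox_near_mono: "d \<le> e \<Longrightarrow> cbox_near J z d \<subseteq> cbox_near J z e"
  by (auto simp: cbox_near_def)

text \<open>Multiplying the difference quotient by its denominator gives an estimate that also holds
  at \<open>w = z\<close>, so punctured neighbourhoods and division disappear from the later
  estimates.\<close>

lemma complex_differentiable_at_iff:
  assumes J: "finite J" and z: "z \<in> extensional J"
  shows "complex_differentiable_at J F z \<longleftrightarrow>
    (\<exists>a. \<forall>e>0. \<exists>d>0. \<forall>w\<in>cbox_near J z d.
      cmod (F w - F z - (\<Sum>j\<in>J. a j * (w j - z j))) \<le> e * l1_dist J w z)"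
proof -
  \<comment> \<open>Extensional functions that agree on \<open>J\<close> are equal, so the
    denominator vanishes at \<open>z\<close> only.\<close>
  have S0: "l1_dist J w z > 0" if "w \<in> extensional J" "w \<noteq> z" for w
  proof -
    have "\<exists>j\<in>J. w j \<noteq> z j"
      using that z extensionalityI[of w J z] by blast
    then obtain j where "j \<in> J" "w j \<noteq> z j" by blast
    then show ?thesis using J by (intro sum_pos2[of J j]) auto
  qed
  have "((\<lambda>w. (F w - F z - (\<Sum>j\<in>J. a j * (w j - z j))) / of_real (l1_dist J w z))
             \<longlongrightarrow> 0) (atin (coord_space J) z) \<longleftrightarrow>
      (\<forall>e>0. \<exists>d>0. \<forall>w\<in>cbox_near J z d.
      cmod (F w - F z - (\<Sum>j\<in>J. a j * (w j - z j))) \<le> e * l1_dist J w z)"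
    (is "?L \<longleftrightarrow> ?R") for a
  proof
    assume ?L
    show ?R
    proof (intro allI impI)
      fix e :: real assume "e > 0"
      then obtain U where U: "openin (coord_space J) U" "z \<in> U" and
        *: "\<And>w. w \<in> U - {z} \<Longrightarrow>
          dist ((F w - F z - (\<Sum>j\<in>J. a j * (w j - z j))) / of_real (l1_dist J w z)) 0 < e"
        using \<open>?L\<close> z unfolding tendsto_iff eventually_atin by force
      obtain d where d: "d > 0" "cbox_near J z d \<subseteq> U"
        using U by (auto simp: openin_coord_space_iff[OF J])
      have "cmod (F w - F z - (\<Sum>j\<in>J. a j * (w j - z j))) \<le> e * l1_dist J w z"
        if w: "w \<in> cbox_near J z d" for w
      proof (cases "w = z")
        case False
        have S: "l1_dist J w z > 0"
          using S0 False w by (auto simp: cbox_near_def)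
        have "cmod (F w - F z - (\<Sum>j\<in>J. a j * (w j - z j))) / l1_dist J w z < e"
          using *[of w] w d False S by (auto simp: norm_divide simp flip: of_real_sum)
        then show ?thesis using S by (simp add: field_simps)
      qed simp
      with d show "\<exists>d>0. \<forall>w\<in>cbox_near J z d.
         cmod (F w - F z - (\<Sum>j\<in>J. a j * (w j - z j))) \<le> e * l1_dist J w z"
        by blast
    qed
  next
    assume R: ?R
    show ?L
      unfolding tendsto_iff eventually_atin
    proof (intro allI impI disjI2)
      fix e :: real assume "e > 0"
      \<comment> \<open>\<open>e/2\<close> turns the weak estimate into the strict one that
        \<open>tendsto_iff\<close> asks for.\<close>
      then obtain d where d: "d > 0" "\<And>w. w \<in> cbox_near J z d \<Longrightarrow>
          cmod (F w - F z - (\<Sum>j\<in>J. a j * (w j - z j))) \<le> e/2 * l1_dist J w z"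
        using R half_gt_zero by metis
      have "dist ((F w - F z - (\<Sum>j\<in>J. a j * (w j - z j))) / of_real (l1_dist J w z)) 0 < e"
        if "w \<in> cbox_near J z d - {z}" for w
      proof -
        have S: "l1_dist J w z > 0"
          using S0 that by (auto simp: cbox_near_def)
        have "cmod (F w - F z - (\<Sum>j\<in>J. a j * (w j - z j))) / l1_dist J w z \<le> e/2"
          using d(2)[of w] that S by (simp add: field_simps)
        also have "e/2 < e" using \<open>e > 0\<close> by simp
        finally show ?thesis using S by (simp add: norm_divide flip: of_real_sum)
      qed
      then show "\<exists>U. openin (coord_space J) U \<and> z \<in> U \<and> (\<forall>w\<in>U - {z}.
          dist ((F w - F z - (\<Sum>j\<in>J. a j * (w j - z j))) / of_real (l1_dist J w z)) 0 < e)"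
        using openin_cbox_near[OF J, of z d] cbox_near_self[OF z d(1)] by blast
    qed
  qed
  then show ?thesis unfolding complex_differentiable_at_def by simp
qed

lemma holomorphic_near_iff:
  assumes J: "finite J"
  shows "holomorphic_near J F z \<longleftrightarrow>
    z \<in> extensional J \<and> (\<exists>d>0. \<forall>w\<in>cbox_near J z d. complex_differentiable_at J F w)"
proof
  assume "holomorphic_near J F z"
  then obtain U where U: "openin (coord_space J) U" "z \<in> U" "\<forall>w\<in>U. complex_differentiable_at J F w"
    by (auto simp: holomorphic_near_def)
  then show "z \<in> extensional J \<and> (\<exists>d>0. \<forall>w\<in>cbox_near J z d. complex_differentiable_at J F w)"
    unfolding openin_coord_space_iff[OF J] by blast
next
  assume "z \<in> extensional J \<and> (\<exists>d>0. \<forall>w\<in>cbox_near J z d. complex_differentiable_at J F w)"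
  then obtain d where "z \<in> extensional J" "d > 0" "\<forall>w\<in>cbox_near J z d. complex_differentiable_at J F w"
    by blast
  then show "holomorphic_near J F z"
    unfolding holomorphic_near_def
    by (intro exI[of _ "cbox_near J z d"] conjI openin_cbox_near[OF J] cbox_near_self)
qed

section \<open>Local Lipschitz bounds and the chain rule\<close>

lemma complex_differentiable_at_imp_local_lipschitz:
  assumes J: "finite J" and z: "z \<in> extensional J" and F: "complex_differentiable_at J F z"
  obtains C d where "C > 0" "d > 0"
    "\<And>w. w \<in> cbox_near J z d \<Longrightarrow> cmod (F w - F z) \<le> C * l1_dist J w z"
proof -
  obtain a where a: "\<And>e. e > 0 \<Longrightarrow> \<exists>d>0. \<forall>w\<in>cbox_near J z d.
      cmod (F w - F z - (\<Sum>j\<in>J. a j * (w j - z j))) \<le> e * l1_dist J w z"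
    using F unfolding complex_differentiable_at_iff[OF J z] by blast
  obtain d where d: "d > 0" "\<And>w. w \<in> cbox_near J z d \<Longrightarrow>
      cmod (F w - F z - (\<Sum>j\<in>J. a j * (w j - z j))) \<le> 1 * l1_dist J w z"
    using a[of 1] by auto
  \<comment> \<open>The \<open>1\<close> bounds the error term, taken with epsilon 1; the sum bounds
    the linear part.\<close>
  define C where "C = 1 + (\<Sum>j\<in>J. cmod (a j))"
  have "C > 0" using sum_nonneg[of J "\<lambda>j. cmod (a j)"] by (simp add: C_def)
  moreover have "cmod (F w - F z) \<le> C * l1_dist J w z" if "w \<in> cbox_near J z d" for w
  proof -
    have "cmod (\<Sum>j\<in>J. a j * (w j - z j)) \<le> (\<Sum>j\<in>J. cmod (a j) * cmod (w j - z j))"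
      by (rule order_trans[OF norm_sum]) (simp add: norm_mult)
    also have "\<dots> \<le> (\<Sum>j\<in>J. (\<Sum>i\<in>J. cmod (a i)) * cmod (w j - z j))"
      using J by (intro sum_mono mult_right_mono member_le_sum) auto
    finally have "cmod (\<Sum>j\<in>J. a j * (w j - z j)) \<le> (\<Sum>i\<in>J. cmod (a i)) * l1_dist J w z"
      by (simp add: sum_distrib_left)
    moreover have "cmod (F w - F z) \<le>
        cmod (F w - F z - (\<Sum>j\<in>J. a j * (w j - z j))) + cmod (\<Sum>j\<in>J. a j * (w j - z j))"
      by (metis diff_add_cancel norm_triangle_ineq)
    ultimately show ?thesis using d(2)[OF that] by (simp add: C_def distrib_right)
  qed
  ultimately show ?thesis using d(1) that by blast
qed

lemma sum_cmod_le_of_cbox_near: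
  assumes "w \<in> cbox_near J z d"
  shows "l1_dist J w z \<le> real (card J) * d"
  using assms by (intro order_trans[OF sum_bounded_above[of J _ d]]) (auto simp: cbox_near_def intro: less_imp_le)

lemma complex_differentiable_at_family_lipschitz:
  assumes K: "finite K" and J: "finite J" and z: "z \<in> extensional K"
    and h: "\<And>j. j \<in> J \<Longrightarrow> complex_differentiable_at K (h j) z"
  obtains C d where "C > 0" "d > 0"
    "\<And>w j. w \<in> cbox_near K z d \<Longrightarrow> j \<in> J \<Longrightarrow> cmod (h j w - h j z) \<le> C * l1_dist K w z"
proof -
  have "\<forall>j\<in>J. \<exists>C d. C > 0 \<and> d > 0 \<and>
      (\<forall>w\<in>cbox_near K z d. cmod (h j w - h j z) \<le> C * l1_dist K w z)"
    using complex_differentiable_at_imp_local_lipschitz[OF K z h] by metis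
  then obtain C d where Cd: "\<And>j. j \<in> J \<Longrightarrow> C j > 0 \<and> d j > 0 \<and>
      (\<forall>w\<in>cbox_near K z (d j). cmod (h j w - h j z) \<le> C j * l1_dist K w z)"
    by metis
  define C' where "C' = Max (insert 1 (C ` J))"
  define d' where "d' = Min (insert 1 (d ` J))"
  have d': "d' > 0" "\<And>j. j \<in> J \<Longrightarrow> d' \<le> d j" using J Cd by (auto simp: d'_def)
  have C': "C' \<ge> 1" "\<And>j. j \<in> J \<Longrightarrow> C j \<le> C'" using J by (auto simp: C'_def)
  have "cmod (h j w - h j z) \<le> C' * l1_dist K w z"
    if "w \<in> cbox_near K z d'" "j \<in> J" for w j
  proof -
    have "cmod (h j w - h j z) \<le> C j * l1_dist K w z"
      using that Cd[of j] d'(2)[of j] cbox_near_mono by blast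
    also have "\<dots> \<le> C' * l1_dist K w z"
      using C' that by (intro mult_right_mono sum_nonneg) auto
    finally show ?thesis .
  qed
  then show ?thesis using that[of C' d'] C' d' by auto
qed

lemma complex_differentiable_at_family_continuous:
  assumes K: "finite K" and J: "finite J" and z: "z \<in> extensional K"
    and h: "\<And>j. j \<in> J \<Longrightarrow> complex_differentiable_at K (h j) z" and "e > 0"
  obtains d where "d > 0"
    "\<And>w. w \<in> cbox_near K z d \<Longrightarrow> (\<lambda>j\<in>J. h j w) \<in> cbox_near J (\<lambda>j\<in>J. h j z) e"
proof -
  obtain C d where Cd: "C > 0" "d > 0"
    "\<And>w j. w \<in> cbox_near K z d \<Longrightarrow> j \<in> J \<Longrightarrow> cmod (h j w - h j z) \<le> C * l1_dist K w z"
    using complex_differentiable_at_family_lipschitz[where h = h, OF K J z h] by blast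
  \<comment> \<open>On the box of radius \<open>d'\<close> the l1 distance is at most
    \<open>card K * d'\<close>, which \<open>C\<close> stretches to at most \<open>e/2\<close>; the
    \<open>+ 1\<close> avoids a zero denominator for empty \<open>K\<close>.\<close>
  define d' where "d' = min d (e / (2 * C * (real (card K) + 1)))"
  have d': "d' > 0" "d' \<le> d" using Cd \<open>e > 0\<close> by (auto simp: d'_def)
  have "C * (real (card K) * d') < e"
  proof -
    have "d' \<le> e / (2 * C * (real (card K) + 1))" by (simp add: d'_def)
    then have "C * ((real (card K) + 1) * d') \<le> e/2"
      using Cd by (simp add: pos_le_divide_eq mult.commute mult.left_commute add_nonneg_pos)
    moreover have "C * (real (card K) * d') \<le> C * ((real (card K) + 1) * d')"
      using Cd d' by (intro mult_left_mono mult_right_mono) auto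
    ultimately show ?thesis using \<open>e > 0\<close> by simp
  qed
  moreover have "C * l1_dist K w z \<le> C * (real (card K) * d')" if "w \<in> cbox_near K z d'" for w
    using sum_cmod_le_of_cbox_near[OF that] Cd by simp
  ultimately have "cmod (h j w - h j z) < e" if "w \<in> cbox_near K z d'" "j \<in> J" for w j
    using Cd(3)[of w j] that cbox_near_mono[OF d'(2)] by fastforce
  then show ?thesis using that[of d'] d' by (auto simp: cbox_near_def)
qed

text \<open>The error splits into the error of \<open>F\<close> at the image point, controlled by
  the Lipschitz bound for the \<open>h j\<close>, and the linear part of \<open>F\<close> applied to
  the errors of the \<open>h j\<close>; each receives half of \<open>e\<close>.\<close>

lemma complex_differentiable_at_compose:
  assumes K: "finite K" and J: "finite J" and z: "z \<in> extensional K"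
    and F: "complex_differentiable_at J F (\<lambda>j\<in>J. h j z)"
    and h: "\<And>j. j \<in> J \<Longrightarrow> complex_differentiable_at K (h j) z"
  shows "complex_differentiable_at K (\<lambda>w. F (\<lambda>j\<in>J. h j w)) z"
proof -
  define S where "S = (\<lambda>w. l1_dist K w z)"
  have S0: "S w \<ge> 0" for w unfolding S_def by (intro sum_nonneg) auto
  obtain a where a: "\<And>e. e > 0 \<Longrightarrow> \<exists>d>0. \<forall>w\<in>cbox_near J (\<lambda>j\<in>J. h j z) d.
      cmod (F w - F (\<lambda>j\<in>J. h j z) - (\<Sum>j\<in>J. a j * (w j - (\<lambda>j\<in>J. h j z) j)))
        \<le> e * (\<Sum>j\<in>J. cmod (w j - (\<lambda>j\<in>J. h j z) j))"
    using F complex_differentiable_at_iff[OF J restrict_extensional] by blast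
  have "\<forall>j\<in>J. \<exists>b. \<forall>e>0. \<exists>d>0. \<forall>w\<in>cbox_near K z d.
      cmod (h j w - h j z - (\<Sum>k\<in>K. b k * (w k - z k))) \<le> e * S w"
    using h unfolding complex_differentiable_at_iff[OF K z] S_def by blast
  then obtain b where b: "\<And>j e. j \<in> J \<Longrightarrow> e > 0 \<Longrightarrow> \<exists>d>0. \<forall>w\<in>cbox_near K z d.
      cmod (h j w - h j z - (\<Sum>k\<in>K. b j k * (w k - z k))) \<le> e * S w"
    by metis
  obtain C d0 where C: "C > 0" "d0 > 0"
    "\<And>w j. w \<in> cbox_near K z d0 \<Longrightarrow> j \<in> J \<Longrightarrow> cmod (h j w - h j z) \<le> C * S w"
    using complex_differentiable_at_family_lipschitz[where h = h, OF K J z h] unfolding S_def by blast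
  define A where "A = 1 + (\<Sum>j\<in>J. cmod (a j))"
  have A: "A > 0" using sum_nonneg[of J "\<lambda>j. cmod (a j)"] by (simp add: A_def)
  show ?thesis
    unfolding complex_differentiable_at_iff[OF K z]
  proof (intro exI[of _ "\<lambda>k. \<Sum>j\<in>J. a j * b j k"] allI impI)
    fix e :: real assume "e > 0"
    \<comment> \<open>\<open>e1\<close> is divided by what the Lipschitz bound contributes,
      \<open>C\<close> for each of the \<open>card J\<close> coordinates; \<open>e2\<close> by the
      bound \<open>A\<close> for the linear part of \<open>F\<close>.\<close>
    define e1 where "e1 = e / (2 * C * (real (card J) + 1))"
    define e2 where "e2 = e / (2 * A)"
    have e12: "e1 > 0" "e2 > 0" using \<open>e > 0\<close> C A by (auto simp: e1_def e2_def)
    obtain r where r: "r > 0" "\<And>w. w\<in>cbox_near J (\<lambda>j\<in>J. h j z) r \<Longrightarrow>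
      cmod (F w - F (\<lambda>j\<in>J. h j z) - (\<Sum>j\<in>J. a j * (w j - (\<lambda>j\<in>J. h j z) j)))
        \<le> e1 * (\<Sum>j\<in>J. cmod (w j - (\<lambda>j\<in>J. h j z) j))"
      using a[OF e12(1)] by blast
    obtain d1 where d1: "d1 > 0"
      "\<And>w. w \<in> cbox_near K z d1 \<Longrightarrow> (\<lambda>j\<in>J. h j w) \<in> cbox_near J (\<lambda>j\<in>J. h j z) r"
      using complex_differentiable_at_family_continuous[where h = h, OF K J z h r(1)] by blast
    have "\<forall>j\<in>J. \<exists>d>0. \<forall>w\<in>cbox_near K z d.
      cmod (h j w - h j z - (\<Sum>k\<in>K. b j k * (w k - z k))) \<le> e2 * S w"
      using b e12 by blast
    then obtain d2 where d2: "\<And>j. j \<in> J \<Longrightarrow> d2 j > 0"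
      "\<And>j w. j \<in> J \<Longrightarrow> w \<in> cbox_near K z (d2 j) \<Longrightarrow>
        cmod (h j w - h j z - (\<Sum>k\<in>K. b j k * (w k - z k))) \<le> e2 * S w"
      by metis
    define d where "d = Min (insert d0 (insert d1 (d2 ` J)))"
    have d: "d > 0" "d \<le> d0" "d \<le> d1" "\<And>j. j \<in> J \<Longrightarrow> d \<le> d2 j"
      using J C(2) d1(1) d2(1) by (auto simp: d_def min.coboundedI2)
    have "cmod (F (\<lambda>j\<in>J. h j w) - F (\<lambda>j\<in>J. h j z) - (\<Sum>k\<in>K. (\<Sum>j\<in>J. a j * b j k) * (w k - z k)))
        \<le> e * S w" if w: "w \<in> cbox_near K z d" for w
    proof -
      have "cmod (F (\<lambda>j\<in>J. h j w) - F (\<lambda>j\<in>J. h j z) - (\<Sum>j\<in>J. a j * (h j w - h j z)))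
          \<le> e1 * (\<Sum>j\<in>J. cmod (h j w - h j z))"
      proof -
        have "(\<lambda>j\<in>J. h j w) \<in> cbox_near J (\<lambda>j\<in>J. h j z) r"
          using d1(2) w cbox_near_mono[OF d(3)] by blast
        from r(2)[OF this] show ?thesis by simp
      qed
      also have "\<dots> \<le> e1 * (\<Sum>j\<in>J. C * S w)"
        using C(3)[OF subsetD[OF cbox_near_mono[OF d(2)] w]] e12 by (intro mult_left_mono sum_mono) auto
      also have "\<dots> \<le> e1 * ((real (card J) + 1) * (C * S w))"
        using C S0[of w] e12 by (intro mult_left_mono) (auto simp: distrib_right)
      also have "\<dots> = e/2 * S w"
      proof -
        have "real (card J) + 1 \<noteq> 0" "C \<noteq> 0" using C by (auto simp: add_nonneg_eq_0_iff)
        then show ?thesis unfolding e1_def by (simp add: divide_simps)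
      qed
      finally have 1: "cmod (F (\<lambda>j\<in>J. h j w) - F (\<lambda>j\<in>J. h j z) - (\<Sum>j\<in>J. a j * (h j w - h j z))) \<le> e/2 * S w" .
      have "cmod (\<Sum>j\<in>J. a j * (h j w - h j z - (\<Sum>k\<in>K. b j k * (w k - z k))))
          \<le> (\<Sum>j\<in>J. cmod (a j) * (e2 * S w))"
      proof (rule order_trans[OF norm_sum], rule sum_mono)
        fix j assume "j \<in> J"
        then show "cmod (a j * (h j w - h j z - (\<Sum>k\<in>K. b j k * (w k - z k)))) \<le> cmod (a j) * (e2 * S w)"
          using d2(2)[of j w] w cbox_near_mono[OF d(4)] by (auto simp: norm_mult intro!: mult_left_mono)
      qed
      also have "\<dots> \<le> A * (e2 * S w)"
        using S0[of w] e12 by (simp add: A_def sum_distrib_right distrib_right)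
      also have "\<dots> = e/2 * S w" using A by (simp add: e2_def)
      finally have 2: "cmod (\<Sum>j\<in>J. a j * (h j w - h j z - (\<Sum>k\<in>K. b j k * (w k - z k)))) \<le> e/2 * S w" .
      have "(\<Sum>k\<in>K. (\<Sum>j\<in>J. a j * b j k) * (w k - z k)) = (\<Sum>j\<in>J. a j * (\<Sum>k\<in>K. b j k * (w k - z k)))"
        unfolding sum_distrib_left sum_distrib_right by (subst sum.swap) (simp add: mult.assoc)
      then have "F (\<lambda>j\<in>J. h j w) - F (\<lambda>j\<in>J. h j z) - (\<Sum>k\<in>K. (\<Sum>j\<in>J. a j * b j k) * (w k - z k)) =
          (F (\<lambda>j\<in>J. h j w) - F (\<lambda>j\<in>J. h j z) - (\<Sum>j\<in>J. a j * (h j w - h j z))) +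
          (\<Sum>j\<in>J. a j * (h j w - h j z - (\<Sum>k\<in>K. b j k * (w k - z k))))"
        by (simp add: right_diff_distrib sum_subtractf)
      also have "cmod \<dots> \<le> e/2 * S w + e/2 * S w"
        by (rule order_trans[OF norm_triangle_ineq add_mono[OF 1 2]])
      finally show ?thesis by simp
    qed
    then show "\<exists>d>0. \<forall>w\<in>cbox_near K z d.
        cmod (F (\<lambda>j\<in>J. h j w) - F (\<lambda>j\<in>J. h j z) - (\<Sum>k\<in>K. (\<Sum>j\<in>J. a j * b j k) * (w k - z k)))
          \<le> e * l1_dist K w z"
      using d(1) unfolding S_def by blast
  qed
qed

lemma holomorphic_near_compose:
  assumes K: "finite K" and J: "finite J"
    and F: "holomorphic_near J F (\<lambda>j\<in>J. h j z)"
    and z: "z \<in> extensional K"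
    and h: "\<And>j. j \<in> J \<Longrightarrow> holomorphic_near K (h j) z"
  shows "holomorphic_near K (\<lambda>w. F (\<lambda>j\<in>J. h j w)) z"
proof -
  obtain r where r: "r > 0" "\<And>w. w\<in>cbox_near J (\<lambda>j\<in>J. h j z) r \<Longrightarrow> complex_differentiable_at J F w"
    using F unfolding holomorphic_near_iff[OF J] by blast
  have "\<forall>j\<in>J. \<exists>d>0. \<forall>w\<in>cbox_near K z d. complex_differentiable_at K (h j) w"
    using h unfolding holomorphic_near_iff[OF K] by blast
  then obtain d where d: "\<And>j. j \<in> J \<Longrightarrow> d j > 0"
    "\<And>j w. j \<in> J \<Longrightarrow> w\<in>cbox_near K z (d j) \<Longrightarrow> complex_differentiable_at K (h j) w"
    by metis
  have hz: "complex_differentiable_at K (h j) z" if "j \<in> J" for j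
    using d that cbox_near_self[OF z] by blast
  obtain d1 where d1: "d1 > 0"
    "\<And>w. w \<in> cbox_near K z d1 \<Longrightarrow> (\<lambda>j\<in>J. h j w) \<in> cbox_near J (\<lambda>j\<in>J. h j z) r"
    using complex_differentiable_at_family_continuous[where h = h, OF K J z hz r(1)] by blast
  define e where "e = Min (insert d1 (d ` J))"
  have e: "e > 0" "e \<le> d1" "\<And>j. j \<in> J \<Longrightarrow> e \<le> d j"
    using J d1 d by (auto simp: e_def)
  have "complex_differentiable_at K (\<lambda>w. F (\<lambda>j\<in>J. h j w)) w" if w: "w \<in> cbox_near K z e" for w
  proof (rule complex_differentiable_at_compose[OF K J])
    show "w \<in> extensional K" using w by (simp add: cbox_near_def)
    show "complex_differentiable_at J F (\<lambda>j\<in>J. h j w)"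
      using r(2) d1(2) w cbox_near_mono[OF e(2)] by blast
    show "complex_differentiable_at K (h j) w" if "j \<in> J" for j
      using d(2)[OF that] w cbox_near_mono[OF e(3)[OF that]] by blast
  qed
  then show ?thesis unfolding holomorphic_near_iff[OF K] using e(1) z by blast
qed

text \<open>A real derivative that commutes with complex scalars is a complex one. The space
  \<open>'v\<close> is only a real normed space, so its complex scaling is passed as the function
  \<open>s\<close>; the coordinates enter through the affine map with base point \<open>x\<close>
  and directions \<open>u j\<close>.\<close>

lemma complex_differentiable_at_has_derivative:
  fixes s :: "complex \<Rightarrow> 'v::real_normed_vector \<Rightarrow> 'v" and u :: "'i \<Rightarrow> 'v::real_normed_vector"
  assumes J: "finite J" and z: "z \<in> extensional J"
    and s: "\<And>j. j \<in> J \<Longrightarrow> bounded_linear (\<lambda>c. s c (u j))"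
    and H: "(H has_derivative D) (at (x + (\<Sum>j\<in>J. s (z j) (u j))))"
    and D: "\<And>c v. D (s c v) = c * D v"
  shows "complex_differentiable_at J (\<lambda>w. H (x + (\<Sum>j\<in>J. s (w j) (u j)))) z"
proof -
  define i where "i = (\<lambda>w. x + (\<Sum>j\<in>J. s (w j) (u j)))"
  have "\<forall>j\<in>J. \<exists>C>0. \<forall>c. norm (s c (u j)) \<le> norm c * C"
    using s bounded_linear.pos_bounded by fastforce
  then obtain c where c: "\<And>j t. j \<in> J \<Longrightarrow> norm (s t (u j)) \<le> norm t * c j"
    by metis
  define C where "C = Max (insert 1 (c ` J))"
  have C: "C \<ge> 1" "\<And>j. j \<in> J \<Longrightarrow> c j \<le> C" using J by (auto simp: C_def)
  have idiff: "i w - i z = (\<Sum>j\<in>J. s (w j - z j) (u j))" for w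
    by (simp add: i_def sum_subtractf[symmetric] linear_diff[OF bounded_linear.linear[OF s]])
  have iC: "norm (i w - i z) \<le> C * l1_dist J w z" for w
  proof -
    have "norm (i w - i z) \<le> (\<Sum>j\<in>J. norm (s (w j - z j) (u j)))"
      unfolding idiff by (rule norm_sum)
    also have "\<dots> \<le> (\<Sum>j\<in>J. cmod (w j - z j) * C)"
      by (intro sum_mono order_trans[OF c] mult_left_mono C) auto
    finally show ?thesis by (simp add: sum_distrib_left mult.commute)
  qed
  have lin: "linear D" using H has_derivative_linear by blast
  have Di: "D (i w - i z) = (\<Sum>j\<in>J. D (u j) * (w j - z j))" for w
    unfolding idiff linear_sum[OF lin] by (simp add: D mult.commute)
  show ?thesis
    unfolding complex_differentiable_at_iff[OF J z]
  proof (intro exI[of _ "\<lambda>j. D (u j)"] allI impI)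
    fix e :: real assume "e > 0"
    then have "e / C > 0" using C by auto
    then obtain d where d: "d > 0" "\<And>y. norm (y - i z) < d \<Longrightarrow>
        norm (H y - H (i z) - D (y - i z)) \<le> e / C * norm (y - i z)"
      using H unfolding has_derivative_at_alt i_def by blast
    \<comment> \<open>Chosen so that the box of radius \<open>d'\<close> is mapped into the ball of
      radius \<open>d\<close>: the affine map stretches the l1 distance by at most
      \<open>C\<close>.\<close>
    define d' where "d' = d / (C * (real (card J) + 1))"
    have d': "d' > 0" using C d by (simp add: d'_def add_nonneg_pos)
    have "cmod (H (i w) - H (i z) - (\<Sum>j\<in>J. D (u j) * (w j - z j))) \<le> e * l1_dist J w z"
      if w: "w \<in> cbox_near J z d'" for w
    proof -
      have "norm (i w - i z) \<le> C * (real (card J) * d')"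
        by (rule order_trans[OF iC]) (use C sum_cmod_le_of_cbox_near[OF w] in auto)
      also have "\<dots> < C * ((real (card J) + 1) * d')"
        using C d' by simp
      also have "\<dots> = d" using C by (simp add: d'_def add_nonneg_eq_0_iff)
      finally have "cmod (H (i w) - H (i z) - D (i w - i z)) \<le> e / C * norm (i w - i z)"
        using d by blast
      also have "\<dots> \<le> e / C * (C * l1_dist J w z)"
        using C \<open>e > 0\<close> iC by (intro mult_left_mono) auto
      finally show ?thesis using C Di by simp
    qed
    then show "\<exists>d>0. \<forall>w\<in>cbox_near J z d.
       cmod (H (x + (\<Sum>j\<in>J. s (w j) (u j))) - H (x + (\<Sum>j\<in>J. s (z j) (u j))) - (\<Sum>j\<in>J. D (u j) * (w j - z j)))
         \<le> e * l1_dist J w z"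
      using d' unfolding i_def by blast
  qed
qed

section \<open>Locality of holomorphy\<close>

lemma holomorphic_near_cong:
  assumes F: "holomorphic_near J F z"
    and U: "openin (coord_space J) U" "z \<in> U" "\<And>w. w \<in> U \<Longrightarrow> F w = G w"
  shows "holomorphic_near J G z"
proof -
  obtain V where V: "openin (coord_space J) V" "z \<in> V" "\<forall>w\<in>V. complex_differentiable_at J F w"
    using F by (auto simp: holomorphic_near_def)
  have "complex_differentiable_at J G w" if w: "w \<in> U \<inter> V" for w
  proof -
    let ?q = "\<lambda>a H v. (H v - H w - (\<Sum>j\<in>J. a j * (v j - w j))) / of_real (l1_dist J v w)"
    obtain a where a: "(?q a F \<longlongrightarrow> 0) (atin (coord_space J) w)"
      using V(3) w unfolding complex_differentiable_at_def by blast
    have "\<forall>\<^sub>F v in atin (coord_space J) w. ?q a F v = ?q a G v"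
      unfolding eventually_atin using U(1,3) w by (intro disjI2 exI[of _ U]) auto
    from Lim_transform_eventually[OF a this] show ?thesis
      unfolding complex_differentiable_at_def by blast
  qed
  then show ?thesis
    unfolding holomorphic_near_def using U V by (intro exI[of _ "U \<inter> V"]) auto
qed

lemma holomorphic_near_open:
  assumes "holomorphic_near J F z"
  obtains U where "openin (coord_space J) U" "z \<in> U" "\<And>w. w \<in> U \<Longrightarrow> holomorphic_near J F w"
  using assms unfolding holomorphic_near_def by blast

section \<open>Polynomials evaluated at matrices\<close>

lemma matrix_vector_scale: "mat a *v (v :: complex^'n::finite) = a *s v"
proof -
  have "(mat a *v v) $ i = a * v $ i" for i
    by (simp add: matrix_vector_mult_def mat_def if_distrib[of "\<lambda>x. x * _"] cong: if_cong)
  then show ?thesis by (simp add: vec_eq_iff)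
qed

lemma mat_matrix_mult_nth: "(mat a ** (M :: 'n::finite cmat)) $ i $ j = a * M $ i $ j"
  by (simp add: matrix_matrix_mult_def mat_def if_distrib[of "\<lambda>x. x * _"] cong: if_cong)

lemma matrix_mult_mat_nth: "((M :: 'n::finite cmat) ** mat a) $ i $ j = a * M $ i $ j"
  by (simp add: matrix_matrix_mult_def mat_def if_distrib mult.commute cong: if_cong)

lemma mat_matrix_mult_commute: "mat a ** (M :: 'n::finite cmat) = M ** mat a"
  by (simp add: vec_eq_iff mat_matrix_mult_nth matrix_mult_mat_nth)

lemma mat_add: "mat (a + b) = mat a + (mat b :: 'n::finite cmat)"
  by (simp add: vec_eq_iff mat_def)

lemma mat_mult: "mat (a * b) = mat a ** (mat b :: 'n::finite cmat)"
  by (simp add: vec_eq_iff mat_matrix_mult_nth) (simp add: mat_def)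

lemma matrix_mult_zero_left [simp]: "0 ** (M :: 'n::finite cmat) = 0"
  by (simp add: vec_eq_iff matrix_matrix_mult_def)

lemma matrix_add_rdistrib: "((X :: 'n::finite cmat) + Y) ** Z = X ** Z + Y ** Z"
  by (simp add: vec_eq_iff matrix_matrix_mult_def distrib_right sum.distrib)

lemma matrix_vector_mult_axis_nth [simp]: "((M :: 'n::finite cmat) *v axis j 1) $ i = M $ i $ j"
  by (simp add: matrix_vector_mult_def axis_def if_distrib cong: if_cong)

section \<open>Evaluation of polynomials at one matrix and at two matrices\<close>

definition mat_poly :: "'n::finite cmat \<Rightarrow> complex poly \<Rightarrow> 'n cmat" where
  "mat_poly A p = fold_coeffs (\<lambda>a M. mat a + A ** M) p 0"

lemma mat_poly_0 [simp]: "mat_poly A 0 = 0"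
  by (simp add: mat_poly_def)

lemma mat_poly_pCons [simp]: "mat_poly A (pCons a p) = mat a + A ** mat_poly A p"
  by (cases "p = 0 \<and> a = 0") (auto simp: mat_poly_def)

lemma mat_poly_add: "mat_poly A (p + q) = mat_poly A p + mat_poly A q"
  by (induction p q rule: poly_induct2) (simp_all add: mat_add matrix_add_ldistrib)

lemma mat_poly_smult: "mat_poly A (smult a p) = mat a ** mat_poly A p"
proof (induction p)
  case (pCons b p)
  have "A ** (mat a ** mat_poly A p) = mat a ** (A ** mat_poly A p)"
    by (metis mat_matrix_mult_commute matrix_mul_assoc)
  with pCons show ?case by (simp add: mat_mult matrix_add_ldistrib)
qed simp

lemma mat_poly_mult: "mat_poly A (p * q) = mat_poly A p ** mat_poly A q"
  by (induction p)
    (simp_all add: mat_poly_add mat_poly_smult matrix_add_rdistrib matrix_mul_assoc)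

text \<open>Stated for arbitrary intertwiners, so that it serves twice: with a group element it
  transports values between conjugate matrices, and with \<open>g = B\<close>, \<open>A' = A\<close>
  it moves \<open>B\<close> past polynomials in \<open>A\<close>.\<close>

lemma mat_poly_intertwine:
  assumes "g ** A = A' ** (g :: 'n::finite cmat)"
  shows "g ** mat_poly A p = mat_poly A' p ** g"
proof (induction p)
  case (pCons a p)
  have "g ** (A ** mat_poly A p) = A' ** (mat_poly A' p ** g)"
    by (metis assms matrix_mul_assoc pCons.IH)
  then show ?case
    by (simp add: matrix_add_ldistrib matrix_add_rdistrib mat_matrix_mult_commute[of a g] matrix_mul_assoc)
qed simp

text \<open>For non-commuting \<open>A\<close> and \<open>B\<close>, powers of \<open>B\<close> are placed to the left of powers of \<open>A\<close>.\<close>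

definition mat_poly2 :: "'n::finite cmat \<Rightarrow> 'n cmat \<Rightarrow> complex poly poly \<Rightarrow> 'n cmat" where
  "mat_poly2 A B f = fold_coeffs (\<lambda>p M. mat_poly A p + B ** M) f 0"

lemma mat_poly_1 [simp]: "mat_poly A 1 = mat 1"
  by (simp add: one_pCons)

lemma mat_poly2_0 [simp]: "mat_poly2 A B 0 = 0"
  by (simp add: mat_poly2_def)

lemma mat_poly2_pCons [simp]: "mat_poly2 A B (pCons p f) = mat_poly A p + B ** mat_poly2 A B f"
  by (cases "f = 0 \<and> p = 0") (auto simp: mat_poly2_def)

lemma mat_poly2_1 [simp]: "mat_poly2 A B 1 = mat 1"
  by (simp add: one_pCons)

lemma mat_poly2_add: "mat_poly2 A B (f + g) = mat_poly2 A B f + mat_poly2 A B g"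
  by (induction f g rule: poly_induct2) (simp_all add: mat_poly_add matrix_add_ldistrib)

lemma mat_poly2_intertwine:
  assumes "g ** A = A' ** (g :: 'n::finite cmat)" "g ** B = B' ** g"
  shows "g ** mat_poly2 A B f = mat_poly2 A' B' f ** g"
proof (induction f)
  case (pCons p f)
  have "g ** (B ** mat_poly2 A B f) = B' ** (mat_poly2 A' B' f ** g)"
    by (metis assms(2) matrix_mul_assoc pCons.IH)
  then show ?case
    by (simp add: matrix_add_ldistrib matrix_add_rdistrib mat_poly_intertwine[OF assms(1)]
        matrix_mul_assoc)
qed simp

lemma mat_poly2_smult:
  assumes "A ** B = B ** A"
  shows "mat_poly2 A B (smult p f) = mat_poly A p ** mat_poly2 A B f"
proof (induction f)
  case (pCons q f)
  have "B ** (mat_poly A p ** mat_poly2 A B f) = mat_poly A p ** (B ** mat_poly2 A B f)"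
    using mat_poly_intertwine[OF assms[symmetric], of p] by (simp add: matrix_mul_assoc)
  with pCons show ?case by (simp add: mat_poly_mult matrix_add_ldistrib)
qed simp

lemma mat_poly2_mult:
  assumes "A ** B = B ** A"
  shows "mat_poly2 A B (f * g) = mat_poly2 A B f ** mat_poly2 A B g"
  by (induction f)
    (simp_all add: mat_poly2_add mat_poly2_smult[OF assms] matrix_add_rdistrib matrix_mul_assoc)

lemma mat_poly2_x: "mat_poly2 A B [:[:0, 1:]:] = A"
  by simp

lemma mat_poly2_y: "mat_poly2 A B [:0, 1:] = B"
  by simp

text \<open>Constants are central, so evaluation is complex linear for all pairs, commuting or
  not.\<close>

lemma mat_poly2_smult_const: "mat_poly2 A B (smult [:a:] f) = mat a ** mat_poly2 A B f"
proof (induction f)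
  case (pCons q f)
  have "B ** (mat a ** mat_poly2 A B f) = mat a ** (B ** mat_poly2 A B f)"
    by (metis mat_matrix_mult_commute matrix_mul_assoc)
  with pCons show ?case by (simp add: mat_poly_smult matrix_add_ldistrib)
qed simp

lemma mat_poly2_diff: "mat_poly2 A B (f - g) = mat_poly2 A B f - mat_poly2 A B g"
  by (metis mat_poly2_add add_diff_cancel_right' diff_add_cancel)

lemma mat_poly2_sum: "mat_poly2 A B (sum f K) = (\<Sum>k\<in>K. mat_poly2 A B (f k))"
  by (induction K rule: infinite_finite_induct) (simp_all add: mat_poly2_add)

section \<open>Cyclic vectors and values of polynomials\<close>

lemma mat_poly_mem_invariant_subspace:
  assumes "vec.subspace S" "\<And>w. w \<in> S \<Longrightarrow> A *v w \<in> S" "v \<in> S"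
  shows "mat_poly A p *v v \<in> S"
  by (induction p)
    (use assms in \<open>simp_all add: vec.subspace_0 matrix_vector_mult_add_rdistrib matrix_vector_scale
      vec.subspace_add vec.subspace_scale flip: matrix_vector_mul_assoc\<close>)

lemma mat_poly2_mem_invariant_subspace:
  assumes "vec.subspace S" "\<And>w. w \<in> S \<Longrightarrow> A *v w \<in> S" "\<And>w. w \<in> S \<Longrightarrow> B *v w \<in> S" "v \<in> S"
  shows "mat_poly2 A B f *v v \<in> S"
  by (induction f)
    (use assms in \<open>simp_all add: vec.subspace_0 matrix_vector_mult_add_rdistrib
      vec.subspace_add mat_poly_mem_invariant_subspace flip: matrix_vector_mul_assoc\<close>)

lemma cyclic_vector_subspaceD:
  assumes "cyclic_vector v A B" "vec.subspace S" "v \<in> S"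
    "\<And>w. w \<in> S \<Longrightarrow> A *v w \<in> S" "\<And>w. w \<in> S \<Longrightarrow> B *v w \<in> S"
  shows "S = UNIV"
  using assms unfolding cyclic_vector_def by blast

lemma cyclic_vector_if_mat_poly2_surj:
  assumes "\<And>w. \<exists>f. mat_poly2 A B f *v v = w"
  shows "cyclic_vector v A B"
  unfolding cyclic_vector_def using mat_poly2_mem_invariant_subspace assms
  by (metis UNIV_eq_I)

text \<open>The values \<open>f(A, B) v\<close> form a subspace containing \<open>v\<close>.
  Commutativity makes it invariant: multiplying \<open>f\<close> by x places the new
  \<open>A\<close> among the powers of \<open>A\<close>, to the right of the powers of
  \<open>B\<close>, and the result must equal \<open>A\<close> acting from the left.\<close>

lemma cyclic_vector_mat_poly2_surj:
  assumes c: "cyclic_vector v A B" and AB: "A ** B = B ** A"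
  shows "\<exists>f. mat_poly2 A B f *v v = w"
proof -
  define S where "S = range (\<lambda>f. mat_poly2 A B f *v v)"
  have "vec.subspace S"
    unfolding vec.subspace_def
  proof (intro conjI ballI allI)
    have "mat_poly2 A B 0 *v v = 0" by simp
    then show "0 \<in> S" unfolding S_def by (metis rangeI)
    fix x y assume "x \<in> S" "y \<in> S"
    then obtain f g where "x = mat_poly2 A B f *v v" "y = mat_poly2 A B g *v v"
      unfolding S_def by blast
    then have "x + y = mat_poly2 A B (f + g) *v v"
      by (simp add: mat_poly2_add matrix_vector_mult_add_rdistrib)
    then show "x + y \<in> S" unfolding S_def by blast
  next
    fix c x assume "x \<in> S"
    then obtain f where "x = mat_poly2 A B f *v v"
      unfolding S_def by blast
    then have "c *s x = mat_poly2 A B (smult [:c:] f) *v v"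
      by (simp add: mat_poly2_smult_const matrix_vector_scale flip: matrix_vector_mul_assoc)
    then show "c *s x \<in> S" unfolding S_def by blast
  qed
  moreover have "mat_poly2 A B 1 *v v = v" by simp
  then have "v \<in> S" unfolding S_def by (metis rangeI)
  moreover have "A *v x \<in> S \<and> B *v x \<in> S" if "x \<in> S" for x
  proof -
    from that obtain f where x: "x = mat_poly2 A B f *v v"
      unfolding S_def by blast
    have "A *v x = mat_poly2 A B ([:[:0, 1:]:] * f) *v v" "B *v x = mat_poly2 A B ([:0, 1:] * f) *v v"
      by (simp_all only: x mat_poly2_mult[OF AB] mat_poly2_x mat_poly2_y matrix_vector_mul_assoc)
    then show ?thesis unfolding S_def by blast
  qed
  ultimately have "S = UNIV" using cyclic_vector_subspaceD[OF c] by blast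
  then have "w \<in> S" by simp
  then show ?thesis unfolding S_def by blast
qed


section \<open>Vanishing of the commutator on the zero level\<close>

lemma column_first_eq_e1_iff: "column first (g :: 'n::{finite,linorder} cmat) = e1 \<longleftrightarrow> g *v e1 = e1"
  by (simp add: e1_def vec_eq_iff column_def)

lemma matrix_mult_only_first_row_nth:
  fixes C :: "'n::{finite,linorder} cmat"
  assumes "\<And>i j. i \<noteq> first \<Longrightarrow> C $ i $ j = 0"
  shows "(U ** C) $ i $ j = U $ i $ first * C $ first $ j"
proof -
  have "(U ** C) $ i $ j = (\<Sum>k\<in>(UNIV :: 'n set). if k = first then U $ i $ first * C $ first $ j else 0)"
    unfolding matrix_matrix_mult_def vec_lambda_beta by (rule sum.cong) (auto simp: assms)
  then show ?thesis by simp
qed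

text \<open>Such a \<open>C\<close> has rank at most one, being \<open>e1\<close> times a row, so
  the trace of a product of two factors ending in \<open>C\<close> factorizes.\<close>

lemma trace_mult_only_first_row:
  fixes C :: "'n::{finite,linorder} cmat"
  assumes "\<And>i j. i \<noteq> first \<Longrightarrow> C $ i $ j = 0"
  shows "trace (U ** C ** (V ** C)) = trace (U ** C) * trace (V ** C)"
  unfolding trace_def matrix_matrix_mult_def[of "U ** C"]
  by (simp add: matrix_mult_only_first_row_nth[OF assms] sum_product mult_ac)

text \<open>\<open>A\<close> and \<open>B\<close> are not yet known to commute, so words in two
  letters take the place of polynomials.\<close>

fun word :: "'n::finite cmat \<Rightarrow> 'n cmat \<Rightarrow> bool list \<Rightarrow> 'n cmat" where
  "word A B [] = mat 1"
| "word A B (s # w) = (if s then B else A) ** word A B w"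

lemma word_append: "word A B (u @ w) = word A B u ** word A B w"
  by (induction u) (simp_all add: matrix_mul_assoc)

lemma trace_diff: "trace ((X :: 'n::finite cmat) - Y) = trace X - trace Y"
  by (simp add: trace_def sum_subtractf)

lemma matrix_mult_diff:
  "(X :: 'n::finite cmat) ** (Y - Z) = X ** Y - X ** Z" "(Y - Z) ** X = Y ** X - Z ** X"
  by (simp_all add: vec_eq_iff matrix_matrix_mult_def algebra_simps sum_subtractf)

context
  fixes A B C :: "'n::{finite,linorder} cmat"
  assumes C_eq: "C = commutator A B"
    and C_row: "\<And>i j. i \<noteq> first \<Longrightarrow> C $ i $ j = 0"
begin

lemma word_swap_diff:
  "word A B (u @ False # True # v) - word A B (u @ True # False # v) = word A B u ** C ** word A B v"
  by (simp add: word_append C_eq commutator_def matrix_mult_diff matrix_mul_assoc)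

text \<open>An exchange of neighbouring letters inserts \<open>C\<close> between \<open>u\<close>
  and \<open>v\<close>. The trace of \<open>u C v C\<close> is a product of two traces, and that of
  \<open>v C\<close> vanishes since \<open>v\<close> is shorter than \<open>k\<close>.\<close>

lemma trace_word_swap:
  assumes IH: "\<And>w. length w < k \<Longrightarrow> trace (word A B w ** C) = 0"
    and k: "length (u @ s # t # v) = k"
  shows "trace (word A B (u @ s # t # v) ** C) = trace (word A B (u @ t # s # v) ** C)"
proof -
  have "trace (word A B (u @ False # True # v) ** C) - trace (word A B (u @ True # False # v) ** C)
      = trace (word A B u ** C ** (word A B v ** C))"
    by (simp only: trace_diff[symmetric] matrix_mult_diff(2)[symmetric] word_swap_diff matrix_mul_assoc)
  also have "\<dots> = 0"
    using IH[of v] k by (simp add: trace_mult_only_first_row[OF C_row])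
  finally have "trace (word A B (u @ False # True # v) ** C) = trace (word A B (u @ True # False # v) ** C)"
    by simp
  then show ?thesis by (cases s; cases t) (simp_all del: word.simps)
qed

lemma trace_word_move:
  assumes IH: "\<And>w. length w < k \<Longrightarrow> trace (word A B w ** C) = 0"
    and k: "length (u @ x # v @ z) = k"
  shows "trace (word A B (u @ x # v @ z) ** C) = trace (word A B (u @ v @ x # z) ** C)"
  using k
proof (induction v arbitrary: u)
  case (Cons y v)
  have "trace (word A B (u @ x # (y # v) @ z) ** C) = trace (word A B (u @ y # x # (v @ z)) ** C)"
    using trace_word_swap[OF IH, where u = u and s = x and t = y and v = "v @ z"] Cons.prems by simp
  also have "\<dots> = trace (word A B ((u @ [y]) @ v @ x # z) ** C)"
    using Cons.IH[of "u @ [y]"] Cons.prems by simp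
  finally show ?case by simp
qed simp

text \<open>The prefix \<open>u\<close> stays in place and grows by the head letter in each
  induction step: the tail is rearranged first, then the head is moved to its position.\<close>

lemma trace_word_mset:
  assumes IH: "\<And>w. length w < k \<Longrightarrow> trace (word A B w ** C) = 0"
    and "length (u @ w) = k" "mset w = mset w'"
  shows "trace (word A B (u @ w) ** C) = trace (word A B (u @ w') ** C)"
  using assms(2,3)
proof (induction w arbitrary: u w')
  case (Cons x w)
  then have "x \<in> set w'"
    by (metis list.set_intros(1) set_mset_mset)
  then obtain v z where w': "w' = v @ x # z" by (meson split_list)
  have m: "mset w = mset (v @ z)" using Cons.prems(2) w' by simp
  have len: "length w = length (v @ z)" using m by (rule mset_eq_length)
  have "trace (word A B (u @ x # w) ** C) = trace (word A B ((u @ [x]) @ v @ z) ** C)"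
    using Cons.IH[OF _ m, of "u @ [x]"] Cons.prems by simp
  also have "\<dots> = trace (word A B (u @ v @ x # z) ** C)"
    using trace_word_move[OF IH, where u = u and x = x and v = v and z = z] Cons.prems len by simp
  finally show ?case by (simp add: w')
qed simp

text \<open>
  Modulo shorter words, \<open>tr (w [A, B])\<close> depends only on the numbers \<open>p\<close>, \<open>q\<close> of letters \<open>A\<close>, \<open>B\<close>
  in \<open>w\<close>. Moving one letter \<open>A\<close> step by step through \<open>q + 1\<close> letters \<open>B\<close> in \<open>A\<^sup>p A B\<^bsup>q+1\<^esup>\<close> leads to
  \<open>A\<^sup>p B\<^bsup>q+1\<^esup> A\<close>, which has the same trace, whence \<open>(q + 1) tr (w [A, B]) = 0\<close>.
\<close>

lemma trace_word_commutator: "trace (word A B w ** C) = 0"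
proof (induction w rule: length_induct)
  case (1 w)
  then have IH: "\<And>u. length u < length w \<Longrightarrow> trace (word A B u ** C) = 0" by blast
  define p q where "p = count (mset w) False" and "q = count (mset w) True"
  have mw: "mset w = replicate_mset p False + replicate_mset q True"
    by (rule multiset_eqI) (auto simp: p_def q_def)
  \<comment> \<open>\<open>t l\<close> is the trace of the bare word after the moving
    \<open>A\<close> has passed \<open>l\<close> letters \<open>B\<close>; the commutator appears
    only in the differences.\<close>
  define t where "t = (\<lambda>l. trace (word A B (replicate p False @ replicate l True @
     False # replicate (q + 1 - l) True)))"
  have step: "t l - t (Suc l) = trace (word A B w ** C)" if "l \<le> q" for l
  proof -
    let ?u = "replicate p False @ replicate l True" and ?v = "replicate (q - l) True"
    have "t l = trace (word A B (?u @ False # True # ?v))"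
      using that by (simp add: t_def Suc_diff_le del: word.simps)
    moreover have "t (Suc l) = trace (word A B (?u @ True # False # ?v))"
    proof -
      have "replicate (Suc l) True = replicate l True @ [True]"
        by (simp add: replicate_append_same)
      then show ?thesis by (simp only: t_def) simp
    qed
    ultimately have "t l - t (Suc l) = trace (word A B ?u ** C ** word A B ?v)"
      by (simp only: trace_diff[symmetric] word_swap_diff)
    \<comment> \<open>Cyclicity rotates \<open>C\<close> to the end; the word before it has the
      letters of \<open>w\<close> and may be rearranged into \<open>w\<close>.\<close>
    also have "\<dots> = trace (word A B ([] @ ?v @ ?u) ** C)"
      by (simp only: trace_mul_sym[of _ "word A B ?v"] word_append matrix_mul_assoc)
        (simp add: matrix_mul_assoc)
    also have "\<dots> = trace (word A B ([] @ w) ** C)"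
    proof (rule trace_word_mset[OF IH])
      show m: "mset (?v @ ?u) = mset w"
        using that by (auto simp: mw multiset_eq_iff)
      show "length ([] @ ?v @ ?u) = length w" using mset_eq_length[OF m] by simp
    qed auto
    finally show ?thesis by simp
  qed
  have "t 0 - t (Suc q) = (\<Sum>l\<le>q. t l - t (Suc l))"
    using sum_telescope[of t q] by simp
  also have "\<dots> = of_nat (Suc q) * trace (word A B w ** C)"
    using step by simp
  finally have sum: "t 0 - t (Suc q) = of_nat (Suc q) * trace (word A B w ** C)" .
  have "t (Suc q) = trace (word A B (replicate p False @ replicate (Suc q) True) ** word A B [False])"
    by (simp only: t_def word_append[symmetric]) simp
  also have "\<dots> = trace (word A B ([False] @ replicate p False @ replicate (Suc q) True))"
    by (simp only: trace_mul_sym[of _ "word A B [False]"] word_append)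
  also have "[False] @ replicate p False @ replicate (Suc q) True =
      replicate p False @ False # replicate (Suc q) True"
    by (simp add: replicate_app_Cons_same)
  finally have "t (Suc q) = t 0" by (simp add: t_def)
  with sum show ?case by (simp del: of_nat_Suc)
qed

text \<open>The trace of \<open>w C\<close> is the row of \<open>C\<close> applied to
  \<open>w e1\<close>, so this row annihilates every \<open>w e1\<close>. The vectors annihilated
  after every word form an invariant subspace, since a letter applied first is absorbed by the word;
  by cyclicity it is the whole space, and the empty word shows that the row is zero.\<close>

lemma commutator_eq_0_if_cyclic:
  assumes "cyclic_vector e1 A B"
  shows "C = 0"
proof -
  define S where "S = {v. \<forall>w. (\<Sum>j\<in>UNIV. C $ first $ j * (word A B w *v v) $ j) = 0}"
  have "(\<Sum>j\<in>UNIV. C $ first $ j * (word A B w *v (c *s x)) $ j) =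
      c * (\<Sum>j\<in>UNIV. C $ first $ j * (word A B w *v x) $ j)" for w c x
    unfolding sum_distrib_left by (simp add: vector_scalar_commute mult.left_commute)
  then have "vec.subspace S"
    by (simp add: vec.subspace_def S_def matrix_vector_right_distrib distrib_left sum.distrib)
  moreover have "e1 \<in> S"
  proof -
    have "(\<Sum>j\<in>UNIV. C $ first $ j * (word A B w *v e1) $ j) = trace (word A B w ** C)" for w
      unfolding trace_def
      by (simp add: matrix_mult_only_first_row_nth[OF C_row] e1_def mult.commute)
    then show ?thesis by (simp add: S_def trace_word_commutator)
  qed
  moreover have "A *v v \<in> S \<and> B *v v \<in> S" if "v \<in> S" for v
  proof -
    have "word A B w *v (A *v v) = word A B (w @ [False]) *v v"
      "word A B w *v (B *v v) = word A B (w @ [True]) *v v" for w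
      by (simp_all add: word_append matrix_vector_mul_assoc)
    then show ?thesis using that by (simp add: S_def)
  qed
  ultimately have "S = UNIV"
    using cyclic_vector_subspaceD[OF assms] by blast
  then have "axis k 1 \<in> S" for k by blast
  then have "(\<Sum>j\<in>UNIV. C $ first $ j * (word A B [] *v axis k 1) $ j) = 0" for k
    unfolding S_def by blast
  then have "C $ first $ k = 0" for k
    by (simp add: axis_def if_distrib cong: if_cong)
  then show ?thesis
    by (metis C_row vec_eq_iff zero_index)
qed

end

text \<open>A vanishing moment map says exactly that all rows of the commutator but the first are
  zero, which is the situation of the trace argument.\<close>

lemma zero_level_iff:
  "(A, B) \<in> zero_level \<longleftrightarrow> cyclic_vector e1 A B \<and> A ** B = B ** A"
proof
  assume L: "(A, B) \<in> zero_level"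
  then have c: "cyclic_vector e1 A B"
    and m: "(\<chi> i j. if i = first then 0 else commutator A B $ i $ j) = 0"
    by (auto simp: zero_level_def cyclic_pairs_def moment_map_def)
  have "commutator A B $ i $ j = 0" if "i \<noteq> first" for i j
    using m that by (auto simp: vec_eq_iff split: if_splits)
  then show "cyclic_vector e1 A B \<and> A ** B = B ** A"
    using commutator_eq_0_if_cyclic[OF refl _ c] c by (simp add: commutator_def)
qed (auto simp: zero_level_def cyclic_pairs_def moment_map_def commutator_def vec_eq_iff)

section \<open>Polynomial functions of the matrix entries\<close>

definition pair_of :: "(bool \<times> 'n::finite \<times> 'n \<Rightarrow> complex) \<Rightarrow> 'n mat_pair" where
  "pair_of w = (\<chi> i j. w (False, i, j), \<chi> i j. w (True, i, j))"

text \<open>Complex linearity of a real derivative \<open>D\<close> is expressed below as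
  \<open>D (scale_pair c v) = c * D v\<close>.\<close>

definition scale_pair :: "complex \<Rightarrow> 'n::finite mat_pair \<Rightarrow> 'n mat_pair" where
  "scale_pair c p = pair_of (\<lambda>m. c * entry m p)"

definition unit_pair :: "bool \<times> 'n::finite \<times> 'n \<Rightarrow> 'n mat_pair" where
  "unit_pair m = pair_of (\<lambda>m'. if m' = m then 1 else 0)"

lemma entry_pair_of [simp]: "entry m (pair_of w) = w m"
  by (cases m) (auto simp: entry_def pair_of_def)

lemma pair_eq_iff: "p = q \<longleftrightarrow> (\<forall>m. entry m p = entry m q)"
proof
  assume *: "\<forall>m. entry m p = entry m q"
  obtain A B A' B' where [simp]: "p = (A, B)" "q = (A', B')" by fastforce
  have "A $ i $ j = A' $ i $ j" "B $ i $ j = B' $ i $ j" for i j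
    using *[rule_format, of "(False, i, j)"] *[rule_format, of "(True, i, j)"]
    by (auto simp: entry_def)
  then show "p = q" by (simp add: vec_eq_iff)
qed simp

lemma pair_of_entry [simp]: "pair_of (\<lambda>m. entry m p) = p"
  by (simp add: pair_eq_iff)

lemma entry_scale_pair [simp]: "entry m (scale_pair c p) = c * entry m p"
  by (simp add: scale_pair_def)

lemma entry_add [simp]: "entry m (p + q) = entry m p + entry m q"
  by (cases m; cases p; cases q) (simp add: entry_def)

lemma entry_scaleR [simp]: "entry m (r *\<^sub>R p) = of_real r * entry m p"
  by (cases m; cases p) (simp add: entry_def scaleR_conv_of_real[where ?'a = complex])

lemma linear_entry: "linear (entry m)"
  by (rule linearI) (simp_all add: scaleR_conv_of_real)

lemma bounded_linear_entry: "bounded_linear (entry m)"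
  using linear_entry linear_conv_bounded_linear by blast

lemma entry_0 [simp]: "entry m 0 = 0"
  using linear_entry linear_0 by blast

lemma entry_sum [simp]: "entry m (sum f K) = (\<Sum>k\<in>K. entry m (f k))"
  using linear_entry linear_sum by blast

text \<open>The summand \<open>0\<close> is the base point \<open>x\<close> in
  \<open>complex_differentiable_at_has_derivative\<close>.\<close>

lemma pair_of_eq_sum: "pair_of w = 0 + (\<Sum>m\<in>UNIV. scale_pair (w m) (unit_pair m))"
  by (simp add: pair_eq_iff unit_pair_def if_distrib cong: if_cong)

lemma bounded_linear_scale_pair: "bounded_linear (\<lambda>c. scale_pair c p)"
proof -
  have "linear (\<lambda>c. scale_pair c p)"
    by (rule linearI) (simp_all add: pair_eq_iff distrib_right scaleR_conv_of_real)
  then show ?thesis using linear_conv_bounded_linear by blast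
qed

lemma continuous_on_pair_iff:
  "continuous_on S f \<longleftrightarrow> (\<forall>m. continuous_on S (\<lambda>x. entry m (f x)))"
proof
  show "continuous_on S f \<Longrightarrow> \<forall>m. continuous_on S (\<lambda>x. entry m (f x))"
    using bounded_linear.continuous_on[OF bounded_linear_entry] by blast
next
  assume *: "\<forall>m. continuous_on S (\<lambda>x. entry m (f x))"
  have "f = (\<lambda>x. pair_of (\<lambda>m. entry m (f x)))" by simp
  also have "\<dots> = (\<lambda>x. \<Sum>m\<in>UNIV. scale_pair (entry m (f x)) (unit_pair m))"
    unfolding pair_of_eq_sum by simp
  finally have f: "f = (\<lambda>x. \<Sum>m\<in>UNIV. scale_pair (entry m (f x)) (unit_pair m))" .
  have "continuous_on S (\<lambda>x. \<Sum>m\<in>UNIV. scale_pair (entry m (f x)) (unit_pair m))"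
    using * by (intro continuous_on_sum bounded_linear.continuous_on[OF bounded_linear_scale_pair]) auto
  then show "continuous_on S f" by (subst f)
qed

text \<open>An inductive predicate, so that the properties of derivatives follow by one induction;
  determinants, matrix products and evaluated polynomials stay within it.\<close>

inductive entry_polynomial :: "('n::finite mat_pair \<Rightarrow> complex) \<Rightarrow> bool" where
  const: "entry_polynomial (\<lambda>_. c)"
| entry: "entry_polynomial (entry m)"
| add: "entry_polynomial f \<Longrightarrow> entry_polynomial g \<Longrightarrow> entry_polynomial (\<lambda>p. f p + g p)"
| mult: "entry_polynomial f \<Longrightarrow> entry_polynomial g \<Longrightarrow> entry_polynomial (\<lambda>p. f p * g p)"

lemma entry_polynomial_diff:
  "entry_polynomial f \<Longrightarrow> entry_polynomial g \<Longrightarrow> entry_polynomial (\<lambda>p. f p - g p)"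
  using entry_polynomial.add[OF _ entry_polynomial.mult[OF entry_polynomial.const[of "-1"]], of f g]
  by simp

lemma entry_polynomial_sum:
  "(\<And>k. k \<in> K \<Longrightarrow> entry_polynomial (f k)) \<Longrightarrow> entry_polynomial (\<lambda>p. \<Sum>k\<in>K. f k p)"
  by (induction K rule: infinite_finite_induct) (auto intro: entry_polynomial.intros)

lemma entry_polynomial_prod:
  "(\<And>k. k \<in> K \<Longrightarrow> entry_polynomial (f k)) \<Longrightarrow> entry_polynomial (\<lambda>p. \<Prod>k\<in>K. f k p)"
  by (induction K rule: infinite_finite_induct) (auto intro: entry_polynomial.intros)

lemma entry_polynomial_det:
  assumes "\<And>i j. entry_polynomial (\<lambda>p. M p $ i $ j)"
  shows "entry_polynomial (\<lambda>p. det (M p))"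
  unfolding det_def
  by (intro entry_polynomial_sum entry_polynomial.mult entry_polynomial.const
      entry_polynomial_prod assms)

lemma entry_polynomial_fst: "entry_polynomial (\<lambda>p. fst p $ i $ j)"
  using entry_polynomial.entry[of "(False, i, j)"] by (simp add: entry_def case_prod_beta')

lemma entry_polynomial_snd: "entry_polynomial (\<lambda>p. snd p $ i $ j)"
  using entry_polynomial.entry[of "(True, i, j)"] by (simp add: entry_def case_prod_beta')

lemma entry_polynomial_matrix_mult:
  assumes "\<And>i j. entry_polynomial (\<lambda>p. M p $ i $ j)" "\<And>i j. entry_polynomial (\<lambda>p. N p $ i $ j)"
  shows "entry_polynomial (\<lambda>p. (M p ** N p) $ i $ j)"
  unfolding matrix_matrix_mult_def vec_lambda_beta
  by (intro entry_polynomial_sum entry_polynomial.mult assms)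

lemma entry_polynomial_mat_poly: "entry_polynomial (\<lambda>p. mat_poly (fst p) q $ i $ j)"
proof (induction q arbitrary: i j)
  case (pCons a q)
  then show ?case
    by (auto intro!: entry_polynomial.add entry_polynomial.const
        entry_polynomial_matrix_mult[OF entry_polynomial_fst])
qed (simp add: entry_polynomial.const)

lemma entry_polynomial_mat_poly2: "entry_polynomial (\<lambda>p. mat_poly2 (fst p) (snd p) f $ i $ j)"
proof (induction f arbitrary: i j)
  case (pCons q f)
  then show ?case
    by (auto intro!: entry_polynomial.add entry_polynomial_mat_poly
        entry_polynomial_matrix_mult[OF entry_polynomial_snd])
qed (simp add: entry_polynomial.const)

text \<open>Complex linearity of the derivative gives holomorphy; its continuity in the base point
  is what the inverse function theorem requires.\<close>

lemma entry_polynomial_has_derivative: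
  assumes "entry_polynomial f"
  shows "\<exists>f'. (\<forall>p. (f has_derivative f' p) (at p)) \<and> (\<forall>p c v. f' p (scale_pair c v) = c * f' p v) \<and>
    (\<forall>v. continuous_on UNIV (\<lambda>p. f' p v))"
  using assms
proof induction
  case (const c)
  then show ?case by (intro exI[of _ "\<lambda>_ _. 0"]) auto
next
  case (entry m)
  then show ?case
    by (intro exI[of _ "\<lambda>_. entry m"]) (auto intro: bounded_linear_imp_has_derivative bounded_linear_entry)
next
  case (add f g)
  then obtain f' g' where
    "\<forall>p. (f has_derivative f' p) (at p)" "\<forall>p c v. f' p (scale_pair c v) = c * f' p v"
    "\<forall>v. continuous_on UNIV (\<lambda>p. f' p v)"
    "\<forall>p. (g has_derivative g' p) (at p)" "\<forall>p c v. g' p (scale_pair c v) = c * g' p v"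
    "\<forall>v. continuous_on UNIV (\<lambda>p. g' p v)" by blast
  then show ?case
    by (intro exI[of _ "\<lambda>p v. f' p v + g' p v"])
      (auto intro: has_derivative_add continuous_on_add simp: distrib_left)
next
  case (mult f g)
  then obtain f' g' where
    *: "\<And>p. (f has_derivative f' p) (at p)" "\<And>p c v. f' p (scale_pair c v) = c * f' p v"
    "\<And>v. continuous_on UNIV (\<lambda>p. f' p v)"
    "\<And>p. (g has_derivative g' p) (at p)" "\<And>p c v. g' p (scale_pair c v) = c * g' p v"
    "\<And>v. continuous_on UNIV (\<lambda>p. g' p v)" by blast
  have "continuous_on UNIV f" "continuous_on UNIV g"
    using has_derivative_continuous[OF *(1)] has_derivative_continuous[OF *(4)]
    by (simp_all add: continuous_at_imp_continuous_on)
  then show ?case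
    using *(2,3,5,6) has_derivative_mult[OF *(1,4)]
    by (intro exI[of _ "\<lambda>p v. f p * g' p v + f' p v * g p"])
      (auto intro!: continuous_on_add continuous_on_mult simp: distrib_left mult_ac)
qed

lemma entry_polynomial_continuous_on:
  assumes "entry_polynomial f"
  shows "continuous_on S f"
proof -
  obtain f' where "\<And>p. (f has_derivative f' p) (at p)"
    using entry_polynomial_has_derivative[OF assms] by blast
  then have "isCont f p" for p by (rule has_derivative_continuous)
  then show ?thesis by (simp add: continuous_at_imp_continuous_on)
qed

lemma complex_differentiable_at_comp_pair_of:
  assumes "(h has_derivative D) (at (pair_of z))" "\<And>c v. D (scale_pair c v) = c * D v"
  shows "complex_differentiable_at UNIV (\<lambda>w. h (pair_of w)) z"
  unfolding pair_of_eq_sum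
  by (rule complex_differentiable_at_has_derivative[where s = scale_pair and D = D,
        OF _ _ bounded_linear_scale_pair assms(1)[unfolded pair_of_eq_sum] assms(2)]) auto

lemma openin_pair_of_vimage:
  assumes "open U"
  shows "openin (coord_space UNIV) {w. pair_of w \<in> U}"
proof -
  have "continuous_on UNIV (pair_of :: _ \<Rightarrow> 'a mat_pair)"
    unfolding continuous_on_pair_iff by simp
  then have "open {w. pair_of w \<in> U}"
    using assms open_vimage[of U pair_of] by (simp add: vimage_def)
  then show ?thesis by (simp add: coord_space_def euclidean_product_topology)
qed

text \<open>The nonvanishing of the denominator at a point persists on an open set. Polynomials are
  covered by the denominator \<open>1\<close>.\<close>

lemma holomorphic_near_rational:
  assumes f: "entry_polynomial f" and g: "entry_polynomial g" and p: "g (pair_of z) \<noteq> 0"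
  shows "holomorphic_near UNIV (\<lambda>w. f (pair_of w) / g (pair_of w)) z"
proof -
  obtain f' g' where *: "\<And>p. (f has_derivative f' p) (at p)" "\<And>p c v. f' p (scale_pair c v) = c * f' p v"
    "\<And>p. (g has_derivative g' p) (at p)" "\<And>p c v. g' p (scale_pair c v) = c * g' p v"
    using entry_polynomial_has_derivative[OF f] entry_polynomial_has_derivative[OF g] by blast
  have "continuous_on UNIV g" using g by (rule entry_polynomial_continuous_on)
  then have "open {p. g p \<noteq> 0}"
    using open_Collect_neq[of g "\<lambda>_. 0"] by (auto intro: continuous_on_const)
  then have o: "openin (coord_space UNIV) {w. pair_of w \<in> {p. g p \<noteq> 0}}"
    by (rule openin_pair_of_vimage)
  have "complex_differentiable_at UNIV (\<lambda>w. f (pair_of w) / g (pair_of w)) w"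
    if "g (pair_of w) \<noteq> 0" for w
    by (rule complex_differentiable_at_comp_pair_of[where h = "\<lambda>p. f p / g p",
          OF has_derivative_divide[OF *(1,3) that]])
      (simp add: *(2,4) algebra_simps)
  then show ?thesis
    unfolding holomorphic_near_def using p by (intro exI[of _ "{w. pair_of w \<in> {p. g p \<noteq> 0}}"] conjI o) auto
qed

lemma restrict_UNIV [simp]: "restrict f UNIV = f"
  by (simp add: restrict_def)

section \<open>Holomorphy in terms of the matrix entries\<close>

lemma holomorphic_in_coords_entry:
  assumes F: "holomorphic_near UNIV F (\<lambda>m. entry m p)"
    and V: "openin T V" "p \<in> V" "\<And>q. q \<in> V \<Longrightarrow> \<phi> q = F (\<lambda>m. entry m q)"
  shows "holomorphic_in_coords T entry \<phi> p"
  unfolding holomorphic_in_coords_def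
  by (rule exI[of _ UNIV], rule exI[of _ F], rule exI[of _ V]) (use assms in \<open>auto simp: restrict_UNIV\<close>)

lemma holomorphic_in_coords_cong:
  assumes "holomorphic_in_coords T c \<phi> p" "\<And>q. q \<in> topspace T \<Longrightarrow> \<phi> q = \<psi> q"
  shows "holomorphic_in_coords T c \<psi> p"
  using assms unfolding holomorphic_in_coords_def by (metis openin_subset subsetD)

text \<open>There are finitely many entries, so \<open>J\<close> can be enlarged to all of them by
  composing with the restriction to \<open>J\<close>.\<close>

lemma holomorphic_in_coords_entryE:
  assumes "holomorphic_in_coords T entry \<phi> p"
  obtains F V where "holomorphic_near UNIV F (\<lambda>m. entry m p)"
    "openin T V" "p \<in> V" "\<And>q. q \<in> V \<Longrightarrow> \<phi> q = F (\<lambda>m. entry m q)"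
proof -
  obtain J F V where F: "finite J" "holomorphic_near J F (\<lambda>m\<in>J. entry m p)"
    and V: "openin T V" "p \<in> V" "\<And>q. q \<in> V \<Longrightarrow> \<phi> q = F (\<lambda>m\<in>J. entry m q)"
    using assms unfolding holomorphic_in_coords_def by blast
  \<comment> \<open>Division by \<open>1\<close> gives the entry the form treated in
    \<open>holomorphic_near_rational\<close>.\<close>
  have "holomorphic_near UNIV (\<lambda>w. F (\<lambda>m\<in>J. entry m (pair_of w) / 1)) (\<lambda>m. entry m p)"
  proof (rule holomorphic_near_compose[OF finite F(1)])
    show "holomorphic_near UNIV (\<lambda>w. entry m (pair_of w) / 1) (\<lambda>m. entry m p)" for m
      by (intro holomorphic_near_rational entry_polynomial.intros) simp
  qed (use F(2) in \<open>auto simp: extensional_def\<close>)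
  then show ?thesis
    using V by (intro that[of "\<lambda>w. F (\<lambda>m\<in>J. entry m (pair_of w) / 1)" V]) auto
qed

text \<open>The quotient structure asks for holomorphy on a whole open set, while a germ is given at
  one point.\<close>

lemma holomorphic_in_coords_entry_open:
  assumes "holomorphic_in_coords (top_of_set E) entry \<phi> p"
  obtains V where "openin (top_of_set E) V" "p \<in> V"
    "\<And>q. q \<in> V \<Longrightarrow> holomorphic_in_coords (top_of_set E) entry \<phi> q"
proof -
  obtain F V where F: "holomorphic_near UNIV F (\<lambda>m. entry m p)" and
    V: "openin (top_of_set E) V" "p \<in> V" "\<And>q. q \<in> V \<Longrightarrow> \<phi> q = F (\<lambda>m. entry m q)"
    using holomorphic_in_coords_entryE[OF assms] by blast
  obtain U where U: "openin (coord_space UNIV) U" "(\<lambda>m. entry m p) \<in> U"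
    "\<And>w. w \<in> U \<Longrightarrow> holomorphic_near UNIV F w"
    using holomorphic_near_open[OF F] by blast
  have "open U" using U(1) by (simp add: coord_space_def euclidean_product_topology)
  have "continuous_on UNIV (\<lambda>q m. entry m (q :: 'a mat_pair))"
    by (intro continuous_on_coordinatewise_then_product entry_polynomial_continuous_on entry_polynomial.entry)
  then have "open {q. (\<lambda>m. entry m q) \<in> U}"
    using \<open>open U\<close> open_vimage[of U "\<lambda>q m. entry m q"] by (simp add: vimage_def)
  then have "openin (top_of_set E) (V \<inter> {q. (\<lambda>m. entry m q) \<in> U})"
    using V(1) by (metis openin_Int_open)
  then show ?thesis
    by (rule that) (use V U in \<open>auto intro!: holomorphic_in_coords_entry[OF _ V(1)]\<close>)
qed

section \<open>The group action\<close>

lemma matrix_inv_right: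
  fixes g :: "'a::semiring_1^'n^'n"
  assumes "invertible g"
  shows "g ** matrix_inv g = mat 1" "matrix_inv g ** g = mat 1"
  using assms unfolding invertible_def matrix_inv_def by (metis (mono_tags, lifting) someI_ex)+

lemma matrix_mult_right_cancel:
  fixes g :: "'n::finite cmat"
  assumes "invertible g" "X ** g = Y ** g"
  shows "X = Y"
  by (metis assms matrix_inv_right(1) matrix_mul_assoc matrix_mul_rid)

lemma invertible_matrix_inv:
  fixes g :: "'n::finite cmat"
  shows "invertible g \<Longrightarrow> invertible (matrix_inv g)"
  using matrix_inv_right invertible_def by blast

text \<open>Intertwining relations contain no inverses. They pass to limits of group elements, which
  may a priori be singular, and they make sense for elements of the Lie algebra.\<close>

lemma conj_action_eq_iff:
  assumes "(A, B) \<in> E" "invertible g"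
  shows "conj_action E g (A, B) = (A', B') \<longleftrightarrow> g ** A = A' ** g \<and> g ** B = B' ** g"
proof -
  have *: "g ** X ** matrix_inv g = Y \<longleftrightarrow> g ** X = Y ** g" for X Y
    by (metis assms(2) matrix_inv_right matrix_mul_assoc matrix_mul_rid)
  then show ?thesis using assms by (simp add: conj_action_def *)
qed

lemma stab_group_simps [simp]:
  "mult stab_group = (**)" "one stab_group = mat 1"
  by (simp_all add: stab_group_def)

lemma carrier_stab_group: "g \<in> carrier stab_group \<longleftrightarrow> invertible g \<and> g *v e1 = e1"
  by (simp add: stab_group_def column_first_eq_e1_iff)

lemma matrix_inv_mem_stab_group:
  assumes "g \<in> carrier stab_group"
  shows "matrix_inv g \<in> carrier stab_group"
  using assms by (metis carrier_stab_group invertible_matrix_inv matrix_inv_right(2)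
      matrix_vector_mul_assoc matrix_vector_mul_lid)

lemma group_stab_group: "group (stab_group :: 'n::{finite,linorder} cmat monoid)"
proof (rule groupI)
  fix x y :: "'n cmat"
  assume "x \<in> carrier stab_group" "y \<in> carrier stab_group"
  then show "x \<otimes>\<^bsub>stab_group\<^esub> y \<in> carrier stab_group"
    by (simp add: carrier_stab_group invertible_mult flip: matrix_vector_mul_assoc)
next
  show "\<one>\<^bsub>stab_group\<^esub> \<in> carrier (stab_group :: 'n cmat monoid)"
    by (auto simp: carrier_stab_group invertible_def intro!: exI[of _ "mat 1"])
next
  fix x :: "'n cmat" assume "x \<in> carrier stab_group"
  then show "\<exists>y\<in>carrier stab_group. y \<otimes>\<^bsub>stab_group\<^esub> x = \<one>\<^bsub>stab_group\<^esub>"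
    using matrix_inv_mem_stab_group matrix_inv_right(2) carrier_stab_group
    by (intro bexI[of _ "matrix_inv x"]) auto
qed (simp_all add: matrix_mul_assoc)

text \<open>Cyclicity is transported through the surjectivity of evaluation: a polynomial whose
  value for the old pair is the preimage of \<open>w\<close> under \<open>g\<close> has the value
  \<open>w\<close> for the new pair.\<close>

lemma zero_level_conj:
  fixes g :: "'n::{finite,linorder} cmat"
  assumes p: "(A, B) \<in> zero_level" and g: "invertible g" "g *v e1 = e1"
    and gA: "g ** A = A' ** g" and gB: "g ** B = B' ** g"
  shows "(A', B') \<in> zero_level"
  unfolding zero_level_iff
proof
  have AB: "A ** B = B ** A" and c: "cyclic_vector e1 A B"
    using p by (auto simp: zero_level_iff)
  have "A' ** B' ** g = g ** (A ** B)" "B' ** A' ** g = g ** (B ** A)"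
    by (metis gA gB matrix_mul_assoc)+
  then show "A' ** B' = B' ** A'"
    using AB matrix_mult_right_cancel[OF g(1)] by metis
  show "cyclic_vector e1 A' B'"
  proof (rule cyclic_vector_if_mat_poly2_surj)
    fix w
    obtain f where f: "mat_poly2 A B f *v e1 = matrix_inv g *v w"
      using cyclic_vector_mat_poly2_surj[OF c AB] by blast
    have "mat_poly2 A' B' f *v e1 = mat_poly2 A' B' f ** g *v e1"
      using g(2) by (simp flip: matrix_vector_mul_assoc)
    also have "\<dots> = g *v (matrix_inv g *v w)"
      by (simp add: f mat_poly2_intertwine[OF gA gB, symmetric] flip: matrix_vector_mul_assoc)
    also have "\<dots> = w" using matrix_inv_right(1)[OF g(1)] by (simp add: matrix_vector_mul_assoc)
    finally show "\<exists>f. mat_poly2 A' B' f *v e1 = w" by blast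
  qed
qed

abbreviation (input) zl_action :: "'n::{finite,linorder} cmat \<Rightarrow> 'n mat_pair \<Rightarrow> 'n mat_pair" where
  "zl_action \<equiv> conj_action zero_level"

lemma zl_action_mem:
  assumes "g \<in> carrier stab_group" "p \<in> zero_level"
  shows "zl_action g p \<in> zero_level"
proof -
  obtain A B A' B' where p: "p = (A, B)" "zl_action g (A, B) = (A', B')" by fastforce
  then show ?thesis
    using assms zero_level_conj[of A B g A' B'] conj_action_eq_iff[of A B zero_level g A' B']
    by (auto simp: carrier_stab_group)
qed

lemma zl_action_mult:
  assumes "g \<in> carrier stab_group" "h \<in> carrier stab_group" "p \<in> zero_level"
  shows "zl_action (g ** h) p = zl_action g (zl_action h p)"
proof -
  obtain A B A' B' A'' B'' where p: "p = (A, B)" "zl_action h (A, B) = (A', B')"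
    "zl_action g (A', B') = (A'', B'')" by (metis surj_pair)
  have p': "(A', B') \<in> zero_level" using p zl_action_mem[OF assms(2,3)] by simp
  have i: "invertible g" "invertible h" "invertible (g ** h)"
    using assms by (auto simp: carrier_stab_group invertible_mult)
  have "h ** A = A' ** h" "h ** B = B' ** h" "g ** A' = A'' ** g" "g ** B' = B'' ** g"
    using p conj_action_eq_iff[OF _ i(2), of A B zero_level A' B'] assms(3)
      conj_action_eq_iff[OF p' i(1), of A'' B''] by auto
  then have "g ** h ** A = A'' ** (g ** h)" "g ** h ** B = B'' ** (g ** h)"
    by (metis matrix_mul_assoc)+
  then have "zl_action (g ** h) (A, B) = (A'', B'')"
    using conj_action_eq_iff[OF _ i(3), of A B zero_level A'' B''] assms(3) p(1) by simp
  then show ?thesis using p by simp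
qed

lemma zl_action_one: "p \<in> zero_level \<Longrightarrow> zl_action (mat 1) p = p"
  by (cases p) (auto simp: conj_action_eq_iff invertible_def intro!: exI[of _ "mat 1"])

lemma group_action_zl_action:
  "group_action (stab_group :: 'n::{finite,linorder} cmat monoid) zero_level zl_action"
proof -
  interpret group "stab_group :: 'n cmat monoid" by (rule group_stab_group)
  have inv: "zl_action (matrix_inv g) (zl_action g p) = p"
    "zl_action g (zl_action (matrix_inv g) p) = p"
    if "g \<in> carrier stab_group" "p \<in> zero_level" for g and p :: "'n mat_pair"
    using that zl_action_mult[of "matrix_inv g" g p] zl_action_mult[of g "matrix_inv g" p]
      matrix_inv_mem_stab_group[of g] matrix_inv_right[of g]
    by (auto simp: carrier_stab_group zl_action_one)
  have bij: "zl_action g \<in> Bij zero_level" if g: "g \<in> carrier stab_group" for g :: "'n cmat"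
    unfolding Bij_def
  proof
    show "zl_action g \<in> extensional zero_level"
      by (auto simp: conj_action_def extensional_def)
    have "bij_betw (zl_action g) zero_level zero_level"
      by (rule bij_betw_byWitness[where f' = "zl_action (matrix_inv g)"])
        (use inv g in \<open>simp_all add: zl_action_mem matrix_inv_mem_stab_group image_subsetI\<close>)
    then show "zl_action g \<in> {f. bij_betw f zero_level zero_level}" by simp
  qed
  have "zl_action \<in> hom (stab_group :: 'n cmat monoid) (BijGroup zero_level)"
  proof (rule homI)
    fix g :: "'n cmat" assume "g \<in> carrier stab_group"
    then show "zl_action g \<in> carrier (BijGroup zero_level)"
      using bij by (simp add: BijGroup_def)
  next
    fix g h :: "'n cmat" assume gh: "g \<in> carrier stab_group" "h \<in> carrier stab_group"
    have "zl_action (g ** h) = compose zero_level (zl_action g) (zl_action h)"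
    proof
      fix p :: "'n mat_pair"
      \<comment> \<open>Off the zero level both sides are \<open>undefined\<close>.\<close>
      show "zl_action (g ** h) p = compose zero_level (zl_action g) (zl_action h) p"
        using gh zl_action_mult[of g h p]
        by (cases "p \<in> zero_level") (auto simp: compose_def conj_action_def)
    qed
    then show "zl_action (g \<otimes>\<^bsub>stab_group\<^esub> h) = zl_action g \<otimes>\<^bsub>BijGroup zero_level\<^esub> zl_action h"
      using gh bij by (simp add: BijGroup_def)
  qed
  then show ?thesis
    unfolding group_action_def group_hom_def group_hom_axioms_def
    using group_BijGroup group_axioms by blast
qed

text \<open>The vectors on which \<open>g\<close> and \<open>h\<close> agree form an invariant
  subspace containing \<open>e1\<close>. Singular matrices are allowed, so that with
  \<open>h = 0\<close> the lemma also gives freeness of the infinitesimal action.\<close>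

lemma intertwiner_of_cyclic_unique:
  assumes c: "cyclic_vector e1 A B" and e: "g *v e1 = h *v e1"
    and A: "g ** A = A' ** g" "h ** A = A' ** h" and B: "g ** B = B' ** g" "h ** B = B' ** h"
  shows "g = (h :: 'n::{finite,linorder} cmat)"
proof -
  have "vec.subspace {v. g *v v = h *v v}"
    by (simp add: vec.subspace_def matrix_vector_right_distrib vector_scalar_commute)
  moreover have "g *v (A *v w) = h *v (A *v w) \<and> g *v (B *v w) = h *v (B *v w)"
    if "g *v w = h *v w" for w
    unfolding matrix_vector_mul_assoc A B using that by (simp flip: matrix_vector_mul_assoc)
  ultimately have "{v. g *v v = h *v v} = UNIV"
    by (intro cyclic_vector_subspaceD[OF c]) (use e in auto)
  then show ?thesis by (auto simp: matrix_eq)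
qed

lemma free_action_zl_action: "free_action stab_group zero_level (zl_action :: 'n::{finite,linorder} cmat \<Rightarrow> _)"
  unfolding free_action_def
proof (intro conjI ballI group_action_zl_action)
  fix p :: "'n mat_pair" assume p: "p \<in> zero_level"
  obtain A B where [simp]: "p = (A, B)" by fastforce
  have 1: "g = mat 1" if "g \<in> carrier stab_group" "zl_action g p = p" for g
  proof -
    have "g ** A = A ** g" "g ** B = B ** g" "g *v e1 = e1"
      using that p conj_action_eq_iff[of A B zero_level g A B] by (simp_all add: carrier_stab_group)
    then show ?thesis
      using p by (intro intertwiner_of_cyclic_unique[of A B g "mat 1" A B]) (simp_all add: zero_level_iff)
  qed
  have 2: "mat 1 \<in> carrier (stab_group :: 'n cmat monoid)"
    using monoid.one_closed[OF group.is_monoid[OF group_stab_group]] by simp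
  show "stabilizer stab_group zl_action p = {\<one>\<^bsub>stab_group\<^esub>}"
  proof
    show "stabilizer stab_group zl_action p \<subseteq> {\<one>\<^bsub>stab_group\<^esub>}"
      unfolding stabilizer_def stab_group_simps(2) by (rule subsetI) (metis (mono_tags) 1 mem_Collect_eq singletonI)
    show "{\<one>\<^bsub>stab_group\<^esub>} \<subseteq> stabilizer stab_group zl_action p"
      unfolding stabilizer_def stab_group_simps(2) using 2 zl_action_one[OF p] by simp
  qed
qed


section \<open>Frames of polynomials\<close>

definition frame_matrix :: "('n \<Rightarrow> complex poly poly) \<Rightarrow> 'n::{finite,linorder} mat_pair \<Rightarrow> 'n cmat" where
  "frame_matrix b p = (\<chi> i j. (mat_poly2 (fst p) (snd p) (b j) *v e1) $ i)"

lemma frame_matrix_axis: "frame_matrix b p *v axis j 1 = mat_poly2 (fst p) (snd p) (b j) *v e1"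
  by (simp add: vec_eq_iff frame_matrix_def)

lemma matrix_eqI_axis:
  assumes "\<And>j. M *v axis j 1 = N *v axis j 1"
  shows "M = (N :: 'n::finite cmat)"
proof -
  have "M $ i $ j = N $ i $ j" for i j
    using arg_cong[OF assms[of j], of "\<lambda>v. v $ i"] by simp
  then show ?thesis by (simp add: vec_eq_iff)
qed

lemma frame_matrix_intertwine:
  assumes "g ** A = A' ** g" "g ** B = B' ** g" "g *v e1 = e1"
  shows "g ** frame_matrix b (A, B) = frame_matrix b (A', B')"
proof (rule matrix_eqI_axis)
  fix j
  have "g ** frame_matrix b (A, B) *v axis j 1 = g ** mat_poly2 A B (b j) *v e1"
    by (simp add: frame_matrix_axis flip: matrix_vector_mul_assoc)
  also have "\<dots> = mat_poly2 A' B' (b j) *v e1"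
    unfolding mat_poly2_intertwine[OF assms(1,2)] using assms(3) by (simp flip: matrix_vector_mul_assoc)
  finally show "g ** frame_matrix b (A, B) *v axis j 1 = frame_matrix b (A', B') *v axis j 1"
    by (simp add: frame_matrix_axis)
qed

lemma frame_matrix_zl_action:
  assumes "g \<in> carrier stab_group" "p \<in> zero_level"
  shows "frame_matrix b (zl_action g p) = g ** frame_matrix b p"
proof -
  obtain A B A' B' where p: "p = (A, B)" "zl_action g (A, B) = (A', B')" by fastforce
  then show ?thesis
    using assms frame_matrix_intertwine[of g A A' B B' b] conj_action_eq_iff[of A B zero_level g A' B']
    by (auto simp: carrier_stab_group)
qed

text \<open>Cyclicity makes every standard basis vector a value \<open>f(A, B) e1\<close>, and
  \<open>1\<close> is a choice for \<open>e1\<close>. Because of \<open>b first = 1\<close> the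
  frame matrices fix \<open>e1\<close>, so the invertible ones lie in the group.\<close>

lemma frame_exists:
  fixes p :: "'n::{finite,linorder} mat_pair"
  assumes "p \<in> zero_level"
  obtains b where "b first = 1" "frame_matrix b p = mat 1"
proof -
  obtain A B where p: "p = (A, B)" by fastforce
  have "\<forall>j. \<exists>f. (j = first \<longrightarrow> f = 1) \<and> mat_poly2 A B f *v e1 = axis j 1"
  proof
    fix j :: 'n
    obtain f where f: "mat_poly2 A B f *v e1 = axis j 1"
      using assms p zero_level_iff cyclic_vector_mat_poly2_surj by blast
    then show "\<exists>f. (j = first \<longrightarrow> f = 1) \<and> mat_poly2 A B f *v e1 = axis j 1"
      by (intro exI[of _ "if j = first then 1 else f"]) (auto simp: e1_def)
  qed
  then obtain b where b: "\<And>j. (j = first \<longrightarrow> b j = 1) \<and> mat_poly2 A B (b j) *v e1 = axis j 1"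
    by metis
  show ?thesis
  proof (rule that)
    show "frame_matrix b p = mat 1"
      by (rule matrix_eqI_axis) (simp add: frame_matrix_axis p b)
  qed (use b in auto)
qed

lemma entry_polynomial_frame_matrix: "entry_polynomial (\<lambda>p. frame_matrix b p $ i $ j)"
  unfolding frame_matrix_def matrix_vector_mult_def vec_lambda_beta
  by (intro entry_polynomial_sum entry_polynomial.mult entry_polynomial_mat_poly2 entry_polynomial.const)


section \<open>Properness\<close>

lemma tendsto_matrix_mult:
  fixes f g :: "'a \<Rightarrow> 'n::finite cmat"
  assumes "(f \<longlongrightarrow> a) F" "(g \<longlongrightarrow> b) F"
  shows "((\<lambda>x. f x ** g x) \<longlongrightarrow> a ** b) F"
  unfolding matrix_matrix_mult_def
  by (intro vec_tendstoI, simp) (intro tendsto_sum tendsto_mult tendsto_vec_nth assms)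

lemma tendsto_det:
  fixes f :: "'a \<Rightarrow> 'n::finite cmat"
  assumes "(f \<longlongrightarrow> a) F"
  shows "((\<lambda>x. det (f x)) \<longlongrightarrow> det a) F"
  unfolding det_def by (intro tendsto_sum tendsto_mult tendsto_prod tendsto_const tendsto_vec_nth assms)

text \<open>Used twice: it makes inversion continuous, and it makes the coefficient functions
  rational.\<close>

lemma matrix_inv_mult_cramer:
  fixes M :: "'n::finite cmat"
  assumes "invertible M"
  shows "matrix_inv M *v v = (\<chi> k. det (\<chi> i j. if j = k then v $ i else M $ i $ j) / det M)"
proof -
  have "det M \<noteq> 0" using assms invertible_det_nz by blast
  moreover have "M *v (matrix_inv M *v v) = v"
    using matrix_inv_right(1)[OF assms] by (simp add: matrix_vector_mul_assoc)
  ultimately show ?thesis using cramer by blast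
qed

lemma tendsto_matrix_inv:
  fixes f :: "'a \<Rightarrow> 'n::finite cmat"
  assumes f: "(f \<longlongrightarrow> a) F" and a: "invertible a"
  shows "((\<lambda>x. matrix_inv (f x)) \<longlongrightarrow> matrix_inv a) F"
proof -
  have inv_nth: "matrix_inv M $ i $ j =
      det (\<chi> k l. if l = i then axis j 1 $ k else M $ k $ l) / det M" if "invertible M" for M :: "'n cmat" and i j
    using arg_cong[OF matrix_inv_mult_cramer[OF that, of "axis j 1"], of "\<lambda>v. v $ i"] by simp
  have "det a \<noteq> 0" using a invertible_det_nz by blast
  then have ev: "\<forall>\<^sub>F x in F. det (f x) \<noteq> 0"
    using tendsto_imp_eventually_ne[OF tendsto_det[OF f]] by blast
  have "((\<lambda>x. matrix_inv (f x) $ i $ j) \<longlongrightarrow> matrix_inv a $ i $ j) F" for i j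
  proof (rule Lim_transform_eventually)
    show "\<forall>\<^sub>F x in F. det (\<chi> k l. if l = i then axis j 1 $ k else f x $ k $ l) / det (f x) =
        matrix_inv (f x) $ i $ j"
      using ev by eventually_elim (simp add: inv_nth invertible_det_nz)
    have "((\<lambda>x. (\<chi> k l. if l = i then axis j 1 $ k else f x $ k $ l) :: 'n cmat) \<longlongrightarrow>
        (\<chi> k l. if l = i then axis j 1 $ k else a $ k $ l)) F"
      by (intro vec_tendstoI) (auto intro!: tendsto_vec_nth f)
    then show "((\<lambda>x. det (\<chi> k l. if l = i then axis j 1 $ k else f x $ k $ l) / det (f x)) \<longlongrightarrow>
        matrix_inv a $ i $ j) F"
      unfolding inv_nth[OF a] using f \<open>det a \<noteq> 0\<close> by (intro tendsto_divide tendsto_det)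
  qed
  then show ?thesis by (intro vec_tendstoI)
qed

lemma tendsto_frame_matrix:
  assumes "(x \<longlongrightarrow> p) F"
  shows "((\<lambda>k. frame_matrix b (x k)) \<longlongrightarrow> frame_matrix b p) F"
proof -
  have "isCont (\<lambda>p. frame_matrix b p $ i $ j) p" for i j
    using entry_polynomial_continuous_on[OF entry_polynomial_frame_matrix, of UNIV b i j]
    unfolding continuous_on_eq_continuous_at[OF open_UNIV] by blast
  then show ?thesis
    using assms by (intro vec_tendstoI) (auto intro: isCont_tendsto_compose)
qed

lemma continuous_on_zl_action:
  "continuous_on (carrier stab_group \<times> zero_level) (\<lambda>(g, x). (zl_action g x, x :: 'n::{finite,linorder} mat_pair))"
  unfolding continuous_on_def
proof
  fix q :: "'n cmat \<times> 'n mat_pair" assume q: "q \<in> carrier stab_group \<times> zero_level"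
  let ?F = "at q within carrier stab_group \<times> zero_level"
  have t: "((\<lambda>x. x) \<longlongrightarrow> q) ?F" by (rule tendsto_ident_at)
  have i: "((\<lambda>x. matrix_inv (fst x)) \<longlongrightarrow> matrix_inv (fst q)) ?F"
    using q by (intro tendsto_matrix_inv tendsto_fst t) (auto simp: carrier_stab_group)
  have lim: "((\<lambda>x. ((fst x ** fst (snd x) ** matrix_inv (fst x), fst x ** snd (snd x) ** matrix_inv (fst x)), snd x))
    \<longlongrightarrow> ((fst q ** fst (snd q) ** matrix_inv (fst q), fst q ** snd (snd q) ** matrix_inv (fst q)), snd q)) ?F"
    by (intro tendsto_Pair tendsto_matrix_mult i tendsto_fst tendsto_snd t)
  have eq: "(case x of (g, p) \<Rightarrow> (zl_action g p, p)) =
      ((fst x ** fst (snd x) ** matrix_inv (fst x), fst x ** snd (snd x) ** matrix_inv (fst x)), snd x)"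
    if "x \<in> carrier stab_group \<times> zero_level" for x
    using that by (auto simp: conj_action_def)
  show "((\<lambda>(g, x). (zl_action g x, x)) \<longlongrightarrow> (case q of (g, x) \<Rightarrow> (zl_action g x, x))) ?F"
    unfolding eq[OF q]
    by (rule Lim_transform_eventually[OF lim])
      (auto simp: eventually_at_filter eq simp del: split_paired_All)
qed

text \<open>A limit of group elements might be singular. Cyclicity of the target excludes this:
  every vector is of the form \<open>f(A', B') e1 = g f(A, B) e1\<close>, so \<open>g\<close> is
  surjective.\<close>

lemma intertwiner_invertible:
  fixes g :: "'n::{finite,linorder} cmat"
  assumes "(A', B') \<in> zero_level" "g *v e1 = e1" "g ** A = A' ** g" "g ** B = B' ** g"
  shows "invertible g"
proof -
  have "\<exists>v. g *v v = w" for w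
  proof -
    obtain f where "mat_poly2 A' B' f *v e1 = w"
      using assms(1) zero_level_iff cyclic_vector_mat_poly2_surj by blast
    then have "g *v (mat_poly2 A B f *v e1) = w"
      unfolding matrix_vector_mul_assoc mat_poly2_intertwine[OF assms(3,4)]
      by (simp add: assms(2) flip: matrix_vector_mul_assoc)
    then show ?thesis by blast
  qed
  then have "surj ((*v) g)" by (metis surj_def)
  then show ?thesis
    by (simp add: invertible_right_inverse matrix_right_invertible_surjective)
qed

text \<open>
  With a frame \<open>b\<close> at the limit of \<open>x k\<close>, the group element is recovered from \<open>g k \<cdot> x k\<close> and \<open>x k\<close> as
  \<open>frame (g k \<cdot> x k) \<cdot> (frame (x k))\<^sup>-\<^sup>1\<close>, so it converges.
\<close>

lemma zl_action_sequentially_proper: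
  fixes x :: "nat \<Rightarrow> 'n::{finite,linorder} mat_pair"
  assumes g: "\<And>k. g k \<in> carrier stab_group" and x: "\<And>k. x k \<in> zero_level"
    and xp: "x \<longlonglongrightarrow> p" and yq: "(\<lambda>k. zl_action (g k) (x k)) \<longlonglongrightarrow> q"
    and p: "p \<in> zero_level" and q: "q \<in> zero_level"
  obtains h where "g \<longlonglongrightarrow> h" "h \<in> carrier stab_group" "zl_action h p = q"
proof -
  obtain b where b: "frame_matrix b p = mat 1" using frame_exists[OF p] by blast
  have fx: "(\<lambda>k. frame_matrix b (x k)) \<longlonglongrightarrow> mat 1"
    using tendsto_frame_matrix[OF xp, of b] b by simp
  have im: "invertible (mat 1 :: 'n cmat)" by (auto simp: invertible_def intro: exI[of _ "mat 1"])
  \<comment> \<open>The frame of \<open>p\<close> is \<open>mat 1\<close>; its inverse is kept so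
    that \<open>h\<close> has the shape of the limit of the products below.\<close>
  define h where "h = frame_matrix b q ** matrix_inv (mat 1)"
  have lim: "(\<lambda>k. frame_matrix b (zl_action (g k) (x k)) ** matrix_inv (frame_matrix b (x k))) \<longlonglongrightarrow> h"
    unfolding h_def by (intro tendsto_matrix_mult tendsto_frame_matrix yq tendsto_matrix_inv fx im)
  have "det (mat 1 :: 'n cmat) \<noteq> 0" by simp
  then have "\<forall>\<^sub>F k in sequentially. det (frame_matrix b (x k)) \<noteq> 0"
    using tendsto_imp_eventually_ne[OF tendsto_det[OF fx]] by blast
  then have "\<forall>\<^sub>F k in sequentially.
      frame_matrix b (zl_action (g k) (x k)) ** matrix_inv (frame_matrix b (x k)) = g k"
  proof eventually_elim
    case (elim k)
    then have "invertible (frame_matrix b (x k))" by (simp add: invertible_det_nz)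
    then show ?case
      using frame_matrix_zl_action[OF g x, of b k k] matrix_inv_right(1)
      by (metis matrix_mul_assoc matrix_mul_rid)
  qed
  then have gh: "g \<longlonglongrightarrow> h" using lim Lim_transform_eventually by blast
  have he: "h *v e1 = e1"
  proof (rule LIMSEQ_unique)
    show "(\<lambda>k. g k *v e1) \<longlonglongrightarrow> h *v e1"
      unfolding matrix_vector_mult_def by (intro vec_tendstoI) (auto intro!: tendsto_intros gh tendsto_vec_nth)
    show "(\<lambda>k. g k *v e1) \<longlonglongrightarrow> e1" using g by (simp add: carrier_stab_group)
  qed
  have int: "g k ** fst (x k) = fst (zl_action (g k) (x k)) ** g k \<and>
      g k ** snd (x k) = snd (zl_action (g k) (x k)) ** g k" for k
    using conj_action_eq_iff[of "fst (x k)" "snd (x k)" zero_level "g k"] g[of k] x[of k]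
    by (auto simp: carrier_stab_group simp flip: prod_eq_iff) (metis prod.collapse)+
  have hA: "h ** fst p = fst q ** h"
  proof (rule LIMSEQ_unique)
    show "(\<lambda>k. g k ** fst (x k)) \<longlonglongrightarrow> h ** fst p"
      by (intro tendsto_matrix_mult gh tendsto_fst xp)
    show "(\<lambda>k. g k ** fst (x k)) \<longlonglongrightarrow> fst q ** h"
      unfolding int[THEN conjunct1] by (intro tendsto_matrix_mult gh tendsto_fst yq)
  qed
  have hB: "h ** snd p = snd q ** h"
  proof (rule LIMSEQ_unique)
    show "(\<lambda>k. g k ** snd (x k)) \<longlonglongrightarrow> h ** snd p"
      by (intro tendsto_matrix_mult gh tendsto_snd xp)
    show "(\<lambda>k. g k ** snd (x k)) \<longlonglongrightarrow> snd q ** h"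
      unfolding int[THEN conjunct2] by (intro tendsto_matrix_mult gh tendsto_snd yq)
  qed
  have hi: "invertible h"
    using intertwiner_invertible[OF _ he hA hB] q by simp
  then have "zl_action h p = q"
    using conj_action_eq_iff[of "fst p" "snd p" zero_level h "fst q" "snd q"] hA hB p by simp
  then show ?thesis using gh hi he by (intro that) (auto simp: carrier_stab_group)
qed

text \<open>For a limit point of the image, the preimages of an approximating sequence converge by
  \<open>zl_action_sequentially_proper\<close>, and their limit lies in the closed set
  \<open>C\<close>.\<close>

lemma zl_action_graph_closed_map:
  "closed_map (top_of_set (carrier stab_group \<times> zero_level)) (top_of_set (zero_level \<times> zero_level))
     (\<lambda>(g, x). (zl_action g x, x :: 'n::{finite,linorder} mat_pair))"
  unfolding closed_map_def
proof (intro allI impI)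
  fix C :: "('n cmat \<times> 'n mat_pair) set"
  assume C: "closedin (top_of_set (carrier stab_group \<times> zero_level)) C"
  let ?f = "\<lambda>(g, x). (zl_action g x, x :: 'n mat_pair)"
  have sub: "C \<subseteq> carrier stab_group \<times> zero_level" using C closedin_imp_subset by blast
  show "closedin (top_of_set (zero_level \<times> zero_level)) (?f ` C)"
    unfolding closedin_limpt
  proof (intro conjI allI impI)
    show "?f ` C \<subseteq> zero_level \<times> zero_level"
    proof (rule image_subsetI)
      fix c assume "c \<in> C"
      then have "fst c \<in> carrier stab_group" "snd c \<in> zero_level" using sub by auto
      then show "?f c \<in> zero_level \<times> zero_level"
        by (simp add: case_prod_beta zl_action_mem)
    qed
    fix z assume z: "z islimpt ?f ` C \<and> z \<in> zero_level \<times> zero_level"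
    then obtain s where s: "\<And>k :: nat. s k \<in> ?f ` C" "s \<longlonglongrightarrow> z"
      unfolding islimpt_sequential by blast
    define c where "c = (\<lambda>k. SOME c. c \<in> C \<and> s k = ?f c)"
    have "c k \<in> C \<and> s k = ?f (c k)" for k
      unfolding c_def by (rule someI_ex) (use s(1)[of k] in blast)
    then have c: "\<And>k. c k \<in> C" "\<And>k. s k = ?f (c k)" by blast+
    have x: "(\<lambda>k. snd (c k)) \<longlonglongrightarrow> snd z" and y: "(\<lambda>k. zl_action (fst (c k)) (snd (c k))) \<longlonglongrightarrow> fst z"
      using tendsto_snd[OF s(2)] tendsto_fst[OF s(2)] by (simp_all add: c(2) case_prod_beta)
    have gx: "fst (c k) \<in> carrier stab_group" "snd (c k) \<in> zero_level" for k
      using c(1)[of k] sub by auto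
    have z': "snd z \<in> zero_level" "fst z \<in> zero_level" using z by auto
    obtain h where h: "(\<lambda>k. fst (c k)) \<longlonglongrightarrow> h" "h \<in> carrier stab_group" "zl_action h (snd z) = fst z"
      using zl_action_sequentially_proper[OF gx x y z'] by blast
    have "c \<longlonglongrightarrow> (h, snd z)" using tendsto_Pair[OF h(1) x] by simp
    moreover obtain T where T: "closed T" "C = carrier stab_group \<times> zero_level \<inter> T"
      using C unfolding closedin_closed by blast
    ultimately have "(h, snd z) \<in> T"
      using c(1) closed_sequentially[of T c "(h, snd z)"] by blast
    then have "(h, snd z) \<in> C" using T(2) h(2) z' by blast
    then show "z \<in> ?f ` C"
      using h(3) by (intro image_eqI[of _ _ "(h, snd z)"]) auto
  qed
qed

text \<open>Freeness makes the graph map injective, so its fibres have at most one point and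
  closedness gives properness.\<close>

lemma proper_action_zl_action:
  "proper_action stab_group zero_level (zl_action :: 'n::{finite,linorder} cmat \<Rightarrow> _)"
  unfolding proper_action_def
proof (intro conjI group_action_zl_action closed_injective_imp_proper_map zl_action_graph_closed_map)
  let ?f = "\<lambda>(g, x). (zl_action g x, x :: 'n mat_pair)"
  show "continuous_map (top_of_set (carrier stab_group \<times> zero_level))
      (top_of_set (zero_level \<times> zero_level)) ?f"
    using continuous_on_zl_action zl_action_mem by (auto simp: continuous_map_in_subtopology)
  show "inj_on ?f (topspace (top_of_set (carrier stab_group \<times> zero_level)))"
  proof (rule inj_onI, clarsimp)
    fix g h and A B :: "'n cmat"
    assume *: "g \<in> carrier stab_group" "h \<in> carrier stab_group" "(A, B) \<in> zero_level"
      "zl_action g (A, B) = zl_action h (A, B)"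
    obtain A' B' where q: "zl_action h (A, B) = (A', B')" by fastforce
    have "g ** A = A' ** g" "g ** B = B' ** g" "h ** A = A' ** h" "h ** B = B' ** h"
      using * q conj_action_eq_iff[of A B zero_level g A' B'] conj_action_eq_iff[of A B zero_level h A' B']
      by (auto simp: carrier_stab_group)
    then show "g = h"
      using * by (intro intertwiner_of_cyclic_unique[of A B g h A' B'])
        (simp_all add: carrier_stab_group zero_level_iff)
  qed
qed

section \<open>Ideals of finite codimension and commuting pairs\<close>

text \<open>Any bijection will do; \<open>first\<close> need not receive the index 0, hence the
  recurring condition \<open>b (idx first) = 1\<close>.\<close>

definition idx :: "'n::finite \<Rightarrow> nat" where
  "idx = (SOME f. bij_betw f UNIV {..<CARD('n)})"

lemma bij_betw_idx: "bij_betw (idx :: 'n::finite \<Rightarrow> nat) UNIV {..<CARD('n)}"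
proof -
  have "\<exists>f :: 'n \<Rightarrow> nat. bij_betw f UNIV {..<CARD('n)}"
    using ex_bij_betw_finite_nat[of "UNIV :: 'n set"] by (auto simp: atLeast0LessThan)
  then show ?thesis unfolding idx_def by (rule someI_ex)
qed

lemma idx_less [simp]: "idx (i :: 'n::finite) < CARD('n)"
  using bij_betwE[OF bij_betw_idx] by auto

lemma idx_surj:
  assumes "k < CARD('n)"
  obtains i :: "'n::finite" where "idx i = k"
  using assms bij_betw_imp_surj_on[OF bij_betw_idx[where 'n = 'n]] by (metis imageE lessThan_iff)

section \<open>Coefficient vectors in the quotient by an ideal\<close>

definition poly_comb :: "(nat \<Rightarrow> complex poly poly) \<Rightarrow> complex^'n::finite \<Rightarrow> complex poly poly" where
  "poly_comb b v = (\<Sum>i\<in>UNIV. smult [:v $ i:] (b (idx i)))"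

definition coeff_vec ::
    "(nat \<Rightarrow> complex poly poly) \<Rightarrow> complex poly poly \<Rightarrow> complex poly poly set \<Rightarrow> complex^'n::finite" where
  "coeff_vec b f I = (\<chi> i. basis_coeff CARD('n) b (f, idx i) I)"

lemma poly_comb_vec: "poly_comb b (\<chi> i. a (idx i) :: complex^'n::finite) = (\<Sum>k<CARD('n). smult [:a k:] (b k))"
  unfolding poly_comb_def
  using sum.reindex_bij_betw[OF bij_betw_idx[where 'n = 'n], of "\<lambda>k. smult [:a k:] (b k)"] by simp

lemma bij_betw_vec_of_fun:
  "bij_betw (\<lambda>a. \<chi> i. a (idx i) :: complex^'n::finite) ({..<CARD('n)} \<rightarrow>\<^sub>E UNIV) UNIV"
proof (rule bij_betw_byWitness[where f' = "\<lambda>v. \<lambda>k\<in>{..<CARD('n)}. v $ inv_into UNIV idx k"])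
  have inv: "inv_into UNIV idx (idx i) = i" for i :: 'n
    by (rule inv_into_f_f) (auto intro: bij_betw_imp_inj_on[OF bij_betw_idx])
  show "\<forall>a\<in>{..<CARD('n)} \<rightarrow>\<^sub>E UNIV.
      (\<lambda>k\<in>{..<CARD('n)}. (\<chi> i. a (idx i) :: complex^'n) $ inv_into UNIV idx k) = a"
  proof
    fix a :: "nat \<Rightarrow> complex" assume a: "a \<in> {..<CARD('n)} \<rightarrow>\<^sub>E UNIV"
    show "(\<lambda>k\<in>{..<CARD('n)}. (\<chi> i. a (idx i) :: complex^'n) $ inv_into UNIV idx k) = a"
    proof
      fix k show "(\<lambda>k\<in>{..<CARD('n)}. (\<chi> i. a (idx i) :: complex^'n) $ inv_into UNIV idx k) k = a k"
      proof (cases "k < CARD('n)")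
        case True
        then obtain i :: 'n where "idx i = k" by (rule idx_surj)
        then show ?thesis using True inv by auto
      qed (use a in \<open>auto simp: PiE_iff extensional_def\<close>)
    qed
  qed
  show "\<forall>v\<in>UNIV. (\<chi> i. (\<lambda>k\<in>{..<CARD('n)}. v $ inv_into UNIV idx k) (idx i) :: complex^'n) = v"
    by (simp add: vec_eq_iff inv)
qed (auto split: if_splits)

text \<open>Replaces the coefficient functions extensional on an initial segment, which occur in the
  definition of the charts, by vectors, on which matrices act.\<close>

lemma ex1_vec_iff:
  "(\<exists>!a. a \<in> {..<CARD('n)} \<rightarrow>\<^sub>E UNIV \<and> P (\<chi> i. a (idx i) :: complex^'n::finite)) \<longleftrightarrow> (\<exists>!v. P v)"
  (is "(\<exists>!a. a \<in> ?S \<and> P (?h a)) \<longleftrightarrow> _")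
proof -
  have inj: "\<And>a a'. a \<in> ?S \<Longrightarrow> a' \<in> ?S \<Longrightarrow> ?h a = ?h a' \<Longrightarrow> a = a'"
    using bij_betw_imp_inj_on[OF bij_betw_vec_of_fun[where 'n = 'n]] unfolding inj_on_def by blast
  have surj: "\<exists>a\<in>?S. v = ?h a" for v
    using bij_betw_imp_surj_on[OF bij_betw_vec_of_fun[where 'n = 'n]] by blast
  show ?thesis
  proof
    assume "\<exists>!a. a \<in> ?S \<and> P (?h a)"
    then obtain a where a: "a \<in> ?S \<and> P (?h a)" and u: "\<forall>a'. a' \<in> ?S \<and> P (?h a') \<longrightarrow> a' = a"
      by (rule ex1E)
    show "\<exists>!v. P v"
    proof (rule ex1I[of P, OF conjunct2[OF a]])
      fix v assume v: "P v"
      obtain a' where a': "a' \<in> ?S" "v = ?h a'" using surj[of v] by blast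
      have "a' = a" using u a'(1) v a'(2) by simp
      then show "v = ?h a" using a'(2) by simp
    qed
  next
    assume "\<exists>!v. P v"
    then obtain v where v: "P v" "\<forall>w. P w \<longrightarrow> w = v" by (rule ex1E)
    obtain a where a: "a \<in> ?S" "v = ?h a" using surj[of v] by blast
    show "\<exists>!a. a \<in> ?S \<and> P (?h a)"
    proof (rule ex1I[of _ a])
      show "a \<in> ?S \<and> P (?h a)" using a v(1) by simp
      fix a' assume a': "a' \<in> ?S \<and> P (?h a')"
      then have "?h a' = v" using v(2) by blast
      then have "?h a' = ?h a" using a(2) by (rule trans)
      then show "a' = a" using inj a(1) a' by blast
    qed
  qed
qed

lemma quotient_basis_iff:
  "quotient_basis CARD('n::finite) b I \<longleftrightarrow> (\<forall>f. \<exists>!v :: complex^'n. f - poly_comb b v \<in> I)"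
  unfolding quotient_basis_def ex1_vec_iff[where P = "\<lambda>v. _ - poly_comb b v \<in> I", symmetric]
  by (simp only: poly_comb_vec)

text \<open>Eliminates the definite description in \<open>basis_coeff\<close>: from here on
  coefficient vectors are handled through membership in the ideal.\<close>

lemma diff_poly_comb_mem_iff:
  fixes v :: "complex^'n::finite"
  assumes "quotient_basis CARD('n) b I"
  shows "f - poly_comb b v \<in> I \<longleftrightarrow> v = coeff_vec b f I"
proof -
  have ex1: "\<exists>!a. a \<in> {..<CARD('n)} \<rightarrow>\<^sub>E UNIV \<and> f - (\<Sum>k<CARD('n). smult [:a k:] (b k)) \<in> I"
    using assms unfolding quotient_basis_def by blast
  define a where "a = (THE a. a \<in> {..<CARD('n)} \<rightarrow>\<^sub>E UNIV \<and> f - (\<Sum>k<CARD('n). smult [:a k:] (b k)) \<in> I)"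
  have "f - (\<Sum>k<CARD('n). smult [:a k:] (b k)) \<in> I"
    using theI'[OF ex1] unfolding a_def by blast
  moreover have "coeff_vec b f I = (\<chi> i. a (idx i) :: complex^'n)"
    by (simp add: coeff_vec_def basis_coeff_def a_def)
  ultimately have "f - poly_comb b (coeff_vec b f I :: complex^'n) \<in> I"
    by (simp only: poly_comb_vec)
  then show ?thesis using assms[unfolded quotient_basis_iff] by blast
qed

text \<open>Coefficient functions with an index \<open>k\<close> beyond the basis also count as
  coordinates in the structure sheaf; they are constant on the chart and so add no holomorphic
  functions.\<close>

lemma basis_coeff_out_of_range:
  assumes "quotient_basis n b I" "\<not> k < n"
  shows "basis_coeff n b (f, k) I = undefined"
proof -
  have "\<exists>!a. a \<in> {..<n} \<rightarrow>\<^sub>E UNIV \<and> f - (\<Sum>k<n. smult [:a k:] (b k)) \<in> I"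
    using assms unfolding quotient_basis_def by blast
  from theI'[OF this] show ?thesis
    using assms(2) by (auto simp: basis_coeff_def PiE_iff extensional_def)
qed

lemma poly_comb_add: "poly_comb b (v + w) = poly_comb b v + poly_comb b (w :: complex^'n::finite)"
proof -
  have "smult [:c + d:] f = smult [:c:] f + smult [:d:] f" for c d :: complex and f :: "complex poly poly"
    using smult_add_left[of "[:c:]" "[:d:]" f] by simp
  then show ?thesis by (simp add: poly_comb_def sum.distrib)
qed

lemma poly_comb_scale: "poly_comb b (c *s v) = smult [:c:] (poly_comb b (v :: complex^'n::finite))"
  by (simp add: poly_comb_def poly_eq_iff coeff_sum sum_distrib_left mult_ac)

lemma poly_comb_0 [simp]: "poly_comb b (0 :: complex^'n::finite) = 0"
  using poly_comb_scale[of b 0 "0 :: complex^'n"] by simp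

lemma poly_comb_sum: "poly_comb b (\<Sum>k\<in>K. v k :: complex^'n::finite) = (\<Sum>k\<in>K. poly_comb b (v k))"
  by (induction K rule: infinite_finite_induct) (simp_all add: poly_comb_add)

lemma poly_comb_axis: "poly_comb b (axis j 1 :: complex^'n::finite) = b (idx j)"
proof -
  have "poly_comb b (axis j 1 :: complex^'n) = (\<Sum>i\<in>UNIV. if i = j then b (idx j) else 0)"
    unfolding poly_comb_def by (rule sum.cong) (auto simp: axis_def simp flip: one_pCons)
  then show ?thesis by simp
qed

definition mult_matrix ::
    "complex poly poly set \<Rightarrow> (nat \<Rightarrow> complex poly poly) \<Rightarrow> complex poly poly \<Rightarrow> 'n::finite cmat" where
  "mult_matrix I b h = (\<chi> i j. coeff_vec b (h * b (idx j)) I $ i)"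

context
  fixes I :: "complex poly poly set" and b :: "nat \<Rightarrow> complex poly poly"
  assumes I: "I \<in> hilb_chart CARD('n::{finite,linorder}) b"
begin

private abbreviation cc :: "complex poly poly \<Rightarrow> (complex, 'n) vec" where
  "cc f \<equiv> coeff_vec b f I"

private abbreviation mm :: "complex poly poly \<Rightarrow> 'n cmat" where
  "mm h \<equiv> mult_matrix I b h"

lemma chart_quotient_basis: "quotient_basis CARD('n) b I"
  using I by (simp add: hilb_chart_def)

lemma chart_ideal_add: "f \<in> I \<Longrightarrow> g \<in> I \<Longrightarrow> f + g \<in> I"
  and chart_ideal_mult: "f \<in> I \<Longrightarrow> h * f \<in> I"
  and chart_ideal_0: "0 \<in> I"
  using I by (auto simp: hilb_chart_def poly_ideal_def)

lemma chart_ideal_smult: "f \<in> I \<Longrightarrow> smult c f \<in> I"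
  using chart_ideal_mult[of f "[:c:]"] by simp

lemma chart_ideal_sum: "(\<And>k. k \<in> K \<Longrightarrow> f k \<in> I) \<Longrightarrow> sum f K \<in> I"
  by (induction K rule: infinite_finite_induct) (auto intro: chart_ideal_0 chart_ideal_add)

lemma coeff_vec_eqI: "f - poly_comb b v \<in> I \<Longrightarrow> cc f = v"
  using diff_poly_comb_mem_iff[OF chart_quotient_basis, of f v] by simp

lemma diff_coeff_vec_mem: "f - poly_comb b (cc f) \<in> I"
  using diff_poly_comb_mem_iff[OF chart_quotient_basis, of f "cc f"] by simp

lemma coeff_vec_poly_comb: "cc (poly_comb b v) = v"
  by (rule coeff_vec_eqI) (simp add: chart_ideal_0)

lemma coeff_vec_basis: "cc (b (idx j)) = axis j 1"
  using coeff_vec_poly_comb[of "axis j 1"] by (simp add: poly_comb_axis)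

lemma coeff_vec_eq_0_iff: "cc f = 0 \<longleftrightarrow> f \<in> I"
  using diff_poly_comb_mem_iff[OF chart_quotient_basis, of f 0] by auto

lemma coeff_vec_add: "cc (f + g) = cc f + cc g"
proof (rule coeff_vec_eqI)
  have "f + g - poly_comb b (cc f + cc g) = (f - poly_comb b (cc f)) + (g - poly_comb b (cc g))"
    by (simp add: poly_comb_add)
  then show "f + g - poly_comb b (cc f + cc g) \<in> I"
    using chart_ideal_add diff_coeff_vec_mem by metis
qed

lemma coeff_vec_smult: "cc (smult [:c:] f) = c *s cc f"
proof (rule coeff_vec_eqI)
  have "smult [:c:] f - poly_comb b (c *s cc f) = smult [:c:] (f - poly_comb b (cc f))"
    by (simp add: poly_comb_scale smult_diff_right)
  then show "smult [:c:] f - poly_comb b (c *s cc f) \<in> I"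
    using chart_ideal_smult diff_coeff_vec_mem by metis
qed

text \<open>Subtracting its basis expansion from \<open>f\<close> leaves an element of
  \<open>I\<close>, and multiplication by \<open>h\<close> preserves \<open>I\<close>; so
  \<open>h\<close> acts on classes through its values on the basis.\<close>

lemma mult_matrix_coeff_vec: "mm h *v cc f = cc (h * f)"
proof (rule coeff_vec_eqI[symmetric])
  let ?v = "cc f"
  have M: "mm h *v ?v = (\<Sum>j\<in>UNIV. ?v $ j *s cc (h * b (idx j)))"
    by (simp add: vec_eq_iff mult_matrix_def matrix_vector_mult_def mult.commute)
  have "h * f - poly_comb b (mm h *v ?v) =
      h * (f - poly_comb b ?v) + (\<Sum>j\<in>UNIV. smult [:?v $ j:] (h * b (idx j) - poly_comb b (cc (h * b (idx j)))))"
    unfolding M poly_comb_sum poly_comb_scale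
    by (simp add: right_diff_distrib smult_diff_right sum_subtractf poly_comb_def[of b ?v] sum_distrib_left)
  also have "\<dots> \<in> I"
    by (intro chart_ideal_add chart_ideal_mult chart_ideal_sum chart_ideal_smult diff_coeff_vec_mem)
  finally show "h * f - poly_comb b (mm h *v ?v) \<in> I" .
qed

private abbreviation "mult_x \<equiv> mm [:[:0, 1:]:]"
private abbreviation "mult_y \<equiv> mm [:0, 1:]"

text \<open>Checked on the basis, where both sides give the class of the product of
  \<open>g\<close>, \<open>h\<close> and a basis element.\<close>

lemma mult_matrix_commute: "mm g ** mm h = mm h ** mm g"
proof (rule matrix_eqI_axis)
  fix j
  show "mm g ** mm h *v axis j 1 = mm h ** mm g *v axis j 1"
    by (simp add: mult_matrix_coeff_vec mult.left_commute flip: coeff_vec_basis matrix_vector_mul_assoc)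
qed

lemma mat_poly_mult_x: "mat_poly mult_x p *v cc g = cc ([:p:] * g)"
proof (induction p)
  case 0
  then show ?case using coeff_vec_eq_0_iff chart_ideal_0 by simp
next
  case (pCons a p)
  have "[:pCons a p:] * g = smult [:a:] g + [:[:0, 1:]:] * ([:p:] * g)"
    by (simp add: smult_add_left[symmetric])
  then show ?case
    by (simp only: mat_poly_pCons matrix_vector_mult_add_rdistrib matrix_vector_mul_assoc[symmetric]
        matrix_vector_scale coeff_vec_add coeff_vec_smult mult_matrix_coeff_vec pCons.IH)
qed

lemma mat_poly2_mult_coeff_vec: "mat_poly2 mult_x mult_y f *v cc g = cc (f * g)"
proof (induction f)
  case 0
  then show ?case using coeff_vec_eq_0_iff chart_ideal_0 by simp
next
  case (pCons p f)
  have "pCons p f * g = [:p:] * g + [:0, 1:] * (f * g)" by simp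
  then show ?case
    by (simp only: mat_poly2_pCons matrix_vector_mult_add_rdistrib matrix_vector_mul_assoc[symmetric]
        mat_poly_mult_x coeff_vec_add mult_matrix_coeff_vec pCons.IH)
qed

lemma mat_poly2_mult_1: "mat_poly2 mult_x mult_y f *v cc 1 = cc f"
  using mat_poly2_mult_coeff_vec[of f 1] by simp

end

text \<open>With \<open>b (idx first) = 1\<close> the class of \<open>1\<close> has coordinates
  \<open>e1\<close>, and this is a section of \<open>ideal_of\<close> over the chart; its image is
  the slice of the zero level where the frame matrix is the identity.\<close>

definition chart_section :: "(nat \<Rightarrow> complex poly poly) \<Rightarrow> complex poly poly set \<Rightarrow> 'n::{finite,linorder} mat_pair" where
  "chart_section b I = (mult_matrix I b [:[:0, 1:]:], mult_matrix I b [:0, 1:])"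

definition ideal_of :: "'n::{finite,linorder} mat_pair \<Rightarrow> complex poly poly set" where
  "ideal_of p = {f. mat_poly2 (fst p) (snd p) f *v e1 = 0}"

abbreviation (input) nat_frame :: "(nat \<Rightarrow> complex poly poly) \<Rightarrow> 'n::{finite,linorder} mat_pair \<Rightarrow> 'n cmat" where
  "nat_frame b \<equiv> frame_matrix (\<lambda>i. b (idx i))"

lemma coeff_vec_1:
  assumes "I \<in> hilb_chart CARD('n::{finite,linorder}) b" "b (idx (first :: 'n)) = 1"
  shows "coeff_vec b 1 I = (e1 :: (complex, 'n) vec)"
  using coeff_vec_basis[OF assms(1), of first] assms(2) by (simp add: e1_def)

lemma
  assumes I: "I \<in> hilb_chart CARD('n::{finite,linorder}) b" and b: "b (idx (first :: 'n)) = 1"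
  shows chart_section_mem: "(chart_section b I :: 'n mat_pair) \<in> zero_level"
    and ideal_of_chart_section: "ideal_of (chart_section b I :: 'n mat_pair) = I"
    and frame_matrix_chart_section: "nat_frame b (chart_section b I :: 'n mat_pair) = mat 1"
proof -
  have f: "mat_poly2 (fst (chart_section b I)) (snd (chart_section b I)) f *v e1 = (coeff_vec b f I :: (complex, 'n) vec)" for f
    using mat_poly2_mult_1[OF I, of f] by (simp add: coeff_vec_1[OF I b] chart_section_def)
  then show "ideal_of (chart_section b I :: 'n mat_pair) = I"
    unfolding ideal_of_def using coeff_vec_eq_0_iff[OF I] by auto
  show "nat_frame b (chart_section b I :: 'n mat_pair) = mat 1"
    by (rule matrix_eqI_axis) (simp add: frame_matrix_axis f coeff_vec_basis[OF I])
  have "cyclic_vector (e1 :: (complex, 'n) vec) (fst (chart_section b I)) (snd (chart_section b I))"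
  proof (rule cyclic_vector_if_mat_poly2_surj)
    fix w :: "(complex, 'n) vec"
    show "\<exists>f. mat_poly2 (fst (chart_section b I)) (snd (chart_section b I)) f *v e1 = w"
      using f[of "poly_comb b w"] coeff_vec_poly_comb[OF I, of w] by auto
  qed
  then show "(chart_section b I :: 'n mat_pair) \<in> zero_level"
    unfolding chart_section_def zero_level_iff using mult_matrix_commute[OF I] by simp
qed

section \<open>Ideals attached to commuting cyclic pairs\<close>

lemma poly_ideal_ideal_of:
  assumes "p \<in> zero_level"
  shows "poly_ideal (ideal_of p)"
proof -
  have AB: "fst p ** snd p = snd p ** fst p" using assms zero_level_iff[of "fst p" "snd p"] by simp
  show ?thesis
    by (auto simp: poly_ideal_def ideal_of_def mat_poly2_add matrix_vector_mult_add_rdistrib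
        mat_poly2_mult[OF AB] simp flip: matrix_vector_mul_assoc)
qed

lemma mat_poly2_poly_comb:
  fixes p :: "'n::{finite,linorder} mat_pair"
  shows "mat_poly2 (fst p) (snd p) (poly_comb b v) *v e1 = nat_frame b p *v v"
proof -
  have s: "sum M K *v w = (\<Sum>k\<in>K. M k *v w)" for M :: "'n \<Rightarrow> 'n cmat" and K and w :: "(complex, 'n) vec"
    by (induction K rule: infinite_finite_induct) (simp_all add: matrix_vector_mult_add_rdistrib)
  show ?thesis
    unfolding poly_comb_def mat_poly2_sum s mat_poly2_smult_const
    by (simp add: matrix_vector_scale frame_matrix_def vec_eq_iff matrix_vector_mult_def[of "\<chi> i j. _ i j"]
        mult.commute flip: matrix_vector_mul_assoc)
qed

lemma diff_poly_comb_mem_ideal_of_iff: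
  "f - poly_comb b v \<in> ideal_of p \<longleftrightarrow>
    mat_poly2 (fst p) (snd p) f *v e1 = nat_frame b p *v v"
  by (simp add: ideal_of_def mat_poly2_diff matrix_vector_mult_diff_rdistrib mat_poly2_poly_comb)

text \<open>By cyclicity, evaluation at \<open>e1\<close> identifies the quotient by
  \<open>ideal_of p\<close> with the space of vectors, and the classes of the \<open>b k\<close>
  with the columns of the frame matrix.\<close>

lemma ideal_of_mem_hilb_chart_iff:
  fixes p :: "'n::{finite,linorder} mat_pair"
  assumes p: "p \<in> zero_level"
  shows "ideal_of p \<in> hilb_chart CARD('n) b \<longleftrightarrow> invertible (nat_frame b p)"
    (is "_ \<longleftrightarrow> invertible ?M")
proof -
  have surj: "\<exists>f. mat_poly2 (fst p) (snd p) f *v e1 = w" for w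
    using p zero_level_iff[of "fst p" "snd p"] cyclic_vector_mat_poly2_surj by auto
  have "ideal_of p \<in> hilb_chart CARD('n) b \<longleftrightarrow> (\<forall>w. \<exists>!v. w = ?M *v v)"
  proof -
    have "(\<forall>f. \<exists>!v. mat_poly2 (fst p) (snd p) f *v e1 = ?M *v v) \<longleftrightarrow> (\<forall>w. \<exists>!v. w = ?M *v v)"
    proof (intro iffI allI)
      fix w assume *: "\<forall>f. \<exists>!v. mat_poly2 (fst p) (snd p) f *v e1 = ?M *v v"
      obtain f where "mat_poly2 (fst p) (snd p) f *v e1 = w" using surj[of w] by blast
      then show "\<exists>!v. w = ?M *v v" using *[rule_format, of f] by simp
    qed blast
    then show ?thesis
      by (simp add: hilb_chart_def quotient_basis_iff[where 'n = 'n] diff_poly_comb_mem_ideal_of_iff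
          poly_ideal_ideal_of[OF p])
  qed
  also have "\<dots> \<longleftrightarrow> invertible ?M"
  proof
    assume "\<forall>w. \<exists>!v. w = ?M *v v"
    then have "surj ((*v) ?M)" unfolding surj_def by blast
    then show "invertible ?M"
      by (simp add: invertible_right_inverse matrix_right_invertible_surjective)
  next
    assume i: "invertible ?M"
    show "\<forall>w. \<exists>!v. w = ?M *v v"
    proof
      fix w
      show "\<exists>!v. w = ?M *v v"
        by (rule ex1I[of _ "matrix_inv ?M *v w"])
          (auto simp: matrix_vector_mul_assoc matrix_inv_right[OF i])
    qed
  qed
  finally show ?thesis .
qed

lemma frame_matrix_coeff_vec:
  fixes p :: "'n::{finite,linorder} mat_pair"
  assumes "ideal_of p \<in> hilb_chart CARD('n) b"
  shows "nat_frame b p *v coeff_vec b f (ideal_of p) = mat_poly2 (fst p) (snd p) f *v e1"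
  using diff_coeff_vec_mem[OF assms, of f] unfolding diff_poly_comb_mem_ideal_of_iff by simp

lemma coeff_vec_ideal_of:
  fixes p :: "'n::{finite,linorder} mat_pair"
  assumes p: "p \<in> zero_level" and I: "ideal_of p \<in> hilb_chart CARD('n) b"
  shows "coeff_vec b f (ideal_of p) =
    matrix_inv (nat_frame b p) *v (mat_poly2 (fst p) (snd p) f *v e1)"
  using frame_matrix_coeff_vec[OF I, of f] I[unfolded ideal_of_mem_hilb_chart_iff[OF p]]
  by (metis matrix_inv_right(2) matrix_vector_mul_assoc matrix_vector_mul_lid)

lemma chart_of_frame:
  fixes p :: "'n::{finite,linorder} mat_pair"
  assumes p: "p \<in> zero_level"
  obtains b where "ideal_of p \<in> hilb_chart CARD('n) b" "b (idx (first :: 'n)) = 1"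
    "nat_frame b p = mat 1"
proof -
  obtain c where c: "c first = 1" "frame_matrix c p = mat 1" using frame_exists[OF p] by blast
  define b where "b = (\<lambda>k. c (inv_into (UNIV :: 'n set) idx k))"
  have "b (idx i) = c i" for i :: 'n
    using inv_into_f_f[OF bij_betw_imp_inj_on[OF bij_betw_idx[where 'n = 'n]]] by (simp add: b_def)
  then have "(\<lambda>i :: 'n. b (idx i)) = c" by auto
  moreover have "invertible (mat 1 :: 'n cmat)" by (auto simp: invertible_def intro: exI[of _ "mat 1"])
  ultimately show ?thesis
    using c ideal_of_mem_hilb_chart_iff[OF p, of b] by (intro that[of b]) (auto dest: fun_cong)
qed

text \<open>The frame matrix of \<open>p\<close> is itself the group element that carries the
  section to \<open>p\<close>: it intertwines multiplication by \<open>h\<close>, written in the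
  basis \<open>b\<close>, with \<open>h(A, B)\<close>. This trivializes the zero level over the
  chart.\<close>

lemma chart_section_action:
  fixes p :: "'n::{finite,linorder} mat_pair"
  assumes p: "p \<in> zero_level" and I: "ideal_of p \<in> hilb_chart CARD('n) b" and b: "b (idx (first :: 'n)) = 1"
  shows "nat_frame b p \<in> carrier stab_group"
    and "zl_action (nat_frame b p) (chart_section b (ideal_of p)) = p"
proof -
  let ?M = "nat_frame b p"
  have i: "invertible ?M" using I ideal_of_mem_hilb_chart_iff[OF p] by blast
  have "?M *v e1 = e1"
    using frame_matrix_coeff_vec[OF I, of 1] by (simp add: coeff_vec_1[OF I b])
  then show g: "?M \<in> carrier stab_group" using i by (simp add: carrier_stab_group)
  have AB: "fst p ** snd p = snd p ** fst p" using p zero_level_iff[of "fst p" "snd p"] by simp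
  have int: "?M ** mult_matrix (ideal_of p) b h = mat_poly2 (fst p) (snd p) h ** ?M" for h
  proof (rule matrix_eqI_axis)
    fix j
    have "?M ** mult_matrix (ideal_of p) b h *v axis j 1 = ?M *v coeff_vec b (h * b (idx j)) (ideal_of p)"
      using mult_matrix_coeff_vec[OF I, of h "b (idx j)"]
      by (simp add: coeff_vec_basis[OF I] flip: matrix_vector_mul_assoc)
    also have "\<dots> = mat_poly2 (fst p) (snd p) h ** ?M *v axis j 1"
      by (simp add: frame_matrix_coeff_vec[OF I] frame_matrix_axis mat_poly2_mult[OF AB]
          flip: matrix_vector_mul_assoc)
    finally show "?M ** mult_matrix (ideal_of p) b h *v axis j 1 = mat_poly2 (fst p) (snd p) h ** ?M *v axis j 1" .
  qed
  have "(mult_matrix (ideal_of p) b [:[:0, 1:]:], mult_matrix (ideal_of p) b [:0, 1:]) \<in> (zero_level :: 'n mat_pair set)"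
    using chart_section_mem[OF I b] by (simp add: chart_section_def)
  from conj_action_eq_iff[OF this i, of "fst p" "snd p"]
  show "zl_action ?M (chart_section b (ideal_of p)) = p"
    using int[of "[:[:0, 1:]:]"] int[of "[:0, 1:]"] by (simp add: chart_section_def mat_poly2_x mat_poly2_y)
qed

lemma chart_section_ideal_of:
  fixes p :: "'n::{finite,linorder} mat_pair"
  assumes p: "p \<in> zero_level" and b: "b (idx (first :: 'n)) = 1" and M: "nat_frame b p = mat 1"
  shows "ideal_of p \<in> hilb_chart CARD('n) b" "chart_section b (ideal_of p) = p"
proof -
  show I: "ideal_of p \<in> hilb_chart CARD('n) b"
    unfolding ideal_of_mem_hilb_chart_iff[OF p] M by (auto simp: invertible_def intro: exI[of _ "mat 1"])
  show "chart_section b (ideal_of p) = p"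
    using chart_section_action(2)[OF p I b] zl_action_one[OF chart_section_mem[OF I b]] by (simp add: M)
qed

lemma ideal_of_zl_action:
  assumes "g \<in> carrier stab_group" "p \<in> zero_level"
  shows "ideal_of (zl_action g p) = ideal_of p"
proof -
  obtain A B A' B' where p: "p = (A, B)" "zl_action g (A, B) = (A', B')" by fastforce
  have g: "invertible g" "g *v e1 = e1" using assms(1) by (auto simp: carrier_stab_group)
  have i: "g ** A = A' ** g" "g ** B = B' ** g"
    using p assms(2) g conj_action_eq_iff[of A B zero_level g A' B'] by auto
  have "mat_poly2 A' B' f *v e1 = g *v (mat_poly2 A B f *v e1)" for f
  proof -
    have "mat_poly2 A' B' f *v e1 = mat_poly2 A' B' f ** g *v e1"
      by (simp add: g flip: matrix_vector_mul_assoc)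
    then show ?thesis by (simp add: mat_poly2_intertwine[OF i, symmetric] matrix_vector_mul_assoc)
  qed
  moreover have "g *v v = 0 \<longleftrightarrow> v = 0" for v
    using matrix_inv_right(2)[OF g(1)]
    by (metis matrix_vector_mul_assoc matrix_vector_mul_lid matrix_vector_mult_0_right)
  ultimately show ?thesis using p by (simp add: ideal_of_def)
qed

text \<open>For a frame that is the identity at \<open>p\<close>, the point \<open>p\<close> is the
  section value at the common ideal, and \<open>q\<close> is a translate of that value.\<close>

lemma ideal_of_eq_iff:
  fixes p q :: "'n::{finite,linorder} mat_pair"
  assumes p: "p \<in> zero_level" and q: "q \<in> zero_level"
  shows "ideal_of p = ideal_of q \<longleftrightarrow> (\<exists>g\<in>carrier stab_group. zl_action g p = q)"
proof
  assume eq: "ideal_of p = ideal_of q"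
  obtain b where b: "ideal_of p \<in> hilb_chart CARD('n) b" "b (idx (first :: 'n)) = 1"
    "nat_frame b p = mat 1"
    using chart_of_frame[OF p] by blast
  have "chart_section b (ideal_of q) = p"
    using chart_section_ideal_of(2)[OF p b(2,3)] eq by simp
  then show "\<exists>g\<in>carrier stab_group. zl_action g p = q"
    using chart_section_action[OF q, of b] b eq by auto
qed (use ideal_of_zl_action[OF _ p] in auto)

text \<open>The first column is \<open>v\<close>; the other columns are the standard vectors except
  the one at a position \<open>k\<close> with \<open>v $ k \<noteq> 0\<close>, arranged by the
  transposition \<open>t\<close> of \<open>first\<close> and \<open>k\<close>.\<close>

lemma invertible_first_column:
  fixes v :: "complex^'n::{finite,linorder}"
  assumes "v \<noteq> 0"
  obtains h :: "'n cmat" where "invertible h" "h *v e1 = v"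
proof -
  obtain k where k: "v $ k \<noteq> 0" using assms by (auto simp: vec_eq_iff)
  define t where "t = (\<lambda>j. if j = k then first else if j = first then k else j)"
  have t: "t j = k \<longleftrightarrow> j = first" "t (t j) = j" for j by (auto simp: t_def)
  define h :: "'n cmat" where "h = (\<chi> i j. if j = first then v $ i else if i = t j then 1 else 0)"
  have "x = 0" if x: "h *v x = 0" for x
  proof -
    have e: "(\<Sum>j\<in>UNIV. h $ i $ j * x $ j) = 0" for i
      using x by (simp add: vec_eq_iff matrix_vector_mult_def)
    \<comment> \<open>Row \<open>k\<close> meets only the first column, since \<open>t j = k\<close>
      forces \<open>j = first\<close>.\<close>
    have "h $ k $ j = (if j = first then v $ k else 0)" for j
      using t(1)[of j] by (auto simp: h_def)
    then have "(\<Sum>j\<in>UNIV. h $ k $ j * x $ j) = v $ k * x $ first"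
      by (simp add: if_distrib[of "\<lambda>c. c * _"] cong: if_cong)
    then have f: "x $ first = 0" using e[of k] k by simp
    have "x $ i = 0" for i
    proof (cases "i = first")
      case False
      have "(\<Sum>j\<in>UNIV. h $ t i $ j * x $ j) = (\<Sum>j\<in>UNIV. if j = i then x $ i else 0)"
        by (rule sum.cong) (use False f in \<open>auto simp: h_def, metis t(2)\<close>)
      then show ?thesis using e[of "t i"] by simp
    qed (use f in simp)
    then show ?thesis by (simp add: vec_eq_iff)
  qed
  then have "invertible h"
    unfolding invertible_left_inverse matrix_left_invertible_ker by blast
  moreover have "h *v e1 = v" by (simp add: vec_eq_iff e1_def h_def)
  ultimately show ?thesis by (rule that)
qed

text \<open>A basis need not contain \<open>1\<close>, so the class of \<open>1\<close> is merely
  some nonzero vector; conjugation by a matrix that sends \<open>e1\<close> to it gives a pair in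
  the zero level.\<close>

lemma ideal_of_surj:
  assumes "I \<in> hilb_points CARD('n)"
  obtains p :: "'n::{finite,linorder} mat_pair" where "p \<in> zero_level" "ideal_of p = I"
proof -
  obtain b where I: "I \<in> hilb_chart CARD('n) b"
    using assms by (auto simp: hilb_points_def hilb_chart_def)
  let ?X = "mult_matrix I b [:[:0, 1:]:] :: 'n cmat" and ?Y = "mult_matrix I b [:0, 1:] :: 'n cmat"
  let ?v = "coeff_vec b 1 I :: (complex, 'n) vec"
  have cc: "mat_poly2 ?X ?Y f *v ?v = coeff_vec b f I" for f
    by (rule mat_poly2_mult_1[OF I])
  \<comment> \<open>If it were zero, every coefficient vector, being a matrix applied to
    \<open>?v\<close>, would be zero, also those of the basis elements.\<close>
  have "?v \<noteq> 0"
  proof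
    assume "?v = 0"
    then have "coeff_vec b (b (idx (first :: 'n))) I = (0 :: (complex, 'n) vec)" using cc by (metis matrix_vector_mult_0_right)
    then show False by (simp add: coeff_vec_basis[OF I])
  qed
  then obtain h :: "'n cmat" where h: "invertible h" "h *v e1 = ?v"
    using invertible_first_column by blast
  define A B where "A = matrix_inv h ** ?X ** h" and "B = matrix_inv h ** ?Y ** h"
  have hA: "h ** A = ?X ** h" and hB: "h ** B = ?Y ** h"
    by (simp_all add: A_def B_def matrix_mul_assoc matrix_inv_right[OF h(1)])
  have inj: "h *v v = h *v w \<longleftrightarrow> v = w" for v w
    by (metis h(1) matrix_inv_right(2) matrix_vector_mul_assoc matrix_vector_mul_lid)
  have e: "h *v (mat_poly2 A B f *v e1) = coeff_vec b f I" for f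
    unfolding matrix_vector_mul_assoc mat_poly2_intertwine[OF hA hB]
    using cc[of f] h(2) by (simp flip: matrix_vector_mul_assoc)
  have "A ** B = B ** A"
  proof (rule matrix_eqI_axis)
    fix j
    have "h ** (A ** B) = ?X ** ?Y ** h" "h ** (B ** A) = ?Y ** ?X ** h"
      by (metis hA hB matrix_mul_assoc)+
    then have "h *v (A ** B *v axis j 1) = h *v (B ** A *v axis j 1)"
      using mult_matrix_commute[OF I] by (metis matrix_vector_mul_assoc)
    then show "A ** B *v axis j 1 = B ** A *v axis j 1" using inj by blast
  qed
  moreover have "cyclic_vector e1 A B"
  proof (rule cyclic_vector_if_mat_poly2_surj)
    fix w
    have "h *v (mat_poly2 A B (poly_comb b (h *v w)) *v e1) = h *v w"
      by (simp add: e coeff_vec_poly_comb[OF I])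
    then show "\<exists>f. mat_poly2 A B f *v e1 = w" using inj by blast
  qed
  ultimately have "(A, B) \<in> zero_level" by (simp add: zero_level_iff)
  moreover have "mat_poly2 A B f *v e1 = 0 \<longleftrightarrow> f \<in> I" for f
    using e[of f] inj[of "mat_poly2 A B f *v e1" 0] coeff_vec_eq_0_iff[OF I, of f] by simp
  then have "ideal_of (A, B) = I" by (simp add: ideal_of_def)
  ultimately show ?thesis by (rule that)
qed

lemma ideal_of_mem:
  fixes p :: "'n::{finite,linorder} mat_pair"
  assumes "p \<in> zero_level"
  shows "ideal_of p \<in> hilb_points CARD('n)"
  using chart_of_frame[OF assms] by (metis (mono_tags, lifting) hilb_chart_def hilb_points_def mem_Collect_eq)

section \<open>The Hilbert scheme as a quotient of the zero level\<close>

lemma holomorphic_near_projection: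
  assumes "finite J" "j \<in> J" "z \<in> extensional J"
  shows "holomorphic_near J (\<lambda>w. w j) z"
proof -
  have "complex_differentiable_at J (\<lambda>w. w j) z" if "z \<in> extensional J" for z
    unfolding complex_differentiable_at_iff[OF assms(1) that]
  proof (intro exI[of _ "\<lambda>i. if i = j then 1 else 0"] allI impI exI[of _ "1 :: real"] conjI ballI)
    fix e :: real and w assume "e > 0"
    have "(\<Sum>i\<in>J. (if i = j then 1 else 0) * (w i - z i)) = w j - z j"
      using assms by (simp add: if_distrib[of "\<lambda>c. c * _"] cong: if_cong)
    then show "cmod (w j - z j - (\<Sum>i\<in>J. (if i = j then 1 else 0) * (w i - z i))) \<le>
        e * (\<Sum>i\<in>J. cmod (w i - z i))"
      using \<open>e > 0\<close> by (simp add: sum_nonneg)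
  qed simp
  then show ?thesis
    unfolding holomorphic_near_iff[OF assms(1)] using assms(3)
    by (auto intro!: exI[of _ "1 :: real"] simp: cbox_near_def)
qed

text \<open>Cramer's rule for the linear system given by the frame matrix. The common denominator is
  its determinant, which vanishes exactly off the chart.\<close>

lemma basis_coeff_rational:
  fixes b :: "nat \<Rightarrow> complex poly poly"
  obtains N and D :: "'n::{finite,linorder} mat_pair \<Rightarrow> complex"
  where "\<And>j. entry_polynomial (N j)" "entry_polynomial D"
    "\<And>p. p \<in> zero_level \<Longrightarrow> ideal_of p \<in> hilb_chart CARD('n) b \<longleftrightarrow> D p \<noteq> 0"
    "\<And>j p. p \<in> zero_level \<Longrightarrow> ideal_of p \<in> hilb_chart CARD('n) b \<Longrightarrow>
       basis_coeff CARD('n) b j (ideal_of p) = N j p / D p"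
proof -
  define D :: "'n mat_pair \<Rightarrow> complex" where "D = (\<lambda>p. det (nat_frame b p))"
  have D: "entry_polynomial D"
    unfolding D_def by (intro entry_polynomial_det entry_polynomial_frame_matrix)
  have D0: "ideal_of p \<in> hilb_chart CARD('n) b \<longleftrightarrow> D p \<noteq> 0" if "p \<in> zero_level" for p
    using ideal_of_mem_hilb_chart_iff[OF that] invertible_det_nz unfolding D_def by blast
  have "\<exists>N. entry_polynomial N \<and> (\<forall>p. p \<in> zero_level \<longrightarrow> ideal_of p \<in> hilb_chart CARD('n) b \<longrightarrow>
      basis_coeff CARD('n) b j (ideal_of p) = N p / D p)" for j
  proof -
    obtain f k where j: "j = (f, k)" by fastforce
    show ?thesis
    proof (cases "k < CARD('n)")
      case True
      then obtain i :: 'n where i: "idx i = k" by (rule idx_surj)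
      define N :: "'n mat_pair \<Rightarrow> complex" where
        "N p = det (\<chi> r c. if c = i then (mat_poly2 (fst p) (snd p) f *v e1) $ r else nat_frame b p $ r $ c)" for p
      have v: "entry_polynomial (\<lambda>p :: 'n mat_pair. (mat_poly2 (fst p) (snd p) f *v e1) $ r)" for r
        unfolding matrix_vector_mult_def vec_lambda_beta
        by (intro entry_polynomial_sum entry_polynomial.mult entry_polynomial_mat_poly2 entry_polynomial.const)
      have "entry_polynomial (\<lambda>p. if c = i then (mat_poly2 (fst p) (snd p) f *v e1) $ r
          else nat_frame b p $ r $ c)" for r c
        using v by (cases "c = i") (auto intro: entry_polynomial_frame_matrix)
      then have "entry_polynomial N" unfolding N_def by (intro entry_polynomial_det) simp
      moreover have "basis_coeff CARD('n) b j (ideal_of p) = N p / D p"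
        if p: "p \<in> zero_level" and I: "ideal_of p \<in> hilb_chart CARD('n) b" for p
      proof -
        have inv: "invertible (nat_frame b p)" using I ideal_of_mem_hilb_chart_iff[OF p] by blast
        have "basis_coeff CARD('n) b j (ideal_of p) = coeff_vec b f (ideal_of p) $ i"
          by (simp add: coeff_vec_def i j)
        then show ?thesis
          unfolding coeff_vec_ideal_of[OF p I] matrix_inv_mult_cramer[OF inv] by (simp add: N_def D_def)
      qed
      ultimately show ?thesis by blast
    next
      case False
      show ?thesis
      \<comment> \<open>This coordinate is constant; the numerator \<open>undefined * D\<close> lets
        it share the denominator \<open>D\<close>.\<close>
      proof (intro exI[of _ "\<lambda>p. undefined * D p"] conjI allI impI)
        fix p :: "'n mat_pair"
        assume p: "p \<in> zero_level" and I: "ideal_of p \<in> hilb_chart CARD('n) b"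
        then show "basis_coeff CARD('n) b j (ideal_of p) = undefined * D p / D p"
          using basis_coeff_out_of_range[OF chart_quotient_basis[OF I] False] D0[OF p] by (simp add: j)
      qed (intro entry_polynomial.mult entry_polynomial.const D)
    qed
  qed
  then obtain N where "\<And>j. entry_polynomial (N j)"
    "\<And>j p. p \<in> zero_level \<Longrightarrow> ideal_of p \<in> hilb_chart CARD('n) b \<Longrightarrow>
      basis_coeff CARD('n) b j (ideal_of p) = N j p / D p"
    by metis
  then show ?thesis using D D0 by (intro that)
qed

section \<open>The topology of the Hilbert scheme\<close>

lemma topspace_hilb_top: "topspace (hilb_top n) = hilb_points n"
proof -
  let ?S = "{{I \<in> hilb_chart n b. \<forall>k<n. basis_coeff n b (f, k) I \<in> W k} | b f W. \<forall>k. open (W k)}"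
  have "hilb_chart n b \<in> ?S" for b
    by (intro CollectI exI[of _ b] exI[of _ 0] exI[of _ "\<lambda>_. UNIV"]) auto
  then have "(\<Union>b. hilb_chart n b) \<subseteq> \<Union>?S" by (intro UN_least Union_upper)
  moreover have "\<Union>?S \<subseteq> (\<Union>b. hilb_chart n b)" by (rule Union_least) blast
  moreover have "hilb_points n = (\<Union>b. hilb_chart n b)"
    by (auto simp: hilb_points_def hilb_chart_def)
  ultimately show ?thesis
    unfolding hilb_top_def topology_generated_by_topspace by simp
qed

lemma openin_hilb_topI:
  assumes "\<And>k. open (W k)"
  shows "openin (hilb_top n) {I \<in> hilb_chart n b. \<forall>k<n. basis_coeff n b (f, k) I \<in> W k}"
  unfolding hilb_top_def using assms by (intro topology_generated_by_Basis) blast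

abbreviation (input) chart_top :: "nat \<Rightarrow> (nat \<Rightarrow> complex poly poly) \<Rightarrow> complex poly poly set topology" where
  "chart_top n b \<equiv> subtopology (hilb_top n) (hilb_chart n b)"

lemma openin_hilb_chart: "openin (hilb_top n) (hilb_chart n b)"
  using openin_hilb_topI[of "\<lambda>_. UNIV" n b] by simp

lemma continuous_map_pair:
  assumes "\<And>m. continuous_map X euclidean (\<lambda>x. entry m (f x))"
  shows "continuous_map X euclidean (f :: _ \<Rightarrow> 'n::finite mat_pair)"
proof -
  have "continuous_map X euclidean (\<lambda>x m. entry m (f x))"
    using assms unfolding euclidean_product_topology[symmetric] continuous_map_componentwise_UNIV by blast
  moreover have "continuous_map euclidean euclidean (pair_of :: _ \<Rightarrow> 'n mat_pair)"
    by (simp add: continuous_on_pair_iff)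
  ultimately have "continuous_map X euclidean (pair_of \<circ> (\<lambda>x m. entry m (f x)))"
    by (rule continuous_map_compose)
  then show ?thesis by (simp add: comp_def)
qed

lemma continuous_map_basis_coeff:
  assumes "k < n"
  shows "continuous_map (chart_top n b) euclidean (basis_coeff n b (f, k))"
  unfolding continuous_map_def
proof (intro conjI allI impI)
  fix U :: "complex set" assume "openin euclidean U"
  then have "openin (hilb_top n) {I \<in> hilb_chart n b. \<forall>l<n. basis_coeff n b (f, l) I \<in> (if l = k then U else UNIV)}"
    by (intro openin_hilb_topI) auto
  moreover have "{I \<in> topspace (chart_top n b). basis_coeff n b (f, k) I \<in> U} =
      {I \<in> hilb_chart n b. \<forall>l<n. basis_coeff n b (f, l) I \<in> (if l = k then U else UNIV)}"
    using assms openin_subset[OF openin_hilb_chart[of n b]] by auto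
  ultimately show "openin (chart_top n b)
      {I \<in> topspace (chart_top n b). basis_coeff n b (f, k) I \<in> U}"
    by (auto simp: openin_open_subtopology[OF openin_hilb_chart])
qed auto

lemma entry_chart_section:
  "entry (s, i, j) (chart_section b I :: 'n::{finite,linorder} mat_pair) =
    basis_coeff CARD('n) b ((if s then [:0, 1:] else [:[:0, 1:]:]) * b (idx j), idx i) I"
  by (cases s) (simp_all only: entry_def chart_section_def mult_matrix_def coeff_vec_def
      if_True if_False case_prod_conv vec_lambda_beta)

lemma topspace_subtopology_hilb_chart:
  "topspace (chart_top n b) = hilb_chart n b"
  using openin_subset[OF openin_hilb_chart[of n b]] by auto

lemma continuous_map_chart_section:
  assumes "b (idx (first :: 'n::{finite,linorder})) = 1"
  shows "continuous_map (chart_top CARD('n) b)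
    (top_of_set zero_level) (chart_section b :: _ \<Rightarrow> 'n mat_pair)"
  unfolding continuous_map_in_subtopology
proof
  show "continuous_map (chart_top CARD('n) b) euclidean
      (chart_section b :: _ \<Rightarrow> 'n mat_pair)"
  proof (rule continuous_map_pair)
    fix m :: "bool \<times> 'n \<times> 'n"
    obtain s i j where m: "m = (s, i, j)" by (cases m)
    show "continuous_map (chart_top CARD('n) b) euclidean
        (\<lambda>x. entry m (chart_section b x))"
      unfolding m entry_chart_section by (rule continuous_map_basis_coeff) simp
  qed
  show "chart_section b \<in> topspace (chart_top CARD('n) b) \<rightarrow> (zero_level :: 'n mat_pair set)"
    unfolding topspace_subtopology_hilb_chart using chart_section_mem assms by auto
qed

text \<open>Preimages of the generating open sets are described by rational functions on the open
  set where the determinant of the frame is nonzero.\<close>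

lemma continuous_map_ideal_of:
  "continuous_map (top_of_set zero_level) (hilb_top CARD('n)) (ideal_of :: 'n::{finite,linorder} mat_pair \<Rightarrow> _)"
  unfolding hilb_top_def
proof (rule continuous_on_generated_topo)
  fix U
  assume "U \<in> {{I \<in> hilb_chart CARD('n) b. \<forall>k<CARD('n). basis_coeff CARD('n) b (f, k) I \<in> W k} | b f W. \<forall>k. open (W k)}"
  then obtain b f W where U: "U = {I \<in> hilb_chart CARD('n) b. \<forall>k<CARD('n). basis_coeff CARD('n) b (f, k) I \<in> W k}"
    and W: "\<And>k. open (W k)" by blast
  obtain N and D :: "'n mat_pair \<Rightarrow> complex" where N: "\<And>j. entry_polynomial (N j)" and Dp: "entry_polynomial D"
    and D: "\<And>p. p \<in> zero_level \<Longrightarrow> ideal_of p \<in> hilb_chart CARD('n) b \<longleftrightarrow> D p \<noteq> 0"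
    and eq: "\<And>j p. p \<in> zero_level \<Longrightarrow> ideal_of p \<in> hilb_chart CARD('n) b \<Longrightarrow>
      basis_coeff CARD('n) b j (ideal_of p) = N j p / D p"
    using basis_coeff_rational[of b] by metis
  have Dc: "continuous_on S D" for S using Dp by (rule entry_polynomial_continuous_on)
  have Do: "open {p. D p \<noteq> 0}"
    using open_Collect_neq[OF Dc continuous_on_const] .
  define T where "T = {p. D p \<noteq> 0} \<inter> (\<Inter>k\<in>{..<CARD('n)}. {p. D p \<noteq> 0} \<inter> (\<lambda>p. N (f, k) p / D p) -` W k)"
  have "open ({p. D p \<noteq> 0} \<inter> (\<lambda>p. N (f, k) p / D p) -` W k)" for k
    using N by (intro continuous_open_preimage Do W continuous_on_divide Dc entry_polynomial_continuous_on) auto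
  then have "open T" unfolding T_def by (intro open_Int Do open_INT) auto
  moreover have "ideal_of -` U \<inter> topspace (top_of_set zero_level) = zero_level \<inter> T"
    unfolding U T_def by (auto simp: D eq)
  ultimately show "openin (top_of_set zero_level) ((ideal_of :: 'n mat_pair \<Rightarrow> _) -` U \<inter> topspace (top_of_set zero_level))"
    by auto
next
  show "ideal_of ` topspace (top_of_set (zero_level :: 'n mat_pair set)) \<subseteq>
      \<Union>{{I \<in> hilb_chart CARD('n) b. \<forall>k<CARD('n). basis_coeff CARD('n) b (f, k) I \<in> W k} | b f W. \<forall>k. open (W k)}"
    using ideal_of_mem topspace_hilb_top[of "CARD('n)"]
    unfolding hilb_top_def topology_generated_by_topspace by auto
qed

text \<open>Each point lies in a chart with a continuous section of \<open>ideal_of\<close>; pulling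
  the open preimage of \<open>U\<close> back along it gives a neighbourhood inside
  \<open>U\<close>.\<close>

lemma quotient_map_ideal_of:
  "quotient_map (top_of_set zero_level) (hilb_top CARD('n)) (ideal_of :: 'n::{finite,linorder} mat_pair \<Rightarrow> _)"
  unfolding quotient_map_def
proof (intro conjI allI impI)
  show "ideal_of ` topspace (top_of_set (zero_level :: 'n mat_pair set)) = topspace (hilb_top CARD('n))"
  proof
    show "ideal_of ` topspace (top_of_set (zero_level :: 'n mat_pair set)) \<subseteq> topspace (hilb_top CARD('n))"
      unfolding topspace_hilb_top using ideal_of_mem by auto
    show "topspace (hilb_top CARD('n)) \<subseteq> ideal_of ` topspace (top_of_set (zero_level :: 'n mat_pair set))"
    proof
      fix I assume "I \<in> topspace (hilb_top CARD('n))"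
      then obtain p :: "'n mat_pair" where "p \<in> zero_level" "ideal_of p = I"
        unfolding topspace_hilb_top by (rule ideal_of_surj)
      then show "I \<in> ideal_of ` topspace (top_of_set (zero_level :: 'n mat_pair set))" by auto
    qed
  qed
  fix U assume U: "U \<subseteq> topspace (hilb_top CARD('n))"
  show "openin (top_of_set zero_level) {p \<in> topspace (top_of_set (zero_level :: 'n mat_pair set)). ideal_of p \<in> U} =
      openin (hilb_top CARD('n)) U"
  proof
    assume "openin (hilb_top CARD('n)) U"
    then show "openin (top_of_set zero_level) {p \<in> topspace (top_of_set (zero_level :: 'n mat_pair set)). ideal_of p \<in> U}"
      using continuous_map_ideal_of openin_continuous_map_preimage by blast
  next
    assume o: "openin (top_of_set zero_level) {p \<in> topspace (top_of_set (zero_level :: 'n mat_pair set)). ideal_of p \<in> U}"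
    show "openin (hilb_top CARD('n)) U"
    proof (subst openin_subopen, intro ballI)
      fix I assume "I \<in> U"
      then obtain p :: "'n mat_pair" where p: "p \<in> zero_level" "ideal_of p = I"
        using U ideal_of_surj unfolding topspace_hilb_top by blast
      obtain b where b: "ideal_of p \<in> hilb_chart CARD('n) b" "b (idx (first :: 'n)) = 1"
        using chart_of_frame[OF p(1)] by blast
      let ?V = "{J \<in> hilb_chart CARD('n) b. (chart_section b J :: 'n mat_pair) \<in>
        {p \<in> topspace (top_of_set (zero_level :: 'n mat_pair set)). ideal_of p \<in> U}}"
      have "openin (chart_top CARD('n) b) ?V"
        using openin_continuous_map_preimage[OF continuous_map_chart_section[where b = b, OF b(2)] o]
        unfolding topspace_subtopology_hilb_chart .
      then have "openin (hilb_top CARD('n)) ?V"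
        using openin_open_subtopology[OF openin_hilb_chart] by blast
      moreover have "?V = {J \<in> hilb_chart CARD('n) b. J \<in> U}"
        using ideal_of_chart_section[where b = b, OF _ b(2)] chart_section_mem[where b = b, OF _ b(2)] by auto
      ultimately show "\<exists>T. openin (hilb_top CARD('n)) T \<and> I \<in> T \<and> T \<subseteq> U"
        using b(1) p(2) \<open>I \<in> U\<close> by (intro exI[of _ ?V]) auto
    qed
  qed
qed

text \<open>Points with the same ideal form an orbit, so the saturation of \<open>V\<close> is the
  union of the preimages of \<open>V\<close> under the group elements.\<close>

lemma openin_saturation:
  fixes V :: "'n::{finite,linorder} mat_pair set"
  assumes "openin (top_of_set zero_level) V"
  shows "openin (top_of_set zero_level) {p \<in> (zero_level :: 'n mat_pair set). ideal_of p \<in> ideal_of ` V}"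
proof -
  have V: "V \<subseteq> zero_level" using openin_imp_subset[OF assms] .
  have o: "openin (top_of_set zero_level) (zero_level \<inter> zl_action g -` V)"
    if g: "g \<in> carrier stab_group" for g :: "'n cmat"
  proof -
    have "continuous_on zero_level (\<lambda>p. fst (case (g, p) of (g, x) \<Rightarrow> (zl_action g x, x)))"
      by (intro continuous_on_fst continuous_on_compose2[OF continuous_on_zl_action])
        (use g in \<open>auto intro!: continuous_intros\<close>)
    then have "continuous_on zero_level (zl_action g)" by simp
    then show ?thesis
      using continuous_openin_preimage[of zero_level "zl_action g" zero_level V] g zl_action_mem assms by blast
  qed
  have eq: "{p \<in> zero_level. ideal_of p \<in> ideal_of ` V} =
      (\<Union>g\<in>carrier stab_group. zero_level \<inter> zl_action g -` V)"
  proof (intro equalityI subsetI)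
    fix p :: "'n mat_pair" assume "p \<in> {p \<in> zero_level. ideal_of p \<in> ideal_of ` V}"
    then obtain q where "p \<in> zero_level" "q \<in> V" "ideal_of p = ideal_of q" by blast
    then show "p \<in> (\<Union>g\<in>carrier stab_group. zero_level \<inter> zl_action g -` V)"
      using ideal_of_eq_iff[of p q] V by auto
  next
    fix p assume "p \<in> (\<Union>g\<in>carrier stab_group. zero_level \<inter> zl_action g -` V)"
    then obtain g where "g \<in> carrier stab_group" "p \<in> zero_level" "zl_action g p \<in> V" by blast
    then show "p \<in> {p \<in> zero_level. ideal_of p \<in> ideal_of ` V}"
      using ideal_of_zl_action[of g p] imageI[of "zl_action g p" V ideal_of] by simp
  qed
  show ?thesis unfolding eq by (rule openin_Union) (use o in blast)
qed

lemma open_map_ideal_of: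
  "open_map (top_of_set zero_level) (hilb_top CARD('n)) (ideal_of :: 'n::{finite,linorder} mat_pair \<Rightarrow> _)"
  unfolding open_map_def
proof (intro allI impI)
  fix V :: "'n mat_pair set" assume V: "openin (top_of_set zero_level) V"
  have "ideal_of ` V \<subseteq> topspace (hilb_top CARD('n))"
    using openin_imp_subset[OF V] ideal_of_mem by (auto simp: topspace_hilb_top)
  then show "openin (hilb_top CARD('n)) (ideal_of ` V)"
    using openin_saturation[OF V] quotient_map_ideal_of[where 'n = 'n] unfolding quotient_map_def by auto
qed

text \<open>Properness makes the orbit relation closed, so two points of different orbits have a
  product neighbourhood that avoids it; since \<open>ideal_of\<close> is open, the images of its
  factors are disjoint neighbourhoods.\<close>

lemma Hausdorff_hilb_top: "Hausdorff_space (hilb_top CARD('n::{finite,linorder}))"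
  unfolding Hausdorff_space_def
proof (intro allI impI)
  fix I J assume IJ: "I \<in> topspace (hilb_top CARD('n)) \<and> J \<in> topspace (hilb_top CARD('n)) \<and> I \<noteq> J"
  obtain p q :: "'n mat_pair" where p: "p \<in> zero_level" "ideal_of p = I" and q: "q \<in> zero_level" "ideal_of q = J"
    using IJ ideal_of_surj unfolding topspace_hilb_top by metis
  let ?f = "\<lambda>(g, x). (zl_action g x, x :: 'n mat_pair)"
  let ?R = "?f ` (carrier stab_group \<times> zero_level)"
  have "closedin (top_of_set (zero_level \<times> zero_level)) ?R"
    using zl_action_graph_closed_map[where 'n = 'n] unfolding closed_map_def by auto
  then have "openin (top_of_set (zero_level \<times> zero_level)) (zero_level \<times> zero_level - ?R)"
    using openin_diff[of "top_of_set (zero_level \<times> zero_level)" "zero_level \<times> zero_level" ?R] by auto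
  then have o: "openin (prod_topology (top_of_set zero_level) (top_of_set zero_level)) (zero_level \<times> zero_level - ?R)"
    by (simp add: subtopology_Times)
  have "(p, q) \<notin> ?R"
    using ideal_of_zl_action p q IJ by auto
  then have "(p, q) \<in> zero_level \<times> zero_level - ?R" using p q by blast
  then obtain U V where UV: "openin (top_of_set zero_level) U" "openin (top_of_set zero_level) V"
    "p \<in> U" "q \<in> V" "U \<times> V \<subseteq> zero_level \<times> zero_level - ?R"
    using o unfolding openin_prod_topology_alt by meson
  have "disjnt (ideal_of ` U) (ideal_of ` V)"
  proof (rule ccontr)
    assume "\<not> disjnt (ideal_of ` U) (ideal_of ` V)"
    then obtain K where "K \<in> ideal_of ` U" "K \<in> ideal_of ` V" unfolding disjnt_def by blast
    then obtain u v where uv: "u \<in> U" "v \<in> V" "ideal_of v = ideal_of u" by (metis imageE)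
    have zl: "u \<in> zero_level" "v \<in> zero_level" using UV uv openin_imp_subset by blast+
    then obtain g where "g \<in> carrier stab_group" "zl_action g v = u"
      using uv ideal_of_eq_iff by blast
    then have "(u, v) \<in> ?R" using zl by (intro image_eqI[of _ _ "(g, v)"]) auto
    then show False using UV uv by blast
  qed
  then show "\<exists>U V. openin (hilb_top CARD('n)) U \<and> openin (hilb_top CARD('n)) V \<and> I \<in> U \<and> J \<in> V \<and> disjnt U V"
    using open_map_ideal_of[where 'n = 'n] UV p q unfolding open_map_def
    by (intro exI[of _ "ideal_of ` U"] exI[of _ "ideal_of ` V"]) auto
qed

lemma second_countable_hilb_top: "second_countable (hilb_top CARD('n::{finite,linorder}))"
proof (rule second_countable_open_map_image[OF continuous_map_ideal_of open_map_ideal_of])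
  show "ideal_of ` topspace (top_of_set (zero_level :: 'n mat_pair set)) = topspace (hilb_top CARD('n))"
    using quotient_map_ideal_of[where 'n = 'n] unfolding quotient_map_def by blast
  obtain B :: "'n mat_pair set set" where B: "countable B" "\<And>U. U \<in> B \<Longrightarrow> open U"
    "\<And>S. open S \<Longrightarrow> \<exists>U. U \<subseteq> B \<and> S = \<Union> U"
    by (rule univ_second_countable) blast
  have "\<exists>V\<in>B. x \<in> V \<and> V \<subseteq> U" if "open U" "x \<in> U" for U x
    using B(3)[OF that(1)] that(2) by blast
  then have "second_countable (euclidean :: 'n mat_pair topology)"
    unfolding second_countable_def open_openin[symmetric] using B(1,2) by blast
  then show "second_countable (top_of_set (zero_level :: 'n mat_pair set))"
    by (rule second_countable_subtopology)
qed


section \<open>Holomorphic functions on the Hilbert scheme\<close>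

lemma holomorphic_in_coords_chart_section:
  fixes I :: "complex poly poly set"
  assumes I: "I \<in> hilb_chart CARD('n::{finite,linorder}) b" and b: "b (idx (first :: 'n)) = 1"
    and F: "holomorphic_near UNIV F (\<lambda>m. entry m (chart_section b I :: 'n mat_pair))"
    and V: "openin (chart_top CARD('n) b) V" "I \<in> V"
    and \<phi>: "\<And>J. J \<in> V \<Longrightarrow> \<phi> J = F (\<lambda>m. entry m (chart_section b J :: 'n mat_pair))"
  shows "holomorphic_in_coords (chart_top CARD('n) b) (basis_coeff CARD('n) b) \<phi> I"
proof -
  \<comment> \<open>Every entry of the section is a coefficient function, with index
    \<open>t m\<close>. Distinct entries may share an index, so the coordinates are taken from
    \<open>range t\<close>.\<close>
  define t :: "bool \<times> 'n \<times> 'n \<Rightarrow> complex poly poly \<times> nat" where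
    "t = (\<lambda>(s, i, j). ((if s then [:0, 1:] else [:[:0, 1:]:]) * b (idx j), idx i))"
  have t: "entry m (chart_section b J :: 'n mat_pair) = basis_coeff CARD('n) b (t m) J" for m J
    by (cases m) (simp only: t_def entry_chart_section case_prod_conv)
  have "holomorphic_near (range t) (\<lambda>w. F (\<lambda>m\<in>UNIV. w (t m))) (\<lambda>j\<in>range t. basis_coeff CARD('n) b j I)"
  proof (rule holomorphic_near_compose)
    show "holomorphic_near UNIV F (\<lambda>m\<in>UNIV. (\<lambda>j\<in>range t. basis_coeff CARD('n) b j I) (t m))"
      using F by (simp add: t)
    show "holomorphic_near (range t) (\<lambda>w. w (t m)) (\<lambda>j\<in>range t. basis_coeff CARD('n) b j I)" for m
      by (rule holomorphic_near_projection) (auto simp: extensional_def)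
  qed (auto simp: extensional_def)
  then show ?thesis
    unfolding holomorphic_in_coords_def
    by (intro exI[of _ "range t"] exI[of _ "\<lambda>w. F (\<lambda>m\<in>UNIV. w (t m))"] exI[of _ V])
      (use V \<phi> in \<open>auto simp: t\<close>)
qed

text \<open>From left to right, the coefficient functions are replaced by rational functions of the
  entries. From right to left, a function of the entries is restricted to the section of a chart
  whose frame is the identity at \<open>p\<close>, so that the section passes through
  \<open>p\<close>.\<close>

lemma Hol_hilbert_scheme_iff:
  fixes p :: "'n::{finite,linorder} mat_pair"
  assumes p: "p \<in> zero_level"
  shows "Hol (hilbert_scheme CARD('n)) \<phi> (ideal_of p) \<longleftrightarrow>
    holomorphic_in_coords (top_of_set zero_level) entry (\<phi> \<circ> ideal_of) p"
proof
  assume "Hol (hilbert_scheme CARD('n)) \<phi> (ideal_of p)"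
  then obtain b where I: "ideal_of p \<in> hilb_chart CARD('n) b" and
    "holomorphic_in_coords (chart_top CARD('n) b) (basis_coeff CARD('n) b) \<phi> (ideal_of p)"
    by (auto simp: hilbert_scheme_def)
  then obtain J F V where J: "finite J" and F: "holomorphic_near J F (\<lambda>j\<in>J. basis_coeff CARD('n) b j (ideal_of p))"
    and V: "openin (chart_top CARD('n) b) V" "ideal_of p \<in> V"
    "\<And>K. K \<in> V \<Longrightarrow> \<phi> K = F (\<lambda>j\<in>J. basis_coeff CARD('n) b j K)"
    unfolding holomorphic_in_coords_def by blast
  obtain N and D :: "'n mat_pair \<Rightarrow> complex" where N: "\<And>j. entry_polynomial (N j)" and Dp: "entry_polynomial D"
    and D: "\<And>p. p \<in> zero_level \<Longrightarrow> ideal_of p \<in> hilb_chart CARD('n) b \<longleftrightarrow> D p \<noteq> 0"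
    and eq: "\<And>j p. p \<in> zero_level \<Longrightarrow> ideal_of p \<in> hilb_chart CARD('n) b \<Longrightarrow>
      basis_coeff CARD('n) b j (ideal_of p) = N j p / D p"
    using basis_coeff_rational[of b] by metis
  have D0: "D p \<noteq> 0" using D[OF p] I by blast
  have hol: "holomorphic_near UNIV (\<lambda>w. F (\<lambda>j\<in>J. N j (pair_of w) / D (pair_of w))) (\<lambda>m. entry m p)"
  proof (rule holomorphic_near_compose[OF finite J])
    have "(\<lambda>j\<in>J. N j (pair_of (\<lambda>m. entry m p)) / D (pair_of (\<lambda>m. entry m p))) =
        (\<lambda>j\<in>J. basis_coeff CARD('n) b j (ideal_of p))"
      using eq[OF p I] by simp
    then show "holomorphic_near J F (\<lambda>j\<in>J. N j (pair_of (\<lambda>m. entry m p)) / D (pair_of (\<lambda>m. entry m p)))"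
      using F by simp
    show "holomorphic_near UNIV (\<lambda>w. N j (pair_of w) / D (pair_of w)) (\<lambda>m. entry m p)" for j
      by (intro holomorphic_near_rational N Dp) (simp add: D0)
  qed (simp add: extensional_def)
  have Vc: "V \<subseteq> hilb_chart CARD('n) b" and Vo: "openin (hilb_top CARD('n)) V"
    using V(1) openin_open_subtopology[OF openin_hilb_chart] by auto
  show "holomorphic_in_coords (top_of_set zero_level) entry (\<phi> \<circ> ideal_of) p"
  proof (rule holomorphic_in_coords_entry[OF hol])
    show "openin (top_of_set zero_level) {q \<in> topspace (top_of_set (zero_level :: 'n mat_pair set)). ideal_of q \<in> V}"
      using openin_continuous_map_preimage[OF continuous_map_ideal_of Vo] .
    show "p \<in> {q \<in> topspace (top_of_set zero_level). ideal_of q \<in> V}" using p V by simp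
    fix q assume "q \<in> {q \<in> topspace (top_of_set (zero_level :: 'n mat_pair set)). ideal_of q \<in> V}"
    then have q: "q \<in> zero_level" "ideal_of q \<in> V" by auto
    have "(\<lambda>j\<in>J. basis_coeff CARD('n) b j (ideal_of q)) = (\<lambda>j\<in>J. N j q / D q)"
      using q Vc by (intro restrict_ext eq) blast+
    then show "(\<phi> \<circ> ideal_of) q = F (\<lambda>j\<in>J. N j (pair_of (\<lambda>m. entry m q)) / D (pair_of (\<lambda>m. entry m q)))"
      using V(3)[OF q(2)] by simp
  qed
next
  assume "holomorphic_in_coords (top_of_set zero_level) entry (\<phi> \<circ> ideal_of) p"
  then obtain F V where F: "holomorphic_near UNIV F (\<lambda>m. entry m p)" and
    V: "openin (top_of_set zero_level) V" "p \<in> V" "\<And>q. q \<in> V \<Longrightarrow> (\<phi> \<circ> ideal_of) q = F (\<lambda>m. entry m q)"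
    using holomorphic_in_coords_entryE by blast
  obtain b where b: "ideal_of p \<in> hilb_chart CARD('n) b" "b (idx (first :: 'n)) = 1"
    "nat_frame b p = mat 1"
    using chart_of_frame[OF p] by blast
  have sp: "chart_section b (ideal_of p) = p" using chart_section_ideal_of(2)[OF p b(2,3)] .
  let ?V = "{J \<in> hilb_chart CARD('n) b. (chart_section b J :: 'n mat_pair) \<in> V}"
  have "holomorphic_in_coords (chart_top CARD('n) b) (basis_coeff CARD('n) b) \<phi> (ideal_of p)"
  proof (rule holomorphic_in_coords_chart_section[where 'n = 'n and F = F and V = ?V, OF b(1,2)])
    show "openin (chart_top CARD('n) b) ?V"
      using openin_continuous_map_preimage[OF continuous_map_chart_section[where b = b, OF b(2)] V(1)]
      unfolding topspace_subtopology_hilb_chart .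
    fix J assume J: "J \<in> ?V"
    then show "\<phi> J = F (\<lambda>m. entry m (chart_section b J :: 'n mat_pair))"
      using V(3)[of "chart_section b J"] ideal_of_chart_section[where b = b, OF _ b(2), of J] by simp
  qed (use F sp b V in auto)
  then show "Hol (hilbert_scheme CARD('n)) \<phi> (ideal_of p)"
    using b(1) by (auto simp: hilbert_scheme_def)
qed


section \<open>The biholomorphism\<close>

abbreviation (input) zl_orbit :: "'n::{finite,linorder} mat_pair \<Rightarrow> 'n mat_pair set" where
  "zl_orbit \<equiv> orbit stab_group zl_action"

lemma zl_orbit_eq_iff:
  assumes "p \<in> zero_level" "q \<in> zero_level"
  shows "zl_orbit p = zl_orbit q \<longleftrightarrow> ideal_of p = ideal_of q"
proof -
  interpret group_action stab_group zero_level "zl_action :: 'a cmat \<Rightarrow> _" by (rule group_action_zl_action)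
  have q: "q \<in> zl_orbit p \<longleftrightarrow> ideal_of p = ideal_of q"
    unfolding ideal_of_eq_iff[OF assms] orbit_def by auto
  show ?thesis
  proof
    assume "zl_orbit p = zl_orbit q"
    then show "ideal_of p = ideal_of q" using q orbit_refl[OF assms(2)] by simp
  next
    assume "ideal_of p = ideal_of q"
    then have "zl_orbit p \<inter> zl_orbit q \<noteq> {}" using q orbit_refl[OF assms(2)] by blast
    moreover have "zl_orbit p \<in> orbits stab_group zero_level zl_action"
      "zl_orbit q \<in> orbits stab_group zero_level zl_action"
      using assms unfolding orbits_def by blast+
    ultimately show "zl_orbit p = zl_orbit q" using disjoint_union by blast
  qed
qed

lemma Top_symplectic_quotient:
  "Top (symplectic_quotient :: 'n::{finite,linorder} mat_pair set holo_space) = quotient_top (top_of_set zero_level) zl_orbit"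
  by (simp add: symplectic_quotient_def quotient_space_def matrix_space_def)

lemma quotient_map_quotient_top: "quotient_map T (quotient_top T f) f"
proof -
  have "topspace (quotient_top T f) = f ` topspace T"
  proof
    show "topspace (quotient_top T f) \<subseteq> f ` topspace T"
      using openin_topspace[of "quotient_top T f"] unfolding openin_quotient_top by blast
    have "{p \<in> topspace T. f p \<in> f ` topspace T} = topspace T" by auto
    then have "openin (quotient_top T f) (f ` topspace T)" by (simp add: openin_quotient_top)
    then show "f ` topspace T \<subseteq> topspace (quotient_top T f)" by (rule openin_subset)
  qed
  then show ?thesis unfolding quotient_map_def openin_quotient_top by auto
qed

lemma Hol_symplectic_quotient:
  "Hol symplectic_quotient \<phi> y \<longleftrightarrow> (\<exists>U. openin (quotient_top (top_of_set zero_level) zl_orbit) U \<and> y \<in> U \<and>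
     (\<forall>p \<in> zero_level. zl_orbit p \<in> U \<longrightarrow> holomorphic_in_coords (top_of_set zero_level) entry (\<phi> \<circ> zl_orbit) p))"
  by (simp add: symplectic_quotient_def quotient_space_def matrix_space_def)

text \<open>Representatives are picked by \<open>SOME\<close>; the equality of the fibres makes the
  choice immaterial.\<close>

lemma biholomorphic_maps_symplectic_quotient:
  obtains f g where "biholomorphic_maps (symplectic_quotient :: 'n::{finite,linorder} mat_pair set holo_space)
    (hilbert_scheme CARD('n)) f g"
proof -
  define f :: "'n mat_pair set \<Rightarrow> complex poly poly set" where
    "f = (\<lambda>S. ideal_of (SOME p. p \<in> zero_level \<and> zl_orbit p = S))"
  define g :: "complex poly poly set \<Rightarrow> 'n mat_pair set" where
    "g = (\<lambda>I. zl_orbit (SOME p. p \<in> zero_level \<and> ideal_of p = I))"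
  have f: "f (zl_orbit p) = ideal_of p" if "p \<in> zero_level" for p
  proof -
    have "(SOME q. q \<in> zero_level \<and> zl_orbit q = zl_orbit p) \<in> zero_level \<and>
        zl_orbit (SOME q. q \<in> zero_level \<and> zl_orbit q = zl_orbit p) = zl_orbit p"
      by (rule someI[of "\<lambda>q. q \<in> zero_level \<and> zl_orbit q = zl_orbit p" p]) (use that in simp)
    then show ?thesis using zl_orbit_eq_iff[OF _ that] unfolding f_def by blast
  qed
  have g: "g (ideal_of p) = zl_orbit p" if "p \<in> zero_level" for p
  proof -
    have "(SOME q :: 'n mat_pair. q \<in> zero_level \<and> ideal_of q = ideal_of p) \<in> zero_level \<and>
        ideal_of (SOME q :: 'n mat_pair. q \<in> zero_level \<and> ideal_of q = ideal_of p) = ideal_of p"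
      by (rule someI[of "\<lambda>q. q \<in> zero_level \<and> ideal_of q = ideal_of p" p]) (use that in simp)
    then show ?thesis using zl_orbit_eq_iff[OF _ that] unfolding g_def by blast
  qed
  let ?Z = "top_of_set (zero_level :: 'n mat_pair set)"
  let ?Q = "quotient_top ?Z zl_orbit"
  have q: "quotient_map ?Z ?Q zl_orbit" by (rule quotient_map_quotient_top)
  have topQ: "topspace ?Q = zl_orbit ` zero_level"
    using q unfolding quotient_map_def by simp
  have topH: "topspace (hilb_top CARD('n)) = ideal_of ` (zero_level :: 'n mat_pair set)"
    using quotient_map_ideal_of[where 'n = 'n] unfolding quotient_map_def by simp
  have "continuous_map ?Z (hilb_top CARD('n)) (f \<circ> zl_orbit)"
    using continuous_map_ideal_of[where 'n = 'n] by (rule continuous_map_eq) (simp add: f)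
  then have fc: "continuous_map ?Q (hilb_top CARD('n)) f"
    using continuous_compose_quotient_map[OF q] by blast
  have "continuous_map ?Z ?Q (g \<circ> ideal_of)"
    using quotient_imp_continuous_map[OF q] by (rule continuous_map_eq) (simp add: g)
  then have gc: "continuous_map (hilb_top CARD('n)) ?Q g"
    using continuous_compose_quotient_map[OF quotient_map_ideal_of] by blast
  have topQ': "Top symplectic_quotient = ?Q" by (rule Top_symplectic_quotient)
  have topH': "Top (hilbert_scheme CARD('n)) = hilb_top CARD('n)" by (simp add: hilbert_scheme_def)
  have "homeomorphic_maps (Top symplectic_quotient) (Top (hilbert_scheme CARD('n))) f g"
    unfolding homeomorphic_maps_def topQ' topH' using fc gc by (auto simp: topQ topH f g)
  moreover have "holomorphic_map symplectic_quotient (hilbert_scheme CARD('n)) f"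
    unfolding holomorphic_map_def topQ' topH'
  proof (intro conjI fc ballI allI impI)
    fix S \<phi> assume "S \<in> topspace ?Q" and h: "Hol (hilbert_scheme CARD('n)) \<phi> (f S)"
    then obtain p where p: "p \<in> zero_level" "S = zl_orbit p" unfolding topQ by blast
    have "holomorphic_in_coords ?Z entry (\<phi> \<circ> ideal_of) p"
      using h Hol_hilbert_scheme_iff[OF p(1)] by (simp add: p f)
    then obtain V where V: "openin ?Z V" "p \<in> V" "\<And>q. q \<in> V \<Longrightarrow> holomorphic_in_coords ?Z entry (\<phi> \<circ> ideal_of) q"
      using holomorphic_in_coords_entry_open by blast
    have Vz: "V \<subseteq> zero_level" using openin_imp_subset[OF V(1)] .
    have orb: "zl_orbit q \<in> zl_orbit ` V \<longleftrightarrow> ideal_of q \<in> ideal_of ` V" if "q \<in> zero_level" for q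
      using zl_orbit_eq_iff[OF that] Vz by (auto simp: image_iff) blast+
    show "Hol symplectic_quotient (\<phi> \<circ> f) S"
      unfolding Hol_symplectic_quotient
    proof (intro exI[of _ "zl_orbit ` V"] conjI ballI impI)
      have "{q \<in> zero_level. zl_orbit q \<in> zl_orbit ` V} = {q \<in> zero_level. ideal_of q \<in> ideal_of ` V}"
        using orb by blast
      then show "openin ?Q (zl_orbit ` V)"
        unfolding openin_quotient_top using openin_saturation[OF V(1)] Vz by auto
      show "S \<in> zl_orbit ` V" using p V by blast
      fix q assume q: "q \<in> (zero_level :: 'n mat_pair set)" "zl_orbit q \<in> zl_orbit ` V"
      then obtain v where v: "v \<in> V" "ideal_of q = ideal_of v" using orb by blast
      \<comment> \<open>By \<open>Hol_hilbert_scheme_iff\<close>, holomorphy of the pullback at a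
        point depends on its ideal alone, so it passes from \<open>v\<close> to the point
        \<open>q\<close> of the same orbit.\<close>
      then have "holomorphic_in_coords ?Z entry (\<phi> \<circ> ideal_of) q"
        using V(3)[of v] Vz q(1) Hol_hilbert_scheme_iff[of v \<phi>] Hol_hilbert_scheme_iff[of q \<phi>] by auto
      then show "holomorphic_in_coords ?Z entry (\<phi> \<circ> f \<circ> zl_orbit) q"
        by (rule holomorphic_in_coords_cong) (simp add: f)
    qed
  qed
  moreover have "holomorphic_map (hilbert_scheme CARD('n)) symplectic_quotient g"
    unfolding holomorphic_map_def topQ' topH'
  proof (intro conjI gc ballI allI impI)
    fix I \<phi> assume "I \<in> topspace (hilb_top CARD('n))" and h: "Hol symplectic_quotient \<phi> (g I)"
    then obtain p :: "'n mat_pair" where p: "p \<in> zero_level" "I = ideal_of p" unfolding topH by blast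
    then have "holomorphic_in_coords ?Z entry (\<phi> \<circ> zl_orbit) p"
      using h unfolding Hol_symplectic_quotient by (auto simp: g)
    then have "holomorphic_in_coords ?Z entry (\<phi> \<circ> g \<circ> ideal_of) p"
      by (rule holomorphic_in_coords_cong) (simp add: g)
    then show "Hol (hilbert_scheme CARD('n)) (\<phi> \<circ> g) I"
      using Hol_hilbert_scheme_iff[OF p(1)] p(2) by simp
  qed
  ultimately show ?thesis using that unfolding biholomorphic_maps_def by blast
qed

section \<open>Transversality of the slice equations\<close>

text \<open>The hypothesis is independence of the rows outside \<open>S\<close>. They are completed
  to a basis, and the new vectors are distributed over the positions in \<open>S\<close>.\<close>

lemma extend_independent_rows:
  fixes M :: "complex^'m::finite^'m"
  assumes ind: "\<And>c m. (\<And>m. m \<in> S \<Longrightarrow> c m = 0) \<Longrightarrow> (\<Sum>m\<in>UNIV. c m *s row m M) = 0 \<Longrightarrow> c m = 0"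
  obtains M' where "invertible M'" "\<And>m. m \<notin> S \<Longrightarrow> row m M' = row m M"
proof -
  let ?f = "\<lambda>m. row m M"
  \<comment> \<open>Independence of a set of vectors does not see repeated rows; the coefficients
    \<open>1\<close> and \<open>-1\<close> exclude them.\<close>
  have inj: "inj_on ?f (- S)"
  proof (rule inj_onI, rule ccontr)
    fix x y assume xy: "x \<in> - S" "y \<in> - S" "row x M = row y M" "x \<noteq> y"
    define c where "c = (\<lambda>m. if m = x then 1 else if m = y then - 1 else (0 :: complex))"
    have "(\<Sum>m\<in>UNIV. c m *s row m M) = (\<Sum>m\<in>{x, y}. c m *s row m M)"
      by (rule sum.mono_neutral_right) (auto simp: c_def)
    also have "\<dots> = c x *s row x M + c y *s row y M" using xy(4) by simp
    also have "\<dots> = (c x + c y) *s row y M" unfolding xy(3) vector_sadd_rdistrib ..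
    also have "\<dots> = 0" using xy(4) by (simp add: c_def)
    finally have s: "(\<Sum>m\<in>UNIV. c m *s row m M) = 0" .
    have "c x = 0" by (rule ind[OF _ s]) (use xy(1,2) in \<open>auto simp: c_def\<close>)
    then show False by (simp add: c_def)
  qed
  have "vec.independent (?f ` (- S))"
    unfolding vec.dependent_finite[OF finite_imageI[OF finite]]
  proof
    assume "\<exists>u. (\<exists>v\<in>?f ` (- S). u v \<noteq> 0) \<and> (\<Sum>v\<in>?f ` (- S). u v *s v) = 0"
    then obtain u x where u: "x \<in> - S" "u (?f x) \<noteq> 0" "(\<Sum>v\<in>?f ` (- S). u v *s v) = 0" by blast
    define c where "c = (\<lambda>m. if m \<in> S then 0 else u (?f m))"
    have "(\<Sum>m\<in>UNIV. c m *s row m M) = (\<Sum>m\<in>- S. u (?f m) *s ?f m)"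
      by (rule sum.mono_neutral_cong_right) (auto simp: c_def)
    also have "\<dots> = 0" using u(3) by (simp add: sum.reindex[OF inj])
    finally have s: "(\<Sum>m\<in>UNIV. c m *s row m M) = 0" .
    have "c x = 0" by (rule ind[OF _ s]) (auto simp: c_def)
    then show False using u by (simp add: c_def)
  qed
  then obtain B where B: "?f ` (- S) \<subseteq> B" "vec.independent B" "UNIV \<subseteq> vec.span B"
    using vec.maximal_independent_subset_extend[OF subset_UNIV] by metis
  have fB: "finite B" using vec.finiteI_independent[OF B(2)] .
  have "card B = CARD('m)"
    using vec.basis_card_eq_dim[OF subset_UNIV B(3,2)] unfolding vec_dim_card .
  moreover have "card (- S) = CARD('m) - card S" "card S \<le> CARD('m)"
    by (simp_all add: Compl_eq_Diff_UNIV card_Diff_subset card_mono)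
  ultimately have "card (B - ?f ` (- S)) = card S"
    using card_Diff_subset[OF _ B(1)] card_image[OF inj] by simp
  then obtain t where t: "bij_betw t S (B - ?f ` (- S))"
    using finite_same_card_bij[of S "B - ?f ` (- S)"] fB by auto
  define M' where "M' = (\<chi> m. if m \<in> S then t m else row m M)"
  have row: "row m M' = (if m \<in> S then t m else row m M)" for m
    by (simp add: M'_def row_def vec_eq_iff)
  have "rows M' = t ` S \<union> ?f ` (- S)"
    unfolding rows_def row by auto
  also have "\<dots> = B" using bij_betw_imp_surj_on[OF t] B(1) by auto
  finally have "vec.span (rows M') = UNIV" using B(3) by auto
  then have "invertible M'"
    using matrix_left_invertible_span_rows_gen[of M'] invertible_left_inverse by blast
  then show ?thesis by (rule that) (simp add: row)
qed

section \<open>Derivatives along the orbits\<close>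

lemma bounded_bilinear_matrix_mult: "bounded_bilinear ((**) :: 'n::finite cmat \<Rightarrow> 'n cmat \<Rightarrow> 'n cmat)"
proof -
  have "(r *\<^sub>R X) ** Y = r *\<^sub>R (X ** Y)" "X ** (r *\<^sub>R Y) = r *\<^sub>R (X ** Y)" for r and X Y :: "'n cmat"
    by (simp_all add: vec_eq_iff matrix_matrix_mult_def scaleR_sum_right)
  then have "bilinear ((**) :: 'n cmat \<Rightarrow> 'n cmat \<Rightarrow> 'n cmat)"
    unfolding bilinear_def by (auto intro!: linearI simp: matrix_add_ldistrib matrix_add_rdistrib)
  then show ?thesis by (simp add: bilinear_conv_bounded_bilinear)
qed

lemma commutator_mult: "commutator \<xi> (X ** Y) = commutator \<xi> X ** Y + X ** commutator \<xi> Y"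
  by (simp add: commutator_def matrix_mult_diff matrix_mul_assoc)

lemma commutator_add: "commutator \<xi> (X + Y) = commutator \<xi> X + commutator \<xi> Y"
  by (simp add: commutator_def matrix_add_ldistrib matrix_add_rdistrib)

lemma commutator_mat [simp]: "commutator \<xi> (mat a) = 0"
  by (simp add: commutator_def mat_matrix_mult_commute)

lemma commutator_0_right [simp]: "commutator \<xi> 0 = 0"
  by (simp add: commutator_def)

lemma fundamental_field_components:
  "fst (fundamental_field \<xi> p) = commutator \<xi> (fst p)" "snd (fundamental_field \<xi> p) = commutator \<xi> (snd p)"
  by (simp_all add: fundamental_field_def case_prod_beta)

text \<open>Differentiation along the fundamental field and \<open>commutator \<xi>\<close> both
  obey the product rule, and they agree on constants and on the first matrix.\<close>

lemma has_derivative_mat_poly_fundamental_field: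
  "\<exists>D. ((\<lambda>p. mat_poly (fst p) q) has_derivative D) (at p) \<and>
     D (fundamental_field \<xi> p) = commutator \<xi> (mat_poly (fst p) q)"
proof (induction q)
  case 0
  show ?case by (intro exI[of _ "\<lambda>_. 0"]) simp
next
  case (pCons a q)
  then obtain D where D: "((\<lambda>p. mat_poly (fst p) q) has_derivative D) (at p)"
    "D (fundamental_field \<xi> p) = commutator \<xi> (mat_poly (fst p) q)" by blast
  show ?case
  proof (intro exI conjI)
    show "((\<lambda>p. mat_poly (fst p) (pCons a q)) has_derivative
        (\<lambda>h. 0 + (fst p ** D h + fst h ** mat_poly (fst p) q))) (at p)"
      unfolding mat_poly_pCons
      by (intro has_derivative_add has_derivative_const bounded_bilinear.FDERIV[OF bounded_bilinear_matrix_mult]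
          has_derivative_fst has_derivative_ident D)
    show "0 + (fst p ** D (fundamental_field \<xi> p) + fst (fundamental_field \<xi> p) ** mat_poly (fst p) q) =
        commutator \<xi> (mat_poly (fst p) (pCons a q))"
      by (simp add: D(2) commutator_add commutator_mult fundamental_field_components)
  qed
qed

lemma has_derivative_mat_poly2_fundamental_field:
  "\<exists>D. ((\<lambda>p. mat_poly2 (fst p) (snd p) f) has_derivative D) (at p) \<and>
     D (fundamental_field \<xi> p) = commutator \<xi> (mat_poly2 (fst p) (snd p) f)"
proof (induction f)
  case 0
  show ?case by (intro exI[of _ "\<lambda>_. 0"]) simp
next
  case (pCons q f)
  then obtain D where D: "((\<lambda>p. mat_poly2 (fst p) (snd p) f) has_derivative D) (at p)"
    "D (fundamental_field \<xi> p) = commutator \<xi> (mat_poly2 (fst p) (snd p) f)" by blast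
  obtain D' where D': "((\<lambda>p. mat_poly (fst p) q) has_derivative D') (at p)"
    "D' (fundamental_field \<xi> p) = commutator \<xi> (mat_poly (fst p) q)"
    using has_derivative_mat_poly_fundamental_field by blast
  show ?case
  proof (intro exI conjI)
    show "((\<lambda>p. mat_poly2 (fst p) (snd p) (pCons q f)) has_derivative
        (\<lambda>h. D' h + (snd p ** D h + snd h ** mat_poly2 (fst p) (snd p) f))) (at p)"
      unfolding mat_poly2_pCons
      by (intro has_derivative_add D' bounded_bilinear.FDERIV[OF bounded_bilinear_matrix_mult]
          has_derivative_snd has_derivative_ident D)
    show "D' (fundamental_field \<xi> p) + (snd p ** D (fundamental_field \<xi> p) +
        snd (fundamental_field \<xi> p) ** mat_poly2 (fst p) (snd p) f) =
        commutator \<xi> (mat_poly2 (fst p) (snd p) (pCons q f))"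
      by (simp add: D(2) D'(2) commutator_add commutator_mult fundamental_field_components)
  qed
qed

text \<open>The 2n positions at which \<open>slice_map\<close> vanishes identically when
  \<open>b first = 1\<close>: the first row of the moment map and the first column of the frame
  condition. They will hold the coordinates of the chart.\<close>

definition free_indices :: "(bool \<times> 'n::{finite,linorder} \<times> 'n) set" where
  "free_indices = {(s, i, j). if s then j = first else i = first}"

text \<open>The equations are arranged as a pair of matrices, so that source and target have the
  same dimension once the free positions are filled.\<close>

definition slice_map :: "('n \<Rightarrow> complex poly poly) \<Rightarrow> 'n::{finite,linorder} mat_pair \<Rightarrow> 'n mat_pair" where
  "slice_map b p = (moment_map p, frame_matrix b p - mat 1)"

lemma frame_matrix_nth: "frame_matrix b p $ i $ j = mat_poly2 (fst p) (snd p) (b j) $ i $ first"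
  by (simp add: frame_matrix_def e1_def)

lemma slice_map_free_indices:
  assumes "b first = 1" "m \<in> free_indices"
  shows "entry m (slice_map b p) = 0"
  using assms
  by (cases m) (auto simp: free_indices_def slice_map_def entry_def moment_map_def frame_matrix_nth case_prod_beta
      split: if_splits)

text \<open>Cyclicity follows from the frame condition: every standard vector is a value of some
  \<open>b j\<close> at \<open>e1\<close> and hence lies in each invariant subspace that contains
  \<open>e1\<close>. The slice is thus given by equations alone, in the space of all pairs.\<close>

lemma slice_map_eq_0D:
  assumes "slice_map b p = 0"
  shows "p \<in> zero_level" "frame_matrix b p = mat 1"
proof -
  have \<mu>: "moment_map p = 0" and F: "frame_matrix b p = mat 1"
    using assms by (auto simp: slice_map_def zero_prod_def)
  show "frame_matrix b p = mat 1" by (fact F)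
  have "cyclic_vector e1 (fst p) (snd p)"
    unfolding cyclic_vector_def
  proof (intro notI, elim exE conjE)
    fix T assume T: "vec.subspace T" "T \<noteq> UNIV" "e1 \<in> T" "\<forall>w\<in>T. fst p *v w \<in> T \<and> snd p *v w \<in> T"
    have "axis j 1 \<in> T" for j
      using mat_poly2_mem_invariant_subspace[of T "fst p" "snd p" e1 "b j"] T
      by (simp add: frame_matrix_axis[symmetric] F)
    then have "(\<Sum>j\<in>UNIV. x $ j *s axis j 1) \<in> T" for x
      using T(1) by (intro vec.subspace_sum vec.subspace_scale)
    moreover have "(\<Sum>j\<in>UNIV. x $ j *s axis j 1) = x" for x :: "(complex, 'a) vec"
      by (simp add: vec_eq_iff axis_def if_distrib cong: if_cong)
    ultimately show False using T(2) by auto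
  qed
  then show "p \<in> zero_level"
    using \<mu> by (simp add: zero_level_def cyclic_pairs_def case_prod_beta)
qed

lemma entry_polynomial_slice_map: "entry_polynomial (\<lambda>p. entry m (slice_map b p))"
proof -
  obtain s i j where m: "m = (s, i, j)" by (cases m)
  have "entry_polynomial (\<lambda>p. frame_matrix b p $ i $ j - mat 1 $ i $ j)"
    by (intro entry_polynomial_diff entry_polynomial_frame_matrix entry_polynomial.const)
  moreover have "entry_polynomial (\<lambda>p. (fst p ** snd p) $ i $ j - (snd p ** fst p) $ i $ j)"
    by (intro entry_polynomial_diff entry_polynomial_matrix_mult entry_polynomial_fst entry_polynomial_snd)
  ultimately show ?thesis
    by (cases s; cases "i = first")
      (simp_all add: m slice_map_def entry_def moment_map_def commutator_def case_prod_beta entry_polynomial.const)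
qed

text \<open>Orbits of commuting pairs are isotropic, as the commutator stays zero along them. In the
  expansion, the eight traces cancel in pairs by cyclicity and
  \<open>A ** B = B ** A\<close>.\<close>

lemma symplectic_form_fundamental_fields:
  assumes "A ** B = B ** A"
  shows "symplectic_form (fundamental_field \<xi> (A, B)) (fundamental_field \<zeta> (A, B)) = 0"
proof -
  have cyc: "trace (X ** Y ** Z ** W) = trace (W ** X ** Y ** Z)" for X Y Z W :: "'a cmat"
    by (metis trace_mul_sym matrix_mul_assoc)
  have "trace (commutator \<xi> A ** commutator \<zeta> B) =
      trace (\<xi> ** A ** \<zeta> ** B) - trace (\<xi> ** A ** B ** \<zeta>) - (trace (A ** \<xi> ** \<zeta> ** B) - trace (A ** \<xi> ** B ** \<zeta>))"
    by (simp add: commutator_def matrix_mult_diff trace_diff matrix_mul_assoc)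
  moreover have "trace (commutator \<zeta> A ** commutator \<xi> B) =
      trace (\<zeta> ** A ** \<xi> ** B) - trace (\<zeta> ** A ** B ** \<xi>) - (trace (A ** \<zeta> ** \<xi> ** B) - trace (A ** \<zeta> ** B ** \<xi>))"
    by (simp add: commutator_def matrix_mult_diff trace_diff matrix_mul_assoc)
  moreover have "trace (A ** \<zeta> ** B ** \<xi>) = trace (\<xi> ** A ** \<zeta> ** B)" by (rule cyc)
  moreover have "trace (A ** \<xi> ** B ** \<zeta>) = trace (\<zeta> ** A ** \<xi> ** B)" by (rule cyc)
  moreover have "trace (\<xi> ** A ** B ** \<zeta>) = trace (A ** \<zeta> ** \<xi> ** B)"
  proof -
    have "\<xi> ** A ** B ** \<zeta> = \<xi> ** B ** A ** \<zeta>" by (metis assms matrix_mul_assoc)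
    then show ?thesis using cyc[of \<xi> B A \<zeta>] cyc[of \<zeta> \<xi> B A] by simp
  qed
  moreover have "trace (\<zeta> ** A ** B ** \<xi>) = trace (A ** \<xi> ** \<zeta> ** B)"
  proof -
    have "\<zeta> ** A ** B ** \<xi> = \<zeta> ** B ** A ** \<xi>" by (metis assms matrix_mul_assoc)
    then show ?thesis using cyc[of \<zeta> B A \<xi>] cyc[of \<xi> \<zeta> B A] by simp
  qed
  ultimately show ?thesis
    by (simp add: symplectic_form_def fundamental_field_def)
qed

lemma symplectic_form_nondegenerate:
  assumes "\<And>v. symplectic_form u v = 0"
  shows "u = 0"
proof -
  have nd: "X = 0" if "\<And>Y. trace (X ** Y) = 0" for X :: "'a cmat"
  proof -
    have "trace (X ** (\<chi> r c. if r = j \<and> c = i then 1 else 0)) = X $ i $ j" for i j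
    proof -
      have "trace (X ** (\<chi> r c. if r = j \<and> c = i then 1 else 0)) =
          (\<Sum>k\<in>UNIV. \<Sum>l\<in>UNIV. if k = i then (if l = j then X $ i $ j else 0) else 0)"
        unfolding trace_def matrix_matrix_mult_def by (auto intro!: sum.cong)
      also have "\<dots> = (\<Sum>k\<in>UNIV. if k = i then X $ i $ j else 0)"
        by (intro sum.cong) auto
      finally show ?thesis by simp
    qed
    then show ?thesis using that by (simp add: vec_eq_iff)
  qed
  obtain a b where u: "u = (a, b)" by fastforce
  have "trace (a ** Y) = 0" for Y
    using assms[of "(0, Y)"] by (simp add: u symplectic_form_def trace_def)
  moreover have "trace (b ** Y) = 0" for Y
    using assms[of "(Y, 0)"] trace_mul_sym[of b Y] by (simp add: u symplectic_form_def trace_def)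
  ultimately show ?thesis using nd u by (simp add: zero_prod_def)
qed

lemma sum_bool_times:
  "(\<Sum>m\<in>UNIV. f m) = (\<Sum>i\<in>UNIV. \<Sum>j\<in>UNIV. f (False, i, j)) + (\<Sum>i\<in>UNIV. \<Sum>j\<in>UNIV. f (True, i, j))"
  for f :: "bool \<times> 'n::finite \<times> 'n \<Rightarrow> complex"
proof -
  have "(\<Sum>m\<in>UNIV. f m) = (\<Sum>s\<in>UNIV. \<Sum>q\<in>UNIV. f (s, q))"
    by (simp add: sum.cartesian_product UNIV_Times_UNIV[symmetric] case_prod_beta del: UNIV_Times_UNIV)
  also have "\<dots> = (\<Sum>s\<in>UNIV. \<Sum>i\<in>UNIV. \<Sum>j\<in>UNIV. f (s, i, j))"
    by (simp add: sum.cartesian_product UNIV_Times_UNIV[symmetric] case_prod_beta del: UNIV_Times_UNIV)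
  finally show ?thesis by (simp add: UNIV_bool add.commute)
qed

text \<open>
  A functional \<open>c\<close> vanishing on the image of the derivative is a pair \<open>(\<xi>, \<eta>)\<close>, paired with the moment
  map and with the frame. On the directions of the orbit the moment map has derivative 0 and the
  frame has derivative \<open>\<zeta>\<close>, so \<open>\<eta> = 0\<close>; by the Hamiltonian property and nondegeneracy, \<open>\<xi>\<close>
  then acts trivially, so \<open>\<xi> = 0\<close> because the action is free.
\<close>

lemma slice_map_derivative_independent:
  fixes p :: "'n::{finite,linorder} mat_pair"
  assumes p: "p \<in> zero_level" and b: "b first = 1" and F: "frame_matrix b p = mat 1"
    and f': "\<And>m. ((\<lambda>p. entry m (slice_map b p)) has_derivative f' m) (at p)"
    and c: "\<And>m. m \<in> free_indices \<Longrightarrow> c m = 0" and l: "\<And>v. (\<Sum>m\<in>UNIV. c m * f' m v) = 0"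
  shows "c m = 0"
proof -
  obtain A B where pAB: "p = (A, B)" by fastforce
  have AB: "A ** B = B ** A" and cyc: "cyclic_vector e1 A B" using p by (auto simp: pAB zero_level_iff)
  \<comment> \<open>Transposed, so that the pairing of \<open>c\<close> with the moment map becomes
    the trace pairing with \<open>\<xi>\<close>; the vanishing of \<open>c\<close> on the first row
    puts \<open>\<xi>\<close> into the Lie algebra.\<close>
  define \<xi> where "\<xi> = (\<chi> j i. c (False, i, j))"
  have \<xi>1: "column first \<xi> = 0"
    by (simp add: \<xi>_def column_def vec_eq_iff c free_indices_def)
  have "(\<Sum>i\<in>UNIV. \<Sum>j\<in>UNIV. c (False, i, j) * entry (False, i, j) (slice_map b q)) = trace (\<xi> ** moment_map q)" for q
    unfolding trace_def matrix_matrix_mult_def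
    by (subst sum.swap) (simp add: \<xi>_def entry_def slice_map_def)
  moreover have "((\<lambda>q. \<Sum>i\<in>UNIV. \<Sum>j\<in>UNIV. c (False, i, j) * entry (False, i, j) (slice_map b q)) has_derivative
      (\<lambda>v. \<Sum>i\<in>UNIV. \<Sum>j\<in>UNIV. c (False, i, j) * f' (False, i, j) v)) (at p)"
    by (intro has_derivative_sum has_derivative_mult_right f')
  ultimately have "((\<lambda>q. trace (\<xi> ** moment_map q)) has_derivative
      (\<lambda>v. \<Sum>i\<in>UNIV. \<Sum>j\<in>UNIV. c (False, i, j) * f' (False, i, j) v)) (at p)"
    by simp
  note eq = has_derivative_unique[OF this moment_map_hamiltonian[OF \<xi>1]]
  have S: "(\<Sum>i\<in>UNIV. \<Sum>j\<in>UNIV. c (False, i, j) * f' (False, i, j) v) =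
      symplectic_form (fundamental_field \<xi> p) v" for v
    using fun_cong[OF eq, of v] by simp
  \<comment> \<open>As \<open>\<zeta>\<close> kills \<open>e1\<close>, the commutator of
    \<open>\<zeta>\<close> with the value of \<open>b j\<close> maps \<open>e1\<close> to
    \<open>\<zeta>\<close> applied to a column of the frame, and the frame is the identity at
    \<open>p\<close>.\<close>
  have fr: "f' (True, i, j) (fundamental_field \<zeta> p) = \<zeta> $ i $ j" if \<zeta>: "\<zeta> *v e1 = 0" for \<zeta> i j
  proof -
    obtain D where D: "((\<lambda>p. mat_poly2 (fst p) (snd p) (b j)) has_derivative D) (at p)"
      "D (fundamental_field \<zeta> p) = commutator \<zeta> (mat_poly2 (fst p) (snd p) (b j))"
      using has_derivative_mat_poly2_fundamental_field by blast
    have "((\<lambda>p. mat_poly2 (fst p) (snd p) (b j) $ i $ first - mat 1 $ i $ j) has_derivative (\<lambda>h. D h $ i $ first - 0)) (at p)"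
      by (intro has_derivative_diff has_derivative_const bounded_linear.has_derivative[OF bounded_linear_vec_nth] D)
    moreover have "(\<lambda>p. entry (True, i, j) (slice_map b p)) = (\<lambda>p. mat_poly2 (fst p) (snd p) (b j) $ i $ first - mat 1 $ i $ j)"
      by (simp add: entry_def slice_map_def frame_matrix_nth)
    ultimately have "f' (True, i, j) = (\<lambda>h. D h $ i $ first - 0)"
      using has_derivative_unique[OF f'[of "(True, i, j)"]] by simp
    then have "f' (True, i, j) (fundamental_field \<zeta> p) = (commutator \<zeta> (mat_poly2 (fst p) (snd p) (b j)) *v e1) $ i"
      by (simp add: D(2) e1_def)
    also have "\<dots> = (\<zeta> *v (frame_matrix b p *v axis j 1)) $ i"
      using \<zeta> by (simp add: commutator_def matrix_vector_mult_diff_rdistrib frame_matrix_axis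
          flip: matrix_vector_mul_assoc)
    finally show ?thesis by (simp add: F)
  qed
  have l': "symplectic_form (fundamental_field \<xi> p) v + (\<Sum>i\<in>UNIV. \<Sum>j\<in>UNIV. c (True, i, j) * f' (True, i, j) v) = 0" for v
    using l[of v] unfolding sum_bool_times S .
  have cT: "c (True, r, s) = 0" for r s
  proof (cases "s = first")
    case True
    then show ?thesis by (intro c) (simp add: free_indices_def)
  next
    case False
    \<comment> \<open>An elementary matrix with \<open>s \<noteq> first\<close> lies in the Lie
      algebra and isolates the coefficient at \<open>(r, s)\<close>.\<close>
    define \<zeta> :: "'n cmat" where "\<zeta> = (\<chi> i j. if i = r \<and> j = s then 1 else 0)"
    have \<zeta>1: "\<zeta> *v e1 = 0" using False by (auto simp: \<zeta>_def e1_def vec_eq_iff)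
    have "symplectic_form (fundamental_field \<xi> p) (fundamental_field \<zeta> p) = 0"
      unfolding pAB using AB by (rule symplectic_form_fundamental_fields)
    then have "(\<Sum>i\<in>UNIV. \<Sum>j\<in>UNIV. c (True, i, j) * \<zeta> $ i $ j) = 0"
      using l'[of "fundamental_field \<zeta> p"] by (simp add: fr[OF \<zeta>1])
    moreover have "(\<Sum>i\<in>UNIV. \<Sum>j\<in>UNIV. c (True, i, j) * \<zeta> $ i $ j) =
        (\<Sum>i\<in>UNIV. \<Sum>j\<in>UNIV. if i = r then (if j = s then c (True, r, s) else 0) else 0)"
      by (auto simp: \<zeta>_def intro!: sum.cong)
    moreover have "\<dots> = (\<Sum>i\<in>UNIV. if i = r then c (True, r, s) else 0)"
      by (intro sum.cong) auto
    ultimately show ?thesis by simp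
  qed
  have "symplectic_form (fundamental_field \<xi> p) v = 0" for v
    using l'[of v] by (simp add: cT)
  then have "fundamental_field \<xi> p = 0" by (rule symplectic_form_nondegenerate)
  then have int: "\<xi> ** A = A ** \<xi>" "\<xi> ** B = B ** \<xi>"
    by (auto simp: pAB fundamental_field_def commutator_def zero_prod_def)
  have "\<xi> *v e1 = 0"
    using \<xi>1 by (simp add: vec_eq_iff column_def e1_def)
  then have "\<xi> = 0"
    by (intro intertwiner_of_cyclic_unique[OF cyc _ int(1) _ int(2)]) simp_all
  then have "c (False, i, j) = 0" for i j by (simp add: \<xi>_def vec_eq_iff)
  then show ?thesis using cT by (cases m; cases "fst m") auto
qed

section \<open>Charts\<close>

lemma linear_complex_expansion:
  assumes "linear D" "\<And>c v. D (scale_pair c v) = c * D v"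
  shows "D v = (\<Sum>k\<in>UNIV. D (unit_pair k) * entry k v)"
proof -
  have "D v = D (\<Sum>k\<in>UNIV. scale_pair (entry k v) (unit_pair k))"
    using pair_of_eq_sum[of "\<lambda>k. entry k v"] by simp
  also have "\<dots> = (\<Sum>k\<in>UNIV. D (unit_pair k) * entry k v)"
    by (simp add: linear_sum[OF assms(1)] assms(2) mult.commute)
  finally show ?thesis .
qed

lemma has_derivative_pair:
  assumes "\<And>m. ((\<lambda>x. entry m (f x)) has_derivative (\<lambda>v. entry m (D v))) F"
  shows "(f has_derivative (D :: _ \<Rightarrow> 'n::finite mat_pair)) F"
proof -
  have e: "h = (\<lambda>x. \<Sum>m\<in>UNIV. scale_pair (entry m (h x)) (unit_pair m))" for h :: "'b \<Rightarrow> 'n mat_pair"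
    using pair_of_eq_sum[of "\<lambda>m. entry m (h x)" for x] by (simp add: fun_eq_iff)
  have "((\<lambda>x. \<Sum>m\<in>UNIV. scale_pair (entry m (f x)) (unit_pair m)) has_derivative
      (\<lambda>v. \<Sum>m\<in>UNIV. scale_pair (entry m (D v)) (unit_pair m))) F"
    by (intro has_derivative_sum bounded_linear.has_derivative[OF bounded_linear_scale_pair] assms)
  then show ?thesis using e[of f] e[of D] by simp
qed

definition complex_derivable :: "('n::finite mat_pair \<Rightarrow> complex) \<Rightarrow> 'n mat_pair \<Rightarrow> bool" where
  "complex_derivable h p \<longleftrightarrow> (\<exists>D. (h has_derivative D) (at p) \<and> (\<forall>c v. D (scale_pair c v) = c * D v))"

text \<open>A holomorphic inverse function theorem obtained from the real one. \<open>M\<close> is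
  the complex Jacobian matrix; polynomiality supplies the continuous derivative, and the inverse of
  a complex linear bijection is complex linear.\<close>

lemma polynomial_local_inverse:
  fixes F :: "'n::finite mat_pair \<Rightarrow> 'n mat_pair"
  assumes poly: "\<And>m. entry_polynomial (\<lambda>p. entry m (F p))"
    and der: "\<And>m. ((\<lambda>p. entry m (F p)) has_derivative (\<lambda>v. \<Sum>k\<in>UNIV. M $ m $ k * entry k v)) (at p)"
    and inv: "invertible M"
  obtains U V g where "open U" "open V" "p \<in> U" "homeomorphism U V F g"
    "\<And>m y. y \<in> V \<Longrightarrow> complex_derivable (\<lambda>y. entry m (g y)) y"
proof -
  have "\<forall>m. \<exists>f'. (\<forall>q. ((\<lambda>p. entry m (F p)) has_derivative f' q) (at q)) \<and>
      (\<forall>q c v. f' q (scale_pair c v) = c * f' q v) \<and> (\<forall>v. continuous_on UNIV (\<lambda>q. f' q v))"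
    using entry_polynomial_has_derivative[OF poly] by blast
  then obtain f' where f': "\<And>m q. ((\<lambda>p. entry m (F p)) has_derivative f' m q) (at q)"
    "\<And>m q c v. f' m q (scale_pair c v) = c * f' m q v" "\<And>m v. continuous_on UNIV (\<lambda>q. f' m q v)"
    by metis
  define D where "D = (\<lambda>q v. pair_of (\<lambda>m. f' m q v))"
  have D: "(F has_derivative D q) (at q)" for q
    by (rule has_derivative_pair) (simp add: D_def f')
  then have bl: "bounded_linear (D q)" for q by (rule has_derivative_bounded_linear)
  define B where "B = (\<lambda>q. Blinfun (D q))"
  have B: "blinfun_apply (B q) = D q" for q
    unfolding B_def by (rule bounded_linear_Blinfun_apply[OF bl])
  have "continuous_on UNIV (\<lambda>q. D q v)" for v
    unfolding continuous_on_pair_iff by (simp add: D_def f')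
  then have cB: "continuous_on UNIV B"
    by (intro continuous_on_blinfun_componentwise) (simp add: B)
  have Dp: "entry m (D p v) = (\<Sum>k\<in>UNIV. M $ m $ k * entry k v)" for m v
    using fun_cong[OF has_derivative_unique[OF f'(1)[of m p] der], of v] by (simp add: D_def)
  \<comment> \<open>An invertible Jacobian leaves no kernel; this yields the left inverse of the
    derivative that the inverse function theorem takes as input.\<close>
  have "v = 0" if "D p v = 0" for v
  proof -
    have "M *v (\<chi> k. entry k v) = 0"
      using that Dp[of _ v] by (simp add: vec_eq_iff matrix_vector_mult_def)
    then have "(\<chi> k. entry k v) = 0"
      by (metis inv matrix_inv_right(2) matrix_vector_mul_assoc matrix_vector_mul_lid matrix_vector_mult_0_right)
    then show ?thesis by (simp add: vec_eq_iff pair_eq_iff)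
  qed
  then have "inj (D p)"
    using linear_injective_0[OF bounded_linear.linear[OF bl]] by blast
  then obtain h where h: "linear h" "h \<circ> D p = id"
    using linear_injective_left_inverse[OF bounded_linear.linear[OF bl]] by blast
  have hb: "blinfun_apply (Blinfun h) = h"
    using h(1) by (intro bounded_linear_Blinfun_apply) (simp add: linear_conv_bounded_linear)
  have inv: "Blinfun h o\<^sub>L B p = id_blinfun"
    using fun_cong[OF h(2)] by (intro blinfun_eqI) (simp add: hb B)
  have D': "(F has_derivative blinfun_apply (B x)) (at x)" for x
    using D B by simp
  show ?thesis
  proof (rule inverse_function_theorem[OF open_UNIV D' cB UNIV_I inv])
    fix U V g g'
    assume UV: "open U" "p \<in> U" "open V" "homeomorphism U V F g"
      and g: "\<And>y. y \<in> V \<Longrightarrow> (g has_derivative (g' y)) (at y)"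
      "\<And>y. y \<in> V \<Longrightarrow> g' y = Hilbert_Choice.inv (blinfun_apply (B (g y)))"
      "\<And>y. y \<in> V \<Longrightarrow> bij (blinfun_apply (B (g y)))"
    show thesis
    proof (rule that[OF UV(1,3,2,4)])
      fix m y assume y: "y \<in> V"
      have "g' y (scale_pair c v) = scale_pair c (g' y v)" for c v
      proof -
        have bij: "bij (D (g y))" and g': "g' y = Hilbert_Choice.inv (D (g y))" using g(2,3)[OF y] by (auto simp: B)
        have "D (g y) (scale_pair c (g' y v)) = scale_pair c (D (g y) (g' y v))"
          by (simp add: D_def pair_eq_iff f')
        also have "\<dots> = scale_pair c v"
          unfolding g' using bij by (simp add: bij_is_surj surj_f_inv_f)
        finally show ?thesis
          unfolding g' using bij by (metis bij_is_inj inv_f_f)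
      qed
      then show "complex_derivable (\<lambda>y. entry m (g y)) y"
        unfolding complex_derivable_def
        by (intro exI[of _ "\<lambda>v. entry m (g' y v)"] conjI
            bounded_linear.has_derivative[OF bounded_linear_entry g(1)[OF y]]) simp
    qed
  qed
qed

text \<open>The Jacobian rows of the slice equations outside \<open>free_indices\<close> are
  independent, so they extend to an invertible matrix \<open>M'\<close>; its remaining rows are the
  linear functions put into the free positions of \<open>F\<close>.\<close>

lemma slice_coordinates:
  fixes p :: "'n::{finite,linorder} mat_pair"
  assumes p: "p \<in> zero_level" and b: "b first = 1" and Fr: "frame_matrix b p = mat 1"
  obtains F U V g where "\<And>m. entry_polynomial (\<lambda>p. entry m (F p))"
    "\<And>q m. m \<notin> free_indices \<Longrightarrow> entry m (F q) = entry m (slice_map b q)"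
    "open U" "open V" "p \<in> U" "homeomorphism U V F g"
    "\<And>m y. y \<in> V \<Longrightarrow> complex_derivable (\<lambda>y. entry m (g y)) y"
proof -
  have "\<forall>m. \<exists>f'. ((\<lambda>p. entry m (slice_map b p)) has_derivative f') (at p) \<and> (\<forall>c v. f' (scale_pair c v) = c * f' v)"
    using entry_polynomial_has_derivative[OF entry_polynomial_slice_map] by blast
  then obtain f' where f': "\<And>m. ((\<lambda>p. entry m (slice_map b p)) has_derivative f' m) (at p)"
    "\<And>m c v. f' m (scale_pair c v) = c * f' m v" by metis
  have exp: "f' m v = (\<Sum>k\<in>UNIV. f' m (unit_pair k) * entry k v)" for m v
    by (rule linear_complex_expansion[OF has_derivative_linear[OF f'(1)] f'(2)])
  define M :: "complex^(bool \<times> 'n \<times> 'n)^(bool \<times> 'n \<times> 'n)" where "M = (\<chi> m k. f' m (unit_pair k))"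
  have "c m = 0" if c: "\<And>m. m \<in> free_indices \<Longrightarrow> c m = 0" and s: "(\<Sum>m\<in>UNIV. c m *s row m M) = 0" for c m
  proof (rule slice_map_derivative_independent[where f' = f', OF p b Fr f'(1) c])
    fix v
    have k: "(\<Sum>m\<in>UNIV. c m * f' m (unit_pair k)) = 0" for k
      using arg_cong[OF s, of "\<lambda>x. x $ k"] by (simp add: row_def M_def)
    have "(\<Sum>m\<in>UNIV. c m * f' m v) = (\<Sum>m\<in>UNIV. \<Sum>k\<in>UNIV. c m * f' m (unit_pair k) * entry k v)"
      by (subst exp) (simp add: sum_distrib_left mult.assoc)
    also have "\<dots> = (\<Sum>k\<in>UNIV. (\<Sum>m\<in>UNIV. c m * f' m (unit_pair k)) * entry k v)"
      by (subst sum.swap) (simp add: sum_distrib_right)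
    finally show "(\<Sum>m\<in>UNIV. c m * f' m v) = 0" by (simp add: k)
  qed
  then obtain M' where M': "invertible M'" "\<And>m. m \<notin> free_indices \<Longrightarrow> row m M' = row m M"
    using extend_independent_rows[of free_indices M] by blast
  define F :: "'n mat_pair \<Rightarrow> 'n mat_pair" where
    "F = (\<lambda>q. pair_of (\<lambda>m. if m \<in> free_indices then \<Sum>k\<in>UNIV. M' $ m $ k * entry k q else entry m (slice_map b q)))"
  have poly: "entry_polynomial (\<lambda>p. entry m (F p))" for m
  proof (cases "m \<in> free_indices")
    case True
    then have "(\<lambda>q. entry m (F q)) = (\<lambda>q. \<Sum>k\<in>UNIV. M' $ m $ k * entry k q)" by (simp add: F_def)
    then show ?thesis
      by (auto intro!: entry_polynomial_sum entry_polynomial.mult entry_polynomial.const entry_polynomial.entry)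
  next
    case False
    then have "(\<lambda>q. entry m (F q)) = (\<lambda>q. entry m (slice_map b q))" by (simp add: F_def)
    then show ?thesis using entry_polynomial_slice_map by simp
  qed
  have der: "((\<lambda>p. entry m (F p)) has_derivative (\<lambda>v. \<Sum>k\<in>UNIV. M' $ m $ k * entry k v)) (at p)" for m
  proof (cases "m \<in> free_indices")
    case True
    have "((\<lambda>q. \<Sum>k\<in>UNIV. M' $ m $ k * entry k q) has_derivative (\<lambda>v. \<Sum>k\<in>UNIV. M' $ m $ k * entry k v)) (at p)"
      by (intro has_derivative_sum has_derivative_mult_right bounded_linear_imp_has_derivative bounded_linear_entry)
    then show ?thesis using True by (simp add: F_def)
  next
    case False
    have "M' $ m $ k = f' m (unit_pair k)" for k
      using arg_cong[OF M'(2)[OF False], of "\<lambda>x. x $ k"] by (simp add: row_def M_def)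
    then have "(\<Sum>k\<in>UNIV. M' $ m $ k * entry k v) = f' m v" for v
      using exp[of m v] by simp
    then have "(\<lambda>v. \<Sum>k\<in>UNIV. M' $ m $ k * entry k v) = f' m" by (rule ext)
    then show ?thesis using False f'(1)[of m] by (simp add: F_def)
  qed
  show ?thesis
  proof (rule polynomial_local_inverse[OF poly der M'(1)])
    fix U V g
    assume UVg: "open U" "open V" "p \<in> U" "homeomorphism U V F g"
      "\<And>m y. y \<in> V \<Longrightarrow> complex_derivable (\<lambda>y. entry m (g y)) y"
    show thesis
      by (rule that[OF poly _ UVg]) (simp add: F_def)
  qed
qed

text \<open>The coordinates of an ideal are the free entries of \<open>F\<close> at its section
  value; the inverse embeds the coordinates into the free positions, applies the local inverse
  \<open>g\<close> and takes the ideal. This fits together because the slice equations hold exactly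
  where all other positions of \<open>F\<close> vanish.\<close>

lemma hilbert_scheme_chart:
  fixes d :: nat
  assumes I0: "I0 \<in> hilb_points CARD('n::{finite,linorder})"
    and d: "d = card (free_indices :: (bool \<times> 'n \<times> 'n) set)"
  shows "\<exists>V W f g. openin (hilb_top CARD('n)) V \<and> I0 \<in> V \<and> openin (coord_space {..<d}) W \<and>
    biholomorphic_maps (open_subspace (hilbert_scheme CARD('n)) V) (open_subspace (affine_space d) W) f g"
proof -
  obtain p :: "'n mat_pair" where p: "p \<in> zero_level" "ideal_of p = I0" using ideal_of_surj[OF I0] by blast
  obtain b where b: "ideal_of p \<in> hilb_chart CARD('n) b" "b (idx (first :: 'n)) = 1"
    "nat_frame b p = mat 1"
    using chart_of_frame[OF p(1)] by blast
  let ?b = "\<lambda>i :: 'n. b (idx i)"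
  obtain F U V g where F: "\<And>m. entry_polynomial (\<lambda>p. entry m (F p))"
    "\<And>q m. m \<notin> free_indices \<Longrightarrow> entry m (F q) = entry m (slice_map ?b q)"
    and UV: "open U" "open V" "p \<in> U" "homeomorphism U V F g"
    and g: "\<And>m y. y \<in> V \<Longrightarrow> complex_derivable (\<lambda>y. entry m (g y)) y"
    using slice_coordinates[of p ?b] p(1) b(2,3) by blast
  have gF: "q \<in> U \<Longrightarrow> F q \<in> V \<and> g (F q) = q" and Fg: "y \<in> V \<Longrightarrow> g y \<in> U \<and> F (g y) = y" for q y
    using UV(4) by (auto simp: homeomorphism_def)
  have gc: "continuous_on V g" using UV(4) by (simp add: homeomorphism_def)
  obtain t where t: "bij_betw t {..<d} (free_indices :: (bool \<times> 'n \<times> 'n) set)"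
    using ex_bij_betw_nat_finite[of "free_indices :: (bool \<times> 'n \<times> 'n) set"] d by (auto simp: atLeast0LessThan)
  have tsurj: "\<exists>j<d. t j = m" if "m \<in> free_indices" for m
    using that bij_betw_imp_surj_on[OF t] by (metis imageE lessThan_iff)
  have tf: "t j \<in> free_indices" if "j < d" for j using bij_betwE[OF t] that by auto
  have tinj: "t j = t k \<longleftrightarrow> j = k" if "j < d" "k < d" for j k
    using bij_betw_imp_inj_on[OF t] that by (auto simp: inj_on_def)
  \<comment> \<open>The embedding of the coordinate space into the free positions, with base point
    \<open>0\<close> as in \<open>complex_differentiable_at_has_derivative\<close>.\<close>
  define i :: "(nat \<Rightarrow> complex) \<Rightarrow> 'n mat_pair" where
    "i = (\<lambda>w. 0 + (\<Sum>j<d. scale_pair (w j) (unit_pair (t j))))"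
  have i_free: "entry (t k) (i w) = w k" if "k < d" for k w
  proof -
    have "entry (t k) (i w) = (\<Sum>j<d. w j * (if t k = t j then 1 else 0))"
      by (simp add: i_def unit_pair_def)
    also have "\<dots> = (\<Sum>j<d. if j = k then w k else 0)"
      by (rule sum.cong) (use that tinj in auto)
    finally show ?thesis using that by simp
  qed
  have i_nfree: "entry m (i w) = 0" if "m \<notin> free_indices" for m w
    using that tf by (auto simp: i_def unit_pair_def intro!: sum.neutral)
  define H where "H = (\<lambda>q. \<lambda>j\<in>{..<d}. entry (t j) (F q))"
  have F_slice: "F q = i (H q)" if "slice_map ?b q = 0" for q
    unfolding pair_eq_iff
  proof
    fix m
    show "entry m (F q) = entry m (i (H q))"
    proof (cases "m \<in> free_indices")
      case True
      then obtain k where "k < d" "t k = m" using tsurj by blast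
      then show ?thesis using i_free by (auto simp: H_def)
    qed (simp add: F i_nfree that)
  qed
  \<comment> \<open>Outside the free positions \<open>F\<close> agrees with \<open>slice_map\<close>
    and \<open>i w\<close> is zero; at the free positions \<open>slice_map\<close> vanishes
    anyway.\<close>
  have slice: "slice_map ?b q = 0" if "F q = i w" for q w
    unfolding pair_eq_iff
  proof
    fix m show "entry m (slice_map ?b q) = entry m 0"
      using F(2)[of m q] i_nfree[of m w] slice_map_free_indices[of ?b m q] b(2) that
      by (cases "m \<in> free_indices") auto
  qed
  let ?C = "hilb_chart CARD('n) b"
  let ?s = "chart_section b :: _ \<Rightarrow> 'n mat_pair"
  have s_slice: "slice_map ?b (?s I) = 0" if "I \<in> ?C" for I
    using chart_section_mem[where b = b, OF that b(2)] frame_matrix_chart_section[where b = b, OF that b(2)]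
    by (cases "?s I") (simp add: slice_map_def zero_level_def zero_prod_def)
  define V' where "V' = {I \<in> ?C. ?s I \<in> U}"
  define W where "W = {w \<in> extensional {..<d}. i w \<in> V}"
  define h where "h = H \<circ> ?s"
  define k where "k = ideal_of \<circ> (g \<circ> i)"
  \<comment> \<open>The slice equations put \<open>g (i w)\<close> into the zero level with identity
    frame, so the section at its ideal returns the same pair.\<close>
  have giw: "g (i w) \<in> zero_level" "ideal_of (g (i w)) \<in> ?C" "?s (ideal_of (g (i w))) = g (i w)" if "w \<in> W" for w
  proof -
    have z: "slice_map ?b (g (i w)) = 0" using slice[of "g (i w)" w] Fg that by (simp add: W_def)
    show "g (i w) \<in> zero_level" by (rule slice_map_eq_0D[OF z])
    then show "ideal_of (g (i w)) \<in> ?C" "?s (ideal_of (g (i w))) = g (i w)"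
      using chart_section_ideal_of[of "g (i w)" b] b(2) slice_map_eq_0D[OF z] by auto
  qed
  have hV: "h I \<in> W" "k (h I) = I" if "I \<in> V'" for I
  proof -
    have I: "I \<in> ?C" "?s I \<in> U" using that by (auto simp: V'_def)
    have Fi: "i (h I) = F (?s I)" using F_slice[OF s_slice[OF I(1)]] by (simp add: h_def)
    show "h I \<in> W" unfolding W_def using gF[OF I(2)] Fi by (auto simp: h_def H_def)
    show "k (h I) = I"
      using gF[OF I(2)] Fi ideal_of_chart_section[where b = b, OF I(1) b(2)] by (simp add: k_def)
  qed
  have kW: "k w \<in> V'" "h (k w) = w" if "w \<in> W" for w
  proof -
    have iw: "i w \<in> V" and we: "w \<in> extensional {..<d}" using that by (auto simp: W_def)
    show "k w \<in> V'" using giw[OF that] Fg[OF iw] by (simp add: k_def V'_def)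
    have "h (k w) = H (g (i w))" using giw(3)[OF that] by (simp add: h_def k_def)
    also have "\<dots> = w"
      using Fg[OF iw] i_free we by (auto simp: H_def fun_eq_iff extensional_def)
    finally show "h (k w) = w" .
  qed
  let ?HC = "subtopology (hilb_top CARD('n)) ?C"
  have V'o: "openin ?HC V'"
  proof -
    have "openin (top_of_set zero_level) (zero_level \<inter> U)" using UV(1) by auto
    from openin_continuous_map_preimage[OF continuous_map_chart_section[where b = b, OF b(2)] this]
    have "openin ?HC {I \<in> ?C. ?s I \<in> zero_level \<inter> U}"
      unfolding topspace_subtopology_hilb_chart .
    moreover have "{I \<in> ?C. ?s I \<in> zero_level \<inter> U} = V'"
      using chart_section_mem[where b = b, OF _ b(2)] by (auto simp: V'_def)
    ultimately show ?thesis by simp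
  qed
  then have V'oh: "openin (hilb_top CARD('n)) V'"
    using openin_open_subtopology[OF openin_hilb_chart] by blast
  have I0V: "I0 \<in> V'"
    using b(1) p chart_section_ideal_of(2)[OF p(1) b(2,3)] UV(3) by (auto simp: V'_def)
  have proj: "continuous_map (coord_space {..<d}) euclidean (\<lambda>w. w j)" if "j < d" for j
    unfolding coord_space_def using that by (intro continuous_map_product_projection) auto
  have ic: "continuous_map (coord_space {..<d}) euclidean i"
  proof (rule continuous_map_pair)
    fix m
    show "continuous_map (coord_space {..<d}) euclidean (\<lambda>w. entry m (i w))"
    proof (cases "m \<in> free_indices")
      case True
      then obtain j where "j < d" "t j = m" using tsurj by blast
      then show ?thesis using i_free proj by auto
    qed (simp add: i_nfree)
  qed
  have Wo: "openin (coord_space {..<d}) W"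
    using openin_continuous_map_preimage[OF ic, of V] UV(2) by (simp add: W_def flip: open_openin)
  have "continuous_map (subtopology (hilb_top CARD('n)) V') euclidean ?s"
    using continuous_map_chart_section[where b = b, OF b(2)] V'_def
    by (auto simp: continuous_map_in_subtopology intro: continuous_map_from_subtopology_mono)
  then have "continuous_map (subtopology (hilb_top CARD('n)) V') euclidean (\<lambda>I. entry m (F (?s I)))" for m
    using continuous_map_compose[of _ euclidean ?s euclidean "\<lambda>q. entry m (F q)"]
      entry_polynomial_continuous_on[OF F(1)[of m], of UNIV] by (simp add: comp_def)
  then have hc: "continuous_map (subtopology (hilb_top CARD('n)) V') (subtopology (coord_space {..<d}) W) h"
    unfolding continuous_map_in_subtopology coord_space_def continuous_map_componentwise
    using hV(1) openin_subset[OF V'oh] by (auto simp: h_def H_def)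
  have giz: "continuous_map (subtopology (coord_space {..<d}) W) (top_of_set zero_level) (g \<circ> i)"
    unfolding continuous_map_in_subtopology
  proof
    have "continuous_map (subtopology (coord_space {..<d}) W) (top_of_set V) i"
      unfolding continuous_map_in_subtopology using ic
      by (auto simp: W_def intro: continuous_map_from_subtopology)
    moreover have "continuous_map (top_of_set V) euclidean g" using gc by simp
    ultimately show "continuous_map (subtopology (coord_space {..<d}) W) euclidean (g \<circ> i)"
      by (rule continuous_map_compose)
    show "g \<circ> i \<in> topspace (subtopology (coord_space {..<d}) W) \<rightarrow> zero_level" using giw(1) by auto
  qed
  then have "continuous_map (subtopology (coord_space {..<d}) W) (hilb_top CARD('n)) k"
    unfolding k_def using continuous_map_ideal_of by (rule continuous_map_compose)
  then have kc: "continuous_map (subtopology (coord_space {..<d}) W) (subtopology (hilb_top CARD('n)) V') k"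
    unfolding continuous_map_in_subtopology using kW(1) by auto
  let ?X = "open_subspace (hilbert_scheme CARD('n)) V'" and ?Y = "open_subspace (affine_space d) W"
  have Top: "Top ?X = subtopology (hilb_top CARD('n)) V'" "Top ?Y = subtopology (coord_space {..<d}) W"
    and Hol: "Hol ?X = Hol (hilbert_scheme CARD('n))" "Hol ?Y = holomorphic_near {..<d}"
    by (simp_all add: open_subspace_def hilbert_scheme_def affine_space_def)
  have "homeomorphic_maps (Top ?X) (Top ?Y) h k"
    unfolding homeomorphic_maps_def Top using hc kc hV(2) kW(2) by auto
  moreover have "holomorphic_map ?X ?Y h"
    unfolding holomorphic_map_def Top Hol
  proof (intro conjI hc ballI allI impI)
    fix I \<psi> assume "I \<in> topspace (subtopology (hilb_top CARD('n)) V')" and \<psi>: "holomorphic_near {..<d} \<psi> (h I)"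
    then have I: "I \<in> V'" "I \<in> ?C" by (auto simp: V'_def)
    have "holomorphic_near UNIV (\<lambda>w. \<psi> (\<lambda>j\<in>{..<d}. entry (t j) (F (pair_of w)) / 1)) (\<lambda>m. entry m (?s I))"
    proof (rule holomorphic_near_compose[OF finite finite_lessThan])
      show "holomorphic_near {..<d} \<psi> (\<lambda>j\<in>{..<d}. entry (t j) (F (pair_of (\<lambda>m. entry m (?s I)))) / 1)"
        using \<psi> by (simp add: h_def H_def)
      show "holomorphic_near UNIV (\<lambda>w. entry (t j) (F (pair_of w)) / 1) (\<lambda>m. entry m (?s I))" for j
        by (intro holomorphic_near_rational F(1) entry_polynomial.const) simp
    qed (simp add: extensional_def)
    then have "holomorphic_in_coords ?HC (basis_coeff CARD('n) b) (\<psi> \<circ> h) I"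
      by (rule holomorphic_in_coords_chart_section[where b = b, OF I(2) b(2) _ V'o I(1)])
        (simp add: h_def H_def)
    then show "Hol (hilbert_scheme CARD('n)) (\<psi> \<circ> h) I"
      using I(2) by (auto simp: hilbert_scheme_def)
  qed
  moreover have "holomorphic_map ?Y ?X k"
    unfolding holomorphic_map_def Top Hol
  proof (intro conjI kc ballI allI impI)
    fix w \<phi> assume "w \<in> topspace (subtopology (coord_space {..<d}) W)"
      and \<phi>: "Hol (hilbert_scheme CARD('n)) \<phi> (k w)"
    then have w: "w \<in> W" "w \<in> extensional {..<d}" by auto
    let ?q = "g (i w)"
    have "holomorphic_in_coords (top_of_set zero_level) entry (\<phi> \<circ> ideal_of) ?q"
      using \<phi> Hol_hilbert_scheme_iff[OF giw(1)[OF w(1)]] by (simp add: k_def)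
    then obtain G T where G: "holomorphic_near UNIV G (\<lambda>m. entry m ?q)" and
      T: "openin (top_of_set zero_level) T" "?q \<in> T" "\<And>q. q \<in> T \<Longrightarrow> (\<phi> \<circ> ideal_of) q = G (\<lambda>m. entry m q)"
      using holomorphic_in_coords_entryE by blast
    have cd: "complex_differentiable_at {..<d} (\<lambda>w. entry m (g (i w))) w" if "w \<in> W" for m w
    proof -
      have iw: "i w \<in> V" and we: "w \<in> extensional {..<d}" using that by (auto simp: W_def)
      obtain D where D: "((\<lambda>y. entry m (g y)) has_derivative D) (at (i w))" "\<And>c v. D (scale_pair c v) = c * D v"
        using g[OF iw] unfolding complex_derivable_def by blast
      show ?thesis
        unfolding i_def
        by (rule complex_differentiable_at_has_derivative[where s = scale_pair and D = D,
              OF finite_lessThan we bounded_linear_scale_pair D(1)[unfolded i_def] D(2)])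
    qed
    have "holomorphic_near {..<d} (\<lambda>w. entry m (g (i w))) w" for m
      unfolding holomorphic_near_def using Wo w(1) cd by blast
    \<comment> \<open>Near \<open>?q\<close> the pullback of \<open>\<phi>\<close> is the function
      \<open>G\<close> of the entries, and these depend holomorphically on \<open>w\<close> through
      \<open>g\<close> and \<open>i\<close>.\<close>
    then have hol: "holomorphic_near {..<d} (\<lambda>w. G (\<lambda>m\<in>UNIV. entry m (g (i w)))) w"
      by (intro holomorphic_near_compose[OF finite_lessThan finite _ w(2)]) (use G in simp_all)
    have "openin (subtopology (coord_space {..<d}) W) {v \<in> topspace (subtopology (coord_space {..<d}) W). (g \<circ> i) v \<in> T}"
      by (rule openin_continuous_map_preimage[OF giz T(1)])
    then have o: "openin (coord_space {..<d}) {v \<in> topspace (subtopology (coord_space {..<d}) W). (g \<circ> i) v \<in> T}"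
      using openin_open_subtopology[OF Wo] by blast
    show "holomorphic_near {..<d} (\<phi> \<circ> k) w"
      by (rule holomorphic_near_cong[OF hol o])
        (use w T in \<open>auto simp: k_def\<close>)
  qed
  ultimately have "biholomorphic_maps ?X ?Y h k" by (simp add: biholomorphic_maps_def)
  then show ?thesis using V'oh I0V Wo by blast
qed

lemma complex_manifold_hilbert_scheme: "complex_manifold (hilbert_scheme CARD('n::{finite,linorder}))"
proof -
  define d where "d = card (free_indices :: (bool \<times> 'n \<times> 'n) set)"
  have Top: "Top (hilbert_scheme CARD('n)) = hilb_top CARD('n)" "Top (affine_space d) = coord_space {..<d}"
    by (simp_all add: hilbert_scheme_def affine_space_def)
  show ?thesis
    unfolding complex_manifold_def
  proof (intro conjI exI[of _ d] ballI)
    show "Hausdorff_space (Top (hilbert_scheme CARD('n)))" unfolding Top by (rule Hausdorff_hilb_top)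
    show "second_countable (Top (hilbert_scheme CARD('n)))" unfolding Top by (rule second_countable_hilb_top)
    fix I assume "I \<in> topspace (Top (hilbert_scheme CARD('n)))"
    then have "I \<in> hilb_points CARD('n)" by (simp add: Top topspace_hilb_top)
    from hilbert_scheme_chart[OF this d_def]
    show "\<exists>V W f g. openin (Top (hilbert_scheme CARD('n))) V \<and> I \<in> V \<and> openin (Top (affine_space d)) W \<and>
        biholomorphic_maps (open_subspace (hilbert_scheme CARD('n)) V) (open_subspace (affine_space d) W) f g"
      unfolding Top .
  qed
qed

section \<open>Transport of the manifold structure along biholomorphic maps\<close>

lemma holomorphic_map_compose:
  assumes f: "holomorphic_map X Y f" and g: "holomorphic_map Y Z g"
  shows "holomorphic_map X Z (g \<circ> f)"
  unfolding holomorphic_map_def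
proof (intro conjI ballI allI impI)
  have fc: "continuous_map (Top X) (Top Y) f" and gc: "continuous_map (Top Y) (Top Z) g"
    using f g by (auto simp: holomorphic_map_def)
  then show "continuous_map (Top X) (Top Z) (g \<circ> f)" by (rule continuous_map_compose)
  fix p \<phi> assume p: "p \<in> topspace (Top X)" and "Hol Z \<phi> ((g \<circ> f) p)"
  moreover have "f p \<in> topspace (Top Y)" using fc p by (auto simp: continuous_map_def)
  ultimately have "Hol X ((\<phi> \<circ> g) \<circ> f) p" using f g by (simp add: holomorphic_map_def)
  then show "Hol X (\<phi> \<circ> (g \<circ> f)) p" by (simp add: comp_assoc)
qed

lemma biholomorphic_maps_compose:
  assumes "biholomorphic_maps X Y f g" "biholomorphic_maps Y Z h k"
  shows "biholomorphic_maps X Z (h \<circ> f) (g \<circ> k)"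
  using assms unfolding biholomorphic_maps_def
  by (blast intro: homeomorphic_maps_compose holomorphic_map_compose)

lemma biholomorphic_maps_open_subspace:
  assumes fg: "biholomorphic_maps X Y f g" and V: "V \<subseteq> topspace (Top Y)"
  shows "biholomorphic_maps (open_subspace X {p \<in> topspace (Top X). f p \<in> V}) (open_subspace Y V) f g"
proof -
  let ?U = "{p \<in> topspace (Top X). f p \<in> V}"
  have fc: "continuous_map (Top X) (Top Y) f" and gc: "continuous_map (Top Y) (Top X) g"
    and gf: "\<And>x. x \<in> topspace (Top X) \<Longrightarrow> g (f x) = x" and fg': "\<And>y. y \<in> topspace (Top Y) \<Longrightarrow> f (g y) = y"
    using fg by (auto simp: biholomorphic_maps_def homeomorphic_maps_def)
  have fc': "continuous_map (subtopology (Top X) ?U) (subtopology (Top Y) V) f"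
    using fc by (auto simp: continuous_map_in_subtopology intro: continuous_map_from_subtopology)
  have gV: "g y \<in> ?U" if "y \<in> V" for y
    using that V fg' continuous_map_image_subset_topspace[OF gc] by auto
  have gc': "continuous_map (subtopology (Top Y) V) (subtopology (Top X) ?U) g"
    using gc gV by (auto simp: continuous_map_in_subtopology intro: continuous_map_from_subtopology)
  show ?thesis
    unfolding biholomorphic_maps_def homeomorphic_maps_def holomorphic_map_def open_subspace_def holo_space.simps
  proof (intro conjI fc' gc' ballI allI impI)
    fix p \<phi> assume "p \<in> topspace (subtopology (Top X) ?U)" "Hol Y \<phi> (f p)"
    then show "Hol X (\<phi> \<circ> f) p"
      using fg by (simp add: biholomorphic_maps_def holomorphic_map_def)
  next
    fix y \<phi> assume "y \<in> topspace (subtopology (Top Y) V)" "Hol X \<phi> (g y)"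
    then show "Hol Y (\<phi> \<circ> g) y"
      using fg by (simp add: biholomorphic_maps_def holomorphic_map_def)
  qed (use gf fg' in simp_all)
qed

text \<open>\<open>biholomorphic\<close> demands a manifold on both sides; charts of
  \<open>Y\<close> composed with \<open>f\<close> serve as charts of \<open>X\<close>, of the same
  dimension.\<close>

lemma complex_manifold_biholomorphic:
  assumes fg: "biholomorphic_maps X Y f g" and Y: "complex_manifold Y"
  shows "complex_manifold X"
proof -
  have hm: "homeomorphic_maps (Top X) (Top Y) f g" using fg by (simp add: biholomorphic_maps_def)
  then have hs: "Top X homeomorphic_space Top Y" unfolding homeomorphic_space_def by blast
  have fc: "continuous_map (Top X) (Top Y) f" using hm by (simp add: homeomorphic_maps_def)
  obtain d where d: "\<forall>p \<in> topspace (Top Y). \<exists>V W f g.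
        openin (Top Y) V \<and> p \<in> V \<and> openin (Top (affine_space d)) W \<and>
        biholomorphic_maps (open_subspace Y V) (open_subspace (affine_space d) W) f g"
    using Y by (auto simp: complex_manifold_def)
  show ?thesis
    unfolding complex_manifold_def
  proof (intro conjI exI[of _ d] ballI)
    show "Hausdorff_space (Top X)" using Y homeomorphic_Hausdorff_space[OF hs] by (simp add: complex_manifold_def)
    show "second_countable (Top X)"
      using Y homeomorphic_space_second_countability[OF hs] by (simp add: complex_manifold_def)
    fix p assume p: "p \<in> topspace (Top X)"
    then have fp: "f p \<in> topspace (Top Y)" using fc by (auto simp: continuous_map_def)
    obtain V W h k where V: "openin (Top Y) V" "f p \<in> V" and W: "openin (Top (affine_space d)) W"
      and hk: "biholomorphic_maps (open_subspace Y V) (open_subspace (affine_space d) W) h k"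
      using bspec[OF d fp] by (elim exE conjE) (rule that)
    have "openin (Top X) {p \<in> topspace (Top X). f p \<in> V}"
      by (rule openin_continuous_map_preimage[OF fc V(1)])
    moreover have "biholomorphic_maps (open_subspace X {p \<in> topspace (Top X). f p \<in> V})
        (open_subspace (affine_space d) W) (h \<circ> f) (g \<circ> k)"
      by (rule biholomorphic_maps_compose[OF biholomorphic_maps_open_subspace[OF fg openin_subset[OF V(1)]] hk])
    moreover have "p \<in> {p \<in> topspace (Top X). f p \<in> V}" using p V(2) by simp
    ultimately show "\<exists>V W f g. openin (Top X) V \<and> p \<in> V \<and> openin (Top (affine_space d)) W \<and>
        biholomorphic_maps (open_subspace X V) (open_subspace (affine_space d) W) f g"
      using W by (intro exI conjI)
  qed
qed

theorem theorem1p5: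
  shows "free_action stab_group zero_level (conj_action (zero_level :: 'n::{finite,linorder} mat_pair set))
    \<and> proper_action stab_group zero_level (conj_action (zero_level :: 'n mat_pair set))
    \<and> biholomorphic (symplectic_quotient :: 'n mat_pair set holo_space) (hilbert_scheme CARD('n))"
proof (intro conjI free_action_zl_action proper_action_zl_action)
  obtain f g where "biholomorphic_maps (symplectic_quotient :: 'n mat_pair set holo_space) (hilbert_scheme CARD('n)) f g"
    by (rule biholomorphic_maps_symplectic_quotient)
  then show "biholomorphic (symplectic_quotient :: 'n mat_pair set holo_space) (hilbert_scheme CARD('n))"
    unfolding biholomorphic_def
    using complex_manifold_hilbert_scheme complex_manifold_biholomorphic by blast
qed

end
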